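(* Let $A$ be a bialgebra over a field $k$ and let $M,N$ be left-right Yetter-Drinfel'd modules over $A$. Let $H^*(M,N)$ be the cohomology of the total complex of the double complex $(Y^{n,p}(M,N),d_m^{n,p},d_c^{n,p})_{n,p\ge 0}$ defined in the context, and let $\mathrm{Ext}^1(M,N)$ be the group of equivalence classes of extensions of $M$ by $N$ in the category of left-right Yetter-Drinfel'd modules over $A$. Then the groups $H^1(M,N)$ and $\mathrm{Ext}^1(M,N)$ are isomorphic.
   Context: $k$ is a field, all linear spaces, tensor products and Homs are over $k$; $A^n$ denotes $A^{\otimes n}$ with $A^0=k$. Sweedler notation: $\Delta(a)=\sum a_1\otimes a_2$, iterated $\sum a_1\otimes\cdots\otimes a_{r}$. A left-right Yetter-Drinfel'd module over a bialgebra $A$ is a $k$-space $M$ that is a left $A$-module ($a\otimes m\mapsto a\cdot m$) and a right $A$-comodule ($\rho_M(m)=\sum m_0\otimes m_1\in M\otimes A$) with $$\sum (a_2\cdot m)_0\otimes (a_2\cdot m)_1a_1=\sum a_1\cdot m_0\otimes a_2m_1\quad\text{for all } a\in A,\ m\in M.$$ Morphisms are the $A$-linear and $A$-colinear maps; this category is abelian. An extension of $M$ by $N$ is a short exact sequence $0\to N\to E\to M\to 0$ in it; $\mathrm{Ext}^1(M,N)$ is the set of equivalence classes of such extensions, with group law the Baer sum. $Y^{n,p}(M,N)=\mathrm{Hom}(A^n\otimes M,N\otimes A^p)$ for $n,p\ge0$. For $f\in Y^{n,p}(M,N)$ write $f(x)=\sum f(x)^0\otimes f(x)^1\otimes\cdots\otimes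 f(x)^p$ with $f(x)^0\in N$ and $f(x)^j\in A$ for $j\ge1$. Superscripts on $a^1,\dots,a^n\in A$ are indices. Maps $b_i^{n,p}:Y^{n,p}\to Y^{n+1,p}$, $0\le i\le n+1$: - $b_0^{n,p}(f)(a^1\otimes\cdots\otimes a^{n+1}\otimes m)=\sum (a^1)_1\cdot f(x)^0\otimes (a^1)_2f(x)^1\otimes\cdots\otimes(a^1)_{p+1}f(x)^p$, with $x=a^2\otimes\cdots\otimes a^{n+1}\otimes m$; - $b_i^{n,p}(f)(a^1\otimes\cdots\otimes a^{n+1}\otimes m)=f(a^1\otimes\cdots\otimes a^ia^{i+1}\otimes\cdots\otimes a^{n+1}\otimes m)$ for $1\le i\le n$; - $b_{n+1}^{n,p}(f)(a^1\otimes\cdots\otimes a^{n+1}\otimes m)=\sum f(y)^0\otimes f(y)^1(a^{n+1})_1\otimes\cdots\otimes f(y)^p(a^{n+1})_p$, with $y=a^1\otimes\cdots\otimes a^n\otimes (a^{n+1})_{p+1}\cdot m$. Maps $c_i^{n,p}:Y^{n,p}\to Y^{n,p+1}$, $0\le i\le p+1$: - $c_0^{n,p}(f)(a^1\otimes\cdots\otimes a^n\otimes m)=\sum (f(z)^0)_0\otimes (f(z)^0)_1(a^1)_1\cdots(a^n)_1\otimes f(z)^1\otimes\cdots\otimes f(z)^p$, with $z=(a^1)_2\otimes\cdots\otimes(a^n)_2\otimes m$; - for $1\le i\le p$, $c_i^{n,p}(f)(x)=\sum f(x)^0\otimes\cdots\otimes (f(x)^i)_1\otimes(f(x)^i)_2\otimes\cdots\otimes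 f(x)^p$ ($\Delta$ applied to the $i$-th $A$-factor); - $c_{p+1}^{n,p}(f)(a^1\otimes\cdots\otimes a^n\otimes m)=\sum f((a^1)_1\otimes\cdots\otimes(a^n)_1\otimes m_0)\otimes (a^1)_2\cdots(a^n)_2m_1$. (Empty products, when $n=0$, equal $1$.) $d_m^{n,p}=\sum_{i=0}^{n+1}(-1)^ib_i^{n,p}$ and $d_c^{n,p}=\sum_{i=0}^{p+1}(-1)^ic_i^{n,p}$. These satisfy $d_md_m=0$, $d_cd_c=0$, $d_cd_m=d_md_c$. The total complex has degree-$r$ term $\bigoplus_{n+p=r}Y^{n,p}(M,N)$ and differential $d_m^{n,p}+(-1)^nd_c^{n,p}$ on $Y^{n,p}(M,N)$. *)

theory Defs
  imports
    Complex_Main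
    "HOL-Algebra.Coset"
    "HOL-Library.Function_Algebras"
    "HOL-Library.Product_Plus"
begin

section \<open>Tensor products and Sweedler sums\<close>

text \<open>
  Over a field, a tensor product of vector spaces embeds into the dual of the space of multilinear
  forms: the pure tensor of a tuple \<open>x\<close> is evaluation at \<open>x\<close>, and the tensor product is the span
  of the pure tensors. A \<open>multi\<close> consists of the admissible tuples and the multilinear forms on
  them. Lemma \<open>tsum_eq\<close> below is the universal property.
\<close>

record ('x, 'k) multi =
  gens :: "'x set"
  forms :: "('x \<Rightarrow> 'k) set"

type_synonym ('x, 'k) tensor = "('x \<Rightarrow> 'k) \<Rightarrow> 'k"

definition pure :: "('x, 'k::field) multi \<Rightarrow> 'x \<Rightarrow> ('x, 'k) tensor" where
  "pure T x = (\<lambda>\<beta>. if \<beta> \<in> forms T then \<beta> x else 0)"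

definition fscale :: "'k::field \<Rightarrow> ('i \<Rightarrow> 'k) \<Rightarrow> 'i \<Rightarrow> 'k" where
  "fscale c t = (\<lambda>i. c * t i)"

definition tspace :: "('x, 'k::field) multi \<Rightarrow> ('x, 'k) tensor set" where
  "tspace T = module.span fscale (pure T ` gens T)"

text \<open>
  Sweedler's notation: \<open>tsum T g t\<close> is the sum of \<open>g x\<close> over the tuples \<open>x\<close> of a chosen
  decomposition of \<open>t\<close> into pure tensors. For multilinear \<open>g\<close> the choice is irrelevant
  (\<open>tsum_eq\<close>). No coefficients are needed, since they can be absorbed into one of the factors;
  every space used below has at least one factor.
\<close>

definition tsum ::
  "('x, 'k::field) multi \<Rightarrow> ('x \<Rightarrow> 'w::comm_monoid_add) \<Rightarrow> ('x, 'k) tensor \<Rightarrow> 'w" where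
  "tsum T g t = (\<Sum>x\<leftarrow>(SOME r. set r \<subseteq> gens T \<and> (\<Sum>x\<leftarrow>r. pure T x) = t). g x)"

definition lin_on ::
  "'v::ab_group_add set \<Rightarrow> ('k \<Rightarrow> 'v \<Rightarrow> 'v) \<Rightarrow> ('k \<Rightarrow> 'w::ab_group_add \<Rightarrow> 'w) \<Rightarrow> ('v \<Rightarrow> 'w) \<Rightarrow> bool" where
  "lin_on S s1 s2 f \<longleftrightarrow>
     (\<forall>x\<in>S. \<forall>y\<in>S. f (x + y) = f x + f y) \<and> (\<forall>c. \<forall>x\<in>S. f (s1 c x) = s2 c (f x))"


section \<open>Bialgebras and Yetter-Drinfel'd modules\<close>

text \<open>The ring structure of the bialgebra is that of the type \<open>'a\<close>.\<close>

record ('a, 'k) bialg =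
  bscale :: "'k \<Rightarrow> 'a \<Rightarrow> 'a"
  comult :: "'a \<Rightarrow> ('a list, 'k) tensor"
  counit :: "'a \<Rightarrow> 'k"

text \<open>
  The underlying vector space of a module is a subspace \<open>space M\<close> of the vector space given by the
  type \<open>'v\<close> and \<open>scale M\<close>. Every vector space is of this form. The values of \<open>act M\<close> and
  \<open>coact M\<close> outside \<open>space M\<close> are irrelevant.
\<close>

record ('v, 'a, 'k) yd =
  space :: "'v set"
  scale :: "'k \<Rightarrow> 'v \<Rightarrow> 'v"
  act :: "'a \<Rightarrow> 'v \<Rightarrow> 'v"
  coact :: "'v \<Rightarrow> ('v \<times> 'a list, 'k) tensor"

text \<open>
  \<open>Apow A n\<close> is \<open>A^n\<close> (for \<open>n \<ge> 1\<close>), \<open>AM A n M\<close> is \<open>A^n \<otimes> M\<close>, and \<open>MA A M p\<close> is \<open>M \<otimes> A^p\<close>;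
  with \<open>A^0 = k\<close>, both \<open>AM A 0 M\<close> and \<open>MA A M 0\<close> are copies of \<open>M\<close>. The forms are multilinear on
  the ambient space of \<open>M\<close>; this gives the same tensor product as forms on \<open>space M\<close>, since over a
  field every linear map extends from a subspace.
\<close>

definition Apow :: "('a::ring_1, 'k::field) bialg \<Rightarrow> nat \<Rightarrow> ('a list, 'k) multi" where
  "Apow A n =
     \<lparr>gens = {as. length as = n},
      forms = {\<beta>. \<forall>as. length as = n \<longrightarrow>
        (\<forall>i<n. Vector_Spaces.linear (bscale A) (*) (\<lambda>x. \<beta> (as[i := x])))}\<rparr>"

definition AM :: "('a::ring_1, 'k::field) bialg \<Rightarrow> nat \<Rightarrow> ('m::ab_group_add, 'a, 'k) yd
    \<Rightarrow> ('a list \<times> 'm, 'k) multi" where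
  "AM A n M =
     \<lparr>gens = {(as, m). length as = n \<and> m \<in> space M},
      forms = {\<beta>. \<forall>as m. length as = n \<longrightarrow>
        (\<forall>i<n. Vector_Spaces.linear (bscale A) (*) (\<lambda>x. \<beta> (as[i := x], m))) \<and>
        Vector_Spaces.linear (scale M) (*) (\<lambda>x. \<beta> (as, x))}\<rparr>"

definition MA :: "('a::ring_1, 'k::field) bialg \<Rightarrow> ('m::ab_group_add, 'a, 'k) yd \<Rightarrow> nat
    \<Rightarrow> ('m \<times> 'a list, 'k) multi" where
  "MA A M p =
     \<lparr>gens = {(m, bs). m \<in> space M \<and> length bs = p},
      forms = {\<beta>. \<forall>m bs. length bs = p \<longrightarrow>
        (\<forall>i<p. Vector_Spaces.linear (bscale A) (*) (\<lambda>x. \<beta> (m, bs[i := x]))) \<and>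
        Vector_Spaces.linear (scale M) (*) (\<lambda>x. \<beta> (x, bs))}\<rparr>"

text \<open>
  In what follows, a Sweedler sum over \<open>comult A a\<close> has summation variable \<open>l = [a_1, a_2]\<close>, so
  \<open>l ! 0\<close> is \<open>a_1\<close> and \<open>l ! 1\<close> is \<open>a_2\<close>; a sum over \<open>coact M m\<close> has summation variable \<open>(m\<^sub>0, u)\<close>
  with \<open>u = [m_1]\<close>, so \<open>u ! 0\<close> is \<open>m_1\<close>.
\<close>

definition bialgebra :: "('a::ring_1, 'k::field) bialg \<Rightarrow> bool" where
  "bialgebra A \<longleftrightarrow>
     vector_space (bscale A) \<and>
     (\<forall>c x y. bscale A c x * y = bscale A c (x * y) \<and> x * bscale A c y = bscale A c (x * y)) \<and>
     \<comment> \<open>coalgebra\<close>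
     (\<forall>a. comult A a \<in> tspace (Apow A 2)) \<and>
     Vector_Spaces.linear (bscale A) fscale (comult A) \<and>
     Vector_Spaces.linear (bscale A) (*) (counit A) \<and>
     (\<forall>a. tsum (Apow A 2) (\<lambda>l. tsum (Apow A 2)
             (\<lambda>l'. pure (Apow A 3) [l' ! 0, l' ! 1, l ! 1]) (comult A (l ! 0))) (comult A a) =
          tsum (Apow A 2) (\<lambda>l. tsum (Apow A 2)
             (\<lambda>l'. pure (Apow A 3) [l ! 0, l' ! 0, l' ! 1]) (comult A (l ! 1))) (comult A a)) \<and>
     (\<forall>a. tsum (Apow A 2) (\<lambda>l. bscale A (counit A (l ! 0)) (l ! 1)) (comult A a) = a) \<and>
     (\<forall>a. tsum (Apow A 2) (\<lambda>l. bscale A (counit A (l ! 1)) (l ! 0)) (comult A a) = a) \<and>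
     \<comment> \<open>compatibility with the algebra structure\<close>
     (\<forall>a b. comult A (a * b) =
        tsum (Apow A 2) (\<lambda>l. tsum (Apow A 2)
          (\<lambda>l'. pure (Apow A 2) [l ! 0 * l' ! 0, l ! 1 * l' ! 1]) (comult A b)) (comult A a)) \<and>
     comult A 1 = pure (Apow A 2) [1, 1] \<and>
     (\<forall>a b. counit A (a * b) = counit A a * counit A b) \<and>
     counit A 1 = 1"

definition yd_module ::
  "('a::ring_1, 'k::field) bialg \<Rightarrow> ('m::ab_group_add, 'a, 'k) yd \<Rightarrow> bool" where
  "yd_module A M \<longleftrightarrow>
     vector_space (scale M) \<and> module.subspace (scale M) (space M) \<and>
     \<comment> \<open>left module\<close>
     (\<forall>a. \<forall>m\<in>space M. act M a m \<in> space M) \<and>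
     (\<forall>a. lin_on (space M) (scale M) (scale M) (act M a)) \<and>
     (\<forall>m\<in>space M. lin_on UNIV (bscale A) (scale M) (\<lambda>a. act M a m)) \<and>
     (\<forall>m\<in>space M. act M 1 m = m) \<and>
     (\<forall>a b. \<forall>m\<in>space M. act M (a * b) m = act M a (act M b m)) \<and>
     \<comment> \<open>right comodule\<close>
     (\<forall>m\<in>space M. coact M m \<in> tspace (MA A M 1)) \<and>
     lin_on (space M) (scale M) fscale (coact M) \<and>
     (\<forall>m\<in>space M.
        tsum (MA A M 1) (\<lambda>(m\<^sub>0, u). tsum (MA A M 1)
          (\<lambda>(m\<^sub>0', v). pure (MA A M 2) (m\<^sub>0', [v ! 0, u ! 0])) (coact M m\<^sub>0)) (coact M m) =
        tsum (MA A M 1) (\<lambda>(m\<^sub>0, u). tsum (Apow A 2)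
          (\<lambda>l. pure (MA A M 2) (m\<^sub>0, [l ! 0, l ! 1])) (comult A (u ! 0))) (coact M m)) \<and>
     (\<forall>m\<in>space M. tsum (MA A M 1) (\<lambda>(m\<^sub>0, u). scale M (counit A (u ! 0)) m\<^sub>0) (coact M m) = m) \<and>
     \<comment> \<open>Yetter-Drinfel'd compatibility\<close>
     (\<forall>a. \<forall>m\<in>space M.
        tsum (Apow A 2) (\<lambda>l. tsum (MA A M 1)
          (\<lambda>(x\<^sub>0, u). pure (MA A M 1) (x\<^sub>0, [u ! 0 * l ! 0])) (coact M (act M (l ! 1) m)))
          (comult A a) =
        tsum (Apow A 2) (\<lambda>l. tsum (MA A M 1)
          (\<lambda>(m\<^sub>0, u). pure (MA A M 1) (act M (l ! 0) m\<^sub>0, [l ! 1 * u ! 0])) (coact M m))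
          (comult A a))"

definition yd_hom :: "('a::ring_1, 'k::field) bialg \<Rightarrow> ('m::ab_group_add, 'a, 'k) yd
    \<Rightarrow> ('n::ab_group_add, 'a, 'k) yd \<Rightarrow> ('m \<Rightarrow> 'n) \<Rightarrow> bool" where
  "yd_hom A M N f \<longleftrightarrow>
     f ` space M \<subseteq> space N \<and>
     lin_on (space M) (scale M) (scale N) f \<and>
     (\<forall>a. \<forall>m\<in>space M. f (act M a m) = act N a (f m)) \<and>
     (\<forall>m\<in>space M.
        coact N (f m) = tsum (MA A M 1) (\<lambda>(m\<^sub>0, u). pure (MA A N 1) (f m\<^sub>0, u)) (coact M m))"

definition yd_sum :: "('a::ring_1, 'k::field) bialg \<Rightarrow> ('m::ab_group_add, 'a, 'k) yd
    \<Rightarrow> ('n::ab_group_add, 'a, 'k) yd \<Rightarrow> ('m \<times> 'n, 'a, 'k) yd" where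
  "yd_sum A M N =
     (let S = \<lparr>space = space M \<times> space N,
               scale = (\<lambda>c (x, y). (scale M c x, scale N c y)),
               act = (\<lambda>a (x, y). (act M a x, act N a y)),
               coact = (\<lambda>_. 0)\<rparr>
      in S\<lparr>coact := (\<lambda>(x, y).
            tsum (MA A M 1) (\<lambda>(x\<^sub>0, u). pure (MA A S 1) ((x\<^sub>0, 0), u)) (coact M x) +
            tsum (MA A N 1) (\<lambda>(y\<^sub>0, u). pure (MA A S 1) ((0, y\<^sub>0), u)) (coact N y))\<rparr>)"


section \<open>Extensions and the Baer sum\<close>

text \<open>An extension \<open>0 \<rightarrow> N \<rightarrow> E \<rightarrow> M \<rightarrow> 0\<close> is the triple of \<open>E\<close> and the two maps.\<close>

type_synonym ('e, 'm, 'n, 'a, 'k) ext = "('e, 'a, 'k) yd \<times> ('n \<Rightarrow> 'e) \<times> ('e \<Rightarrow> 'm)"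

definition extensions :: "('a::ring_1, 'k::field) bialg \<Rightarrow> ('m::ab_group_add, 'a, 'k) yd
    \<Rightarrow> ('n::ab_group_add, 'a, 'k) yd \<Rightarrow> ('e::ab_group_add, 'm, 'n, 'a, 'k) ext set" where
  "extensions A M N = {(E, i, p).
     yd_module A E \<and> yd_hom A N E i \<and> yd_hom A E M p \<and>
     inj_on i (space N) \<and> i ` space N = {e \<in> space E. p e = 0} \<and> p ` space E = space M}"

definition ext_equiv :: "('a::ring_1, 'k::field) bialg \<Rightarrow> ('m::ab_group_add, 'a, 'k) yd
    \<Rightarrow> ('n::ab_group_add, 'a, 'k) yd \<Rightarrow> ('d::ab_group_add, 'm, 'n, 'a, 'k) ext
    \<Rightarrow> ('e::ab_group_add, 'm, 'n, 'a, 'k) ext \<Rightarrow> bool" where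
  "ext_equiv A M N = (\<lambda>(D, i, p) (E, j, q).
     \<exists>\<phi>. yd_hom A D E \<phi> \<and> bij_betw \<phi> (space D) (space E) \<and>
         (\<forall>x\<in>space N. \<phi> (i x) = j x) \<and> (\<forall>d\<in>space D. q (\<phi> d) = p d))"

text \<open>
  A Baer sum of \<open>E\<^sub>1\<close> and \<open>E\<^sub>2\<close> is a quotient of their pullback over \<open>M\<close>, a subobject of \<open>E\<^sub>1 \<oplus> E\<^sub>2\<close>,
  by the antidiagonal copy of \<open>N\<close>. The map \<open>\<pi>\<close> is the quotient map.
\<close>

definition is_baer_sum :: "('a::ring_1, 'k::field) bialg \<Rightarrow> ('m::ab_group_add, 'a, 'k) yd
    \<Rightarrow> ('n::ab_group_add, 'a, 'k) yd \<Rightarrow> ('e::ab_group_add, 'm, 'n, 'a, 'k) ext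
    \<Rightarrow> ('e, 'm, 'n, 'a, 'k) ext \<Rightarrow> ('e, 'm, 'n, 'a, 'k) ext \<Rightarrow> bool" where
  "is_baer_sum A M N = (\<lambda>(E\<^sub>1, i\<^sub>1, p\<^sub>1) (E\<^sub>2, i\<^sub>2, p\<^sub>2) (E, i, p).
     let P = (yd_sum A E\<^sub>1 E\<^sub>2)
               \<lparr>space := {(x, y). x \<in> space E\<^sub>1 \<and> y \<in> space E\<^sub>2 \<and> p\<^sub>1 x = p\<^sub>2 y}\<rparr>
     in \<exists>\<pi>. yd_hom A P E \<pi> \<and> \<pi> ` space P = space E \<and>
            {z \<in> space P. \<pi> z = 0} = (\<lambda>n. (i\<^sub>1 n, - i\<^sub>2 n)) ` space N \<and>
            (\<forall>n\<in>space N. i n = \<pi> (i\<^sub>1 n, 0)) \<and>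
            (\<forall>(x, y)\<in>space P. p (\<pi> (x, y)) = p\<^sub>1 x))"

text \<open>
  The extensions considered have underlying set in the type \<open>'e\<close>, which serves as a universe. Once
  the vector space \<open>N \<oplus> M\<close> embeds into \<open>'e\<close>, every extension, of whatever type, is equivalent to one
  of these, since its underlying vector space is isomorphic to \<open>N \<oplus> M\<close>. The product of two classes
  is the class of the Baer sums of their members, and the unit is the class of the split extension.
\<close>

definition Ext1 :: "('a::ring_1, 'k::field) bialg \<Rightarrow> ('m::ab_group_add, 'a, 'k) yd
    \<Rightarrow> ('n::ab_group_add, 'a, 'k) yd \<Rightarrow> ('e::ab_group_add, 'm, 'n, 'a, 'k) ext set monoid" where
  "Ext1 A M N =
     \<lparr>carrier = extensions A M N //
        {(X, Y). X \<in> extensions A M N \<and> Y \<in> extensions A M N \<and> ext_equiv A M N X Y},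
      mult = (\<lambda>C D. {Z \<in> extensions A M N. \<exists>X\<in>C. \<exists>Y\<in>D. is_baer_sum A M N X Y Z}),
      one = {X \<in> extensions A M N. ext_equiv A M N (yd_sum A N M, (\<lambda>n. (n, 0)), snd) X}\<rparr>"


section \<open>The double complex\<close>

text \<open>
  Linear maps between tensor spaces are normalised to vanish off their domain, so that they are
  determined by their values on it.
\<close>

type_synonym ('m, 'n, 'a, 'k) ymap =
  "('a list \<times> 'm, 'k) tensor \<Rightarrow> ('n \<times> 'a list, 'k) tensor"

definition Yhom :: "('a::ring_1, 'k::field) bialg \<Rightarrow> ('m::ab_group_add, 'a, 'k) yd
    \<Rightarrow> ('n::ab_group_add, 'a, 'k) yd \<Rightarrow> nat \<Rightarrow> nat \<Rightarrow> ('m, 'n, 'a, 'k) ymap set" where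
  "Yhom A M N n p = {f.
     f ` tspace (AM A n M) \<subseteq> tspace (MA A N p) \<and>
     lin_on (tspace (AM A n M)) fscale fscale f \<and>
     (\<forall>t. t \<notin> tspace (AM A n M) \<longrightarrow> f t = 0)}"

definition lift :: "('x, 'k::field) multi \<Rightarrow> ('x \<Rightarrow> 'w::comm_monoid_add) \<Rightarrow> ('x, 'k) tensor \<Rightarrow> 'w" where
  "lift T g = (\<lambda>t. if t \<in> tspace T then tsum T g t else 0)"

text \<open>\<open>icomult A r a\<close> is the sum of the \<open>a_1 \<otimes> \<dots> \<otimes> a_(r+1)\<close>, an element of \<open>A^(r+1)\<close>.\<close>

primrec icomult :: "('a::ring_1, 'k::field) bialg \<Rightarrow> nat \<Rightarrow> 'a \<Rightarrow> ('a list, 'k) tensor" where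
  "icomult A 0 a = pure (Apow A 1) [a]"
| "icomult A (Suc r) a =
     tsum (Apow A 2) (\<lambda>l. tsum (Apow A (Suc r))
       (\<lambda>l'. pure (Apow A (Suc (Suc r))) (l ! 0 # l')) (icomult A r (l ! 1))) (comult A a)"

text \<open>
  \<open>comult_list A [a^1, \<dots>, a^n] F\<close> is the sum of
  \<open>F [(a^1)_1, \<dots>, (a^n)_1] [(a^1)_2, \<dots>, (a^n)_2]\<close>.
\<close>

primrec comult_list :: "('a::ring_1, 'k::field) bialg \<Rightarrow> 'a list
    \<Rightarrow> ('a list \<Rightarrow> 'a list \<Rightarrow> 'w::comm_monoid_add) \<Rightarrow> 'w" where
  "comult_list A [] F = F [] []"
| "comult_list A (a # as) F =
     tsum (Apow A 2) (\<lambda>l. comult_list A as (\<lambda>us vs. F (l ! 0 # us) (l ! 1 # vs))) (comult A a)"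

definition b_map :: "('a::ring_1, 'k::field) bialg \<Rightarrow> ('m::ab_group_add, 'a, 'k) yd
    \<Rightarrow> ('n::ab_group_add, 'a, 'k) yd \<Rightarrow> nat \<Rightarrow> nat \<Rightarrow> nat
    \<Rightarrow> ('m, 'n, 'a, 'k) ymap \<Rightarrow> ('m, 'n, 'a, 'k) ymap" where
  "b_map A M N n p i f = lift (AM A (n + 1) M) (\<lambda>(as, m).
     if i = 0 then
       tsum (Apow A (p + 1)) (\<lambda>l. tsum (MA A N p)
         (\<lambda>(y, bs). pure (MA A N p) (act N (hd l) y, map2 (*) (tl l) bs))
         (f (pure (AM A n M) (tl as, m)))) (icomult A p (hd as))
     else if i \<le> n then
       f (pure (AM A n M) (take (i - 1) as @ [as ! (i - 1) * as ! i] @ drop (i + 1) as, m))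
     else
       tsum (Apow A (p + 1)) (\<lambda>l. tsum (MA A N p)
         (\<lambda>(y, bs). pure (MA A N p) (y, map2 (*) bs (butlast l)))
         (f (pure (AM A n M) (butlast as, act M (last l) m)))) (icomult A p (last as)))"

definition c_map :: "('a::ring_1, 'k::field) bialg \<Rightarrow> ('m::ab_group_add, 'a, 'k) yd
    \<Rightarrow> ('n::ab_group_add, 'a, 'k) yd \<Rightarrow> nat \<Rightarrow> nat \<Rightarrow> nat
    \<Rightarrow> ('m, 'n, 'a, 'k) ymap \<Rightarrow> ('m, 'n, 'a, 'k) ymap" where
  "c_map A M N n p i f = lift (AM A n M) (\<lambda>(as, m).
     if i = 0 then
       comult_list A as (\<lambda>us vs. tsum (MA A N p) (\<lambda>(y, bs). tsum (MA A N 1)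
         (\<lambda>(y\<^sub>0, u). pure (MA A N (p + 1)) (y\<^sub>0, (u ! 0 * prod_list us) # bs)) (coact N y))
         (f (pure (AM A n M) (vs, m))))
     else if i \<le> p then
       tsum (MA A N p) (\<lambda>(y, bs). tsum (Apow A 2)
         (\<lambda>l. pure (MA A N (p + 1)) (y, take (i - 1) bs @ [l ! 0, l ! 1] @ drop i bs))
         (comult A (bs ! (i - 1)))) (f (pure (AM A n M) (as, m)))
     else
       comult_list A as (\<lambda>us vs. tsum (MA A M 1) (\<lambda>(m\<^sub>0, u). tsum (MA A N p)
         (\<lambda>(y, bs). pure (MA A N (p + 1)) (y, bs @ [prod_list vs * u ! 0]))
         (f (pure (AM A n M) (us, m\<^sub>0)))) (coact M m)))"

definition sgn_scale :: "nat \<Rightarrow> 'w::ab_group_add \<Rightarrow> 'w" where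
  "sgn_scale i x = (if even i then x else - x)"

definition d_m :: "('a::ring_1, 'k::field) bialg \<Rightarrow> ('m::ab_group_add, 'a, 'k) yd
    \<Rightarrow> ('n::ab_group_add, 'a, 'k) yd \<Rightarrow> nat \<Rightarrow> nat
    \<Rightarrow> ('m, 'n, 'a, 'k) ymap \<Rightarrow> ('m, 'n, 'a, 'k) ymap" where
  "d_m A M N n p f = (\<Sum>i\<le>n + 1. sgn_scale i (b_map A M N n p i f))"

definition d_c :: "('a::ring_1, 'k::field) bialg \<Rightarrow> ('m::ab_group_add, 'a, 'k) yd
    \<Rightarrow> ('n::ab_group_add, 'a, 'k) yd \<Rightarrow> nat \<Rightarrow> nat
    \<Rightarrow> ('m, 'n, 'a, 'k) ymap \<Rightarrow> ('m, 'n, 'a, 'k) ymap" where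
  "d_c A M N n p f = (\<Sum>i\<le>p + 1. sgn_scale i (c_map A M N n p i f))"

text \<open>An element of degree \<open>r\<close> is a family whose \<open>n\<close>-th member lies in \<open>Y^(n,r-n)\<close>.\<close>

definition Tot :: "('a::ring_1, 'k::field) bialg \<Rightarrow> ('m::ab_group_add, 'a, 'k) yd
    \<Rightarrow> ('n::ab_group_add, 'a, 'k) yd \<Rightarrow> nat \<Rightarrow> (nat \<Rightarrow> ('m, 'n, 'a, 'k) ymap) set" where
  "Tot A M N r = {F. (\<forall>n\<le>r. F n \<in> Yhom A M N n (r - n)) \<and> (\<forall>n>r. F n = 0)}"

definition tot_d :: "('a::ring_1, 'k::field) bialg \<Rightarrow> ('m::ab_group_add, 'a, 'k) yd
    \<Rightarrow> ('n::ab_group_add, 'a, 'k) yd \<Rightarrow> nat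
    \<Rightarrow> (nat \<Rightarrow> ('m, 'n, 'a, 'k) ymap) \<Rightarrow> nat \<Rightarrow> ('m, 'n, 'a, 'k) ymap" where
  "tot_d A M N r F = (\<lambda>n.
     (if 1 \<le> n \<and> n \<le> r + 1 then d_m A M N (n - 1) (r - (n - 1)) (F (n - 1)) else 0) +
     (if n \<le> r then sgn_scale n (d_c A M N n (r - n) (F n)) else 0))"

definition cocycles :: "('a::ring_1, 'k::field) bialg \<Rightarrow> ('m::ab_group_add, 'a, 'k) yd
    \<Rightarrow> ('n::ab_group_add, 'a, 'k) yd \<Rightarrow> nat \<Rightarrow> (nat \<Rightarrow> ('m, 'n, 'a, 'k) ymap) set" where
  "cocycles A M N r = {F \<in> Tot A M N r. tot_d A M N r F = 0}"

definition coboundaries :: "('a::ring_1, 'k::field) bialg \<Rightarrow> ('m::ab_group_add, 'a, 'k) yd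
    \<Rightarrow> ('n::ab_group_add, 'a, 'k) yd \<Rightarrow> nat \<Rightarrow> (nat \<Rightarrow> ('m, 'n, 'a, 'k) ymap) set" where
  "coboundaries A M N r = (if r = 0 then {0} else tot_d A M N (r - 1) ` Tot A M N (r - 1))"

definition Hcoh :: "('a::ring_1, 'k::field) bialg \<Rightarrow> ('m::ab_group_add, 'a, 'k) yd
    \<Rightarrow> ('n::ab_group_add, 'a, 'k) yd \<Rightarrow> nat \<Rightarrow> (nat \<Rightarrow> ('m, 'n, 'a, 'k) ymap) set monoid" where
  "Hcoh A M N r =
     \<lparr>carrier = cocycles A M N r, mult = (+), one = 0\<rparr> Mod coboundaries A M N r"


section \<open>Universal property of the tensor spaces\<close>

lemma vector_space_mult: "vector_space ((*) :: 'k::field \<Rightarrow> 'k \<Rightarrow> 'k)"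
  by unfold_locales (auto simp: algebra_simps)

lemma vector_space_fscale: "vector_space (fscale :: 'k::field \<Rightarrow> ('i \<Rightarrow> 'k) \<Rightarrow> 'i \<Rightarrow> 'k)"
  by unfold_locales (auto simp: fscale_def algebra_simps fun_eq_iff)

lemma sum_list_fun_apply: "(\<Sum>x\<leftarrow>r. h x) y = (\<Sum>x\<leftarrow>r. h x y)"
  for h :: "'x \<Rightarrow> 'i \<Rightarrow> 'w::comm_monoid_add"
  by (induction r) auto

text \<open>
  If the composites of \<open>g\<close> with linear functionals are multilinear forms, then the linear extension
  of \<open>g\<close> to the tensor space is well defined and is computed by \<open>tsum\<close>.
\<close>

lemma tsum_eq:
  fixes T :: "('x, 'k::field) multi" and g :: "'x \<Rightarrow> 'w::ab_group_add"
  assumes W: "vector_space sW"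
    and g: "\<And>\<phi>. Vector_Spaces.linear sW (*) \<phi> \<Longrightarrow> \<exists>\<beta>\<in>forms T. \<forall>x\<in>gens T. \<beta> x = \<phi> (g x)"
    and r: "set r \<subseteq> gens T"
  shows "tsum T g (\<Sum>x\<leftarrow>r. pure T x) = (\<Sum>x\<leftarrow>r. g x)"
proof -
  interpret W: vector_space sW by (rule W)
  interpret P: vector_space_pair sW "(*) :: 'k \<Rightarrow> 'k \<Rightarrow> 'k"
    by (intro vector_space_pair.intro W vector_space_mult)
  let ?Q = "\<lambda>r'. set r' \<subseteq> gens T \<and> (\<Sum>x\<leftarrow>r'. pure T x) = (\<Sum>x\<leftarrow>r. pure T x)"
  define r' where "r' = (SOME r'. ?Q r')"
  have "?Q r'" unfolding r'_def by (rule someI[of ?Q r]) (use r in auto)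
  hence r': "set r' \<subseteq> gens T" and eq: "(\<Sum>x\<leftarrow>r'. pure T x) = (\<Sum>x\<leftarrow>r. pure T x)" by auto
  have "(\<Sum>x\<leftarrow>r'. g x) = (\<Sum>x\<leftarrow>r. g x)"
  proof (rule ccontr)
    define w where "w = (\<Sum>x\<leftarrow>r'. g x) - (\<Sum>x\<leftarrow>r. g x)"
    assume "\<not> ?thesis"
    hence "w \<noteq> 0" by (simp add: w_def)
    hence ind: "W.independent {w}" by (simp add: W.dependent_single)
    define \<phi> where "\<phi> = P.construct {w} (\<lambda>_. 1)"
    have lin: "Vector_Spaces.linear sW (*) \<phi>"
      unfolding \<phi>_def by (rule P.linear_construct[OF ind])
    have "\<phi> w = 1" unfolding \<phi>_def by (rule P.construct_basis[OF ind]) simp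
    interpret L: Vector_Spaces.linear sW "(*)" \<phi> by (rule lin)
    obtain \<beta> where \<beta>: "\<beta> \<in> forms T" "\<And>x. x \<in> gens T \<Longrightarrow> \<beta> x = \<phi> (g x)"
      using g[OF lin] by blast
    have ev: "(\<Sum>x\<leftarrow>s. pure T x) \<beta> = \<phi> (\<Sum>x\<leftarrow>s. g x)" if "set s \<subseteq> gens T" for s
      using that by (induction s) (auto simp: pure_def \<beta> L.add L.zero)
    have "\<phi> (\<Sum>x\<leftarrow>r'. g x) = \<phi> (\<Sum>x\<leftarrow>r. g x)"
      using ev[OF r'] ev[OF r] eq by simp
    hence "\<phi> w = 0" by (simp add: w_def L.diff)
    with \<open>\<phi> w = 1\<close> show False by simp
  qed
  thus ?thesis by (simp add: tsum_def r'_def)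
qed

lemma linear_comp_functional:
  "Vector_Spaces.linear s sW h \<Longrightarrow> Vector_Spaces.linear sW t \<phi> \<Longrightarrow>
   Vector_Spaces.linear s t (\<lambda>x. \<phi> (h x))"
  using Vector_Spaces.linear_compose[of s sW h t \<phi>] by (simp add: o_def)

lemma tsum_eq_Apow:
  fixes g :: "'a::ring_1 list \<Rightarrow> 'w::ab_group_add"
  assumes "vector_space sW"
    and "\<And>as i. length as = n \<Longrightarrow> i < n \<Longrightarrow>
           Vector_Spaces.linear (bscale A) sW (\<lambda>x. g (as[i := x]))"
    and "set r \<subseteq> gens (Apow A n)"
  shows "tsum (Apow A n) g (\<Sum>x\<leftarrow>r. pure (Apow A n) x) = (\<Sum>x\<leftarrow>r. g x)"
proof (rule tsum_eq[OF assms(1) _ assms(3)])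
  fix \<phi> :: "'w \<Rightarrow> 'b" assume \<phi>: "Vector_Spaces.linear sW (*) \<phi>"
  show "\<exists>\<beta>\<in>forms (Apow A n). \<forall>x\<in>gens (Apow A n). \<beta> x = \<phi> (g x)"
    by (rule bexI[of _ "\<lambda>x. \<phi> (g x)"])
       (auto simp: Apow_def intro: linear_comp_functional[OF assms(2) \<phi>])
qed

lemma subspace_projection:
  assumes "vector_space s" and "module.subspace s S"
  obtains \<pi> where "Vector_Spaces.linear s s \<pi>" "range \<pi> \<subseteq> S" "\<And>x. x \<in> S \<Longrightarrow> \<pi> x = x"
proof -
  interpret V: vector_space s by fact
  interpret P: vector_space_pair s s by (intro vector_space_pair.intro assms)
  have "\<exists>g. range g \<subseteq> S \<and> Vector_Spaces.linear s s g \<and> (\<forall>v\<in>S. g (id v) = v)"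
    by (rule P.linear_exists_left_inverse_on) (auto simp: assms V.linear_id V.linear_id[unfolded id_def])
  thus ?thesis using that by auto
qed

lemma linear_lin_on_projection:
  assumes "lin_on S s sW h" "Vector_Spaces.linear s s \<pi>" "range \<pi> \<subseteq> S" "vector_space sW"
  shows "Vector_Spaces.linear s sW (\<lambda>x. h (\<pi> x))"
proof -
  interpret L: Vector_Spaces.linear s s \<pi> by fact
  interpret W: vector_space sW by fact
  have "\<pi> x \<in> S" for x using assms(3) by auto
  thus ?thesis using assms(1)
    by unfold_locales (auto simp: lin_on_def L.add L.scale)
qed

lemma tsum_eq_MA:
  fixes g :: "'m::ab_group_add \<times> 'a::ring_1 list \<Rightarrow> 'w::ab_group_add"
  assumes W: "vector_space sW"
    and M: "vector_space (scale M)" "module.subspace (scale M) (space M)"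
    and lin: "\<And>m bs i. m \<in> space M \<Longrightarrow> length bs = p \<Longrightarrow> i < p \<Longrightarrow>
           Vector_Spaces.linear (bscale A) sW (\<lambda>x. g (m, bs[i := x]))"
       "\<And>bs. length bs = p \<Longrightarrow> lin_on (space M) (scale M) sW (\<lambda>x. g (x, bs))"
    and r: "set r \<subseteq> gens (MA A M p)"
  shows "tsum (MA A M p) g (\<Sum>x\<leftarrow>r. pure (MA A M p) x) = (\<Sum>x\<leftarrow>r. g x)"
proof (rule tsum_eq[OF W _ r])
  fix \<phi> :: "'w \<Rightarrow> 'b" assume \<phi>: "Vector_Spaces.linear sW (*) \<phi>"
  obtain \<pi> where \<pi>: "Vector_Spaces.linear (scale M) (scale M) \<pi>" "range \<pi> \<subseteq> space M"
    "\<And>x. x \<in> space M \<Longrightarrow> \<pi> x = x"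
    using subspace_projection[OF M] by blast
  have "\<pi> m \<in> space M" for m using \<pi>(2) by auto
  thus "\<exists>\<beta>\<in>forms (MA A M p). \<forall>x\<in>gens (MA A M p). \<beta> x = \<phi> (g x)"
    by (intro bexI[of _ "\<lambda>(m, bs). \<phi> (g (\<pi> m, bs))"])
       (auto simp: MA_def \<pi>(3) intro!: linear_comp_functional[OF _ \<phi>] lin
          linear_lin_on_projection[OF lin(2) \<pi>(1,2) W])
qed

lemma tsum_eq_AM:
  fixes g :: "'a::ring_1 list \<times> 'm::ab_group_add \<Rightarrow> 'w::ab_group_add"
  assumes W: "vector_space sW"
    and M: "vector_space (scale M)" "module.subspace (scale M) (space M)"
    and lin: "\<And>as m i. m \<in> space M \<Longrightarrow> length as = n \<Longrightarrow> i < n \<Longrightarrow>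
           Vector_Spaces.linear (bscale A) sW (\<lambda>x. g (as[i := x], m))"
       "\<And>as. length as = n \<Longrightarrow> lin_on (space M) (scale M) sW (\<lambda>x. g (as, x))"
    and r: "set r \<subseteq> gens (AM A n M)"
  shows "tsum (AM A n M) g (\<Sum>x\<leftarrow>r. pure (AM A n M) x) = (\<Sum>x\<leftarrow>r. g x)"
proof (rule tsum_eq[OF W _ r])
  fix \<phi> :: "'w \<Rightarrow> 'b" assume \<phi>: "Vector_Spaces.linear sW (*) \<phi>"
  obtain \<pi> where \<pi>: "Vector_Spaces.linear (scale M) (scale M) \<pi>" "range \<pi> \<subseteq> space M"
    "\<And>x. x \<in> space M \<Longrightarrow> \<pi> x = x"
    using subspace_projection[OF M] by blast
  have "\<pi> m \<in> space M" for m using \<pi>(2) by auto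
  thus "\<exists>\<beta>\<in>forms (AM A n M). \<forall>x\<in>gens (AM A n M). \<beta> x = \<phi> (g x)"
    by (intro bexI[of _ "\<lambda>(as, m). \<phi> (g (as, \<pi> m))"])
       (auto simp: AM_def \<pi>(3) intro!: linear_comp_functional[OF _ \<phi>] lin
          linear_lin_on_projection[OF lin(2) \<pi>(1,2) W])
qed

end

theory Submission
  imports Defs
begin

text \<open>
  A linear splitting of an extension \<open>E\<close> of \<open>M\<close> by \<open>N\<close> identifies \<open>E\<close> with \<open>N \<oplus> M\<close>, with action
  \<open>a \<cdot> (n, m) = (a \<cdot> n + \<omega>(a, m), a \<cdot> m)\<close> and coaction \<open>\<rho>(n) + \<rho>(m) + \<theta>(m)\<close> for linear maps
  \<open>\<omega> : A \<otimes> M \<rightarrow> N\<close> and \<open>\<theta> : M \<rightarrow> N \<otimes> A\<close>. Such a pair is a cochain of degree one. Associativity of the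
  twisted action is \<open>d\<^sub>m \<omega> = 0\<close>, coassociativity of the twisted coaction is \<open>d\<^sub>c \<theta> = 0\<close>, and the
  Yetter-Drinfel'd condition is \<open>d\<^sub>m \<theta> = d\<^sub>c \<omega>\<close>; unit and counit axioms follow. An equivalence of
  two twisted extensions is a shear \<open>(n, m) \<mapsto> (n + \<phi>(m), m)\<close>, which changes the pair by the coboundary
  of \<open>\<phi>\<close>, and a Baer sum of twisted extensions is twisted by the sum of the pairs.

  Identities between tensors are checked by evaluating both sides at scalar-valued multilinear
  functions, where Sweedler sums become finite sums of scalars.
\<close>

section \<open>Tensors as functionals on forms\<close>

text \<open>The cocycle identities are matched with the axioms only once, in
  \<open>tw_yd_module_iff\<close>. For a split extension, for a shear and for a coboundary they are
  not computed but obtained by carrying a known structure along a linear surjection, with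
  \<open>yd_image\<close>. Two obstacles shape the rest. A Sweedler sum runs over an arbitrarily
  chosen decomposition, so a nested sum can be transformed only once its inner sum is known to be
  multilinear; this is the source of the recurring conditions \<open>bil\<close> and
  \<open>tril\<close>. Forms, moreover, are linear on the whole ambient type, whereas actions,
  coactions and cochains make sense on \<open>space M\<close> only; test functions are therefore
  multilinear on the subspace and are extended by a linear projection. Finally, twisted modules live
  on \<open>'n \<times> 'm\<close> and the classes of \<open>Ext1\<close> on \<open>'e\<close>, so
  equivalences relate extensions on different types. The group laws of \<open>Ext1\<close> are
  inherited from the group of cocycles through a surjective multiplicative map.\<close>

lemma tsum_apply: "tsum T g t i = tsum T (\<lambda>x. g x i) t"
  for g :: "'x \<Rightarrow> 'i \<Rightarrow> 'w::comm_monoid_add"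
  by (simp add: tsum_def sum_list_fun_apply)

lemma tsum_plus: "tsum T (\<lambda>x. g x + h x) t = tsum T g t + tsum T h t"
  by (simp add: tsum_def sum_list_addf)

lemma tsum_minus: "tsum T (\<lambda>x. g x - h x) t = tsum T g t - tsum T h t"
  for g :: "'x \<Rightarrow> 'w::ab_group_add"
  by (simp add: tsum_def sum_list_subtractf)

lemma tsum_additive:
  assumes "f 0 = 0" "\<And>x y. f (x + y) = f x + f y"
  shows "f (tsum T g t) = tsum T (\<lambda>x. f (g x)) t"
proof -
  have "f (\<Sum>x\<leftarrow>r. g x) = (\<Sum>x\<leftarrow>r. f (g x))" for r
    by (induction r) (auto simp: assms)
  thus ?thesis by (simp add: tsum_def)
qed

lemma tsum_mult: "c * tsum T g t = tsum T (\<lambda>x. c * g x) t"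
  for g :: "'x \<Rightarrow> 'w::ring"
  by (rule tsum_additive[of "\<lambda>x. c * x"]) (auto simp: distrib_left)

lemma tsum_zero: "tsum T (\<lambda>_. 0) t = 0"
  by (simp add: tsum_def)

text \<open>A Sweedler sum uses a decomposition without coefficients, whereas \<open>tspace\<close>
  is a span. This is the condition that reconciles the two. It fails for \<open>Apow A 0\<close>,
  which has no factor to take the scalar.\<close>

definition absorbs :: "('x, 'k::field) multi \<Rightarrow> bool" where
  "absorbs T \<longleftrightarrow> (\<forall>c. \<forall>x\<in>gens T. \<exists>x'\<in>gens T. pure T x' = fscale c (pure T x))"

lemma tspace_0: "0 \<in> tspace T"
  and tspace_add: "s \<in> tspace T \<Longrightarrow> t \<in> tspace T \<Longrightarrow> s + t \<in> tspace T"
  and tspace_diff: "s \<in> tspace T \<Longrightarrow> t \<in> tspace T \<Longrightarrow> s - t \<in> tspace T"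
  and tspace_scale: "t \<in> tspace T \<Longrightarrow> fscale c t \<in> tspace T"
  and tspace_pure: "x \<in> gens T \<Longrightarrow> pure T x \<in> tspace T"
proof -
  interpret vector_space fscale by (rule vector_space_fscale)
  show "0 \<in> tspace T"
    and "s \<in> tspace T \<Longrightarrow> t \<in> tspace T \<Longrightarrow> s + t \<in> tspace T"
    and "s \<in> tspace T \<Longrightarrow> t \<in> tspace T \<Longrightarrow> s - t \<in> tspace T"
    and "t \<in> tspace T \<Longrightarrow> fscale c t \<in> tspace T"
    and "x \<in> gens T \<Longrightarrow> pure T x \<in> tspace T"
    unfolding tspace_def by (auto intro: span_zero span_add span_diff span_scale span_base)
qed

lemma tspace_sum_list: "\<forall>x\<in>set r. h x \<in> tspace T \<Longrightarrow> (\<Sum>x\<leftarrow>r. h x) \<in> tspace T"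
  by (induction r) (auto intro: tspace_0 tspace_add)

lemma tspace_decomp:
  assumes "absorbs T" "t \<in> tspace T"
  shows "\<exists>r. set r \<subseteq> gens T \<and> (\<Sum>x\<leftarrow>r. pure T x) = t"
proof -
  interpret vector_space fscale by (rule vector_space_fscale)
  show ?thesis
    using assms(2) unfolding tspace_def
  proof (induction rule: span_induct_alt)
    case base
    show ?case by (rule exI[of _ "[]"]) auto
  next
    case (step c x y)
    then obtain g where g: "g \<in> gens T" "x = pure T g" by blast
    obtain r where r: "set r \<subseteq> gens T" "(\<Sum>x\<leftarrow>r. pure T x) = y"
      using step.IH by blast
    obtain g' where g': "g' \<in> gens T" "pure T g' = fscale c x"
      using assms(1) g unfolding absorbs_def by blast
    show ?case by (rule exI[of _ "g' # r"]) (simp add: g' r)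
  qed
qed

lemma tsum_rep:
  assumes "absorbs T" "t \<in> tspace T"
  shows "set (SOME r. set r \<subseteq> gens T \<and> (\<Sum>x\<leftarrow>r. pure T x) = t) \<subseteq> gens T"
    and "(\<Sum>x\<leftarrow>(SOME r. set r \<subseteq> gens T \<and> (\<Sum>x\<leftarrow>r. pure T x) = t). pure T x) = t"
  using someI_ex[OF tspace_decomp[OF assms]] by auto

text \<open>The chosen decomposition consists of generators. This is what allows rewriting under a
  sum with identities that hold on \<open>space M\<close> alone.\<close>

lemma tsum_cong:
  assumes "absorbs T" "t \<in> tspace T" "\<And>x. x \<in> gens T \<Longrightarrow> g x = h x"
  shows "tsum T g t = tsum T h t"
  using tsum_rep(1)[OF assms(1,2)] assms(3) unfolding tsum_def
  by (intro arg_cong[of _ _ sum_list] map_cong) auto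

lemma tsum_in_tspace:
  assumes "absorbs T" "t \<in> tspace T" "\<And>x. x \<in> gens T \<Longrightarrow> h x \<in> tspace T'"
  shows "tsum T h t \<in> tspace T'"
  unfolding tsum_def using tsum_rep(1)[OF assms(1,2)] assms(3) by (intro tspace_sum_list) auto

lemma tsum_pure_id: "absorbs T \<Longrightarrow> t \<in> tspace T \<Longrightarrow> tsum T (pure T) t = t"
  using tsum_rep(2) unfolding tsum_def by auto

lemma sum_list_pure_form:
  "\<beta> \<in> forms T \<Longrightarrow> (\<Sum>x\<leftarrow>r. pure T x) \<beta> = (\<Sum>x\<leftarrow>r. \<beta> x)"
  by (simp add: sum_list_fun_apply pure_def)

text \<open>Evaluating a tensor at \<open>\<beta>\<close> adds up the values of
  \<open>\<beta>\<close> over any decomposition. A scalar Sweedler sum whose summand is a form on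
  the generators is thus independent of the choice, and linear in the tensor.\<close>

lemma tsum_form:
  assumes "absorbs T" "t \<in> tspace T" "\<beta> \<in> forms T" "\<And>x. x \<in> gens T \<Longrightarrow> \<beta> x = g x"
  shows "tsum T g t = t \<beta>"
proof -
  have "tsum T g t = tsum T \<beta> t" by (rule tsum_cong) (use assms in auto)
  also have "\<dots> = t \<beta>"
    unfolding tsum_def sum_list_pure_form[OF assms(3), symmetric] tsum_rep(2)[OF assms(1,2)] ..
  finally show ?thesis .
qed

text \<open>
  Evaluation at a form that agrees with \<open>g\<close> turns the nested sum into a finite sum of scalars.
\<close>

lemma tsum_pure_form:
  assumes "absorbs T" "t \<in> tspace T" "\<And>x. x \<in> gens T \<Longrightarrow> h x \<in> gens T'"
    and "absorbs T'" "\<beta> \<in> forms T'" "\<And>x. x \<in> gens T' \<Longrightarrow> \<beta> x = g x"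
  shows "tsum T' g (tsum T (\<lambda>x. pure T' (h x)) t) = tsum T (\<lambda>x. g (h x)) t"
proof -
  have "tsum T' g (tsum T (\<lambda>x. pure T' (h x)) t) = tsum T (\<lambda>x. pure T' (h x)) t \<beta>"
    by (rule tsum_form) (use assms in \<open>auto intro!: tsum_in_tspace tspace_pure\<close>)
  also have "\<dots> = tsum T (\<lambda>x. \<beta> (h x)) t"
    using assms(5) by (simp add: tsum_apply pure_def)
  also have "\<dots> = tsum T (\<lambda>x. g (h x)) t"
    by (rule tsum_cong) (use assms in auto)
  finally show ?thesis .
qed

lemma tspace_off_forms: "t \<in> tspace T \<Longrightarrow> \<beta> \<notin> forms T \<Longrightarrow> t \<beta> = 0"
proof -
  interpret vector_space fscale by (rule vector_space_fscale)
  assume "t \<in> tspace T" "\<beta> \<notin> forms T"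
  thus "t \<beta> = 0"
    unfolding tspace_def by (induction rule: span_induct_alt) (auto simp: fscale_def pure_def)
qed

text \<open>\<open>pure\<close> is set to vanish off the forms and the span inherits this, so a
  tensor is determined by its values at forms.\<close>

lemma tspace_eqI:
  "s \<in> tspace T \<Longrightarrow> t \<in> tspace T \<Longrightarrow> (\<And>\<beta>. \<beta> \<in> forms T \<Longrightarrow> s \<beta> = t \<beta>) \<Longrightarrow> s = t"
proof (rule ext)
  fix \<beta> assume "s \<in> tspace T" "t \<in> tspace T" "\<And>\<beta>. \<beta> \<in> forms T \<Longrightarrow> s \<beta> = t \<beta>"
  thus "s \<beta> = t \<beta>" by (cases "\<beta> \<in> forms T") (simp_all add: tspace_off_forms)
qed

section \<open>Linear functions\<close>

lemma linear_iff_lin_on: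
  "Vector_Spaces.linear s1 s2 f \<longleftrightarrow> vector_space s1 \<and> vector_space s2 \<and> lin_on UNIV s1 s2 f"
  unfolding Vector_Spaces.linear_iff lin_on_def by blast

text \<open>Only the linear part of a module record, so that facts about tensors are available for
  records whose action and coaction are still to be verified.\<close>

definition vsub :: "('v::ab_group_add, 'a, 'k::field) yd \<Rightarrow> bool" where
  "vsub V \<longleftrightarrow> vector_space (scale V) \<and> module.subspace (scale V) (space V)"

lemma vsub_0: "vsub V \<Longrightarrow> 0 \<in> space V"
  and vsub_add: "vsub V \<Longrightarrow> x \<in> space V \<Longrightarrow> y \<in> space V \<Longrightarrow> x + y \<in> space V"
  and vsub_scale: "vsub V \<Longrightarrow> x \<in> space V \<Longrightarrow> scale V c x \<in> space V"
  unfolding vsub_def using module.subspace_def[of "scale V" "space V"] module_iff_vector_space[of "scale V"]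
  by blast+

lemma vsub_minus: assumes "vsub V" "x \<in> space V" shows "- x \<in> space V"
proof -
  interpret vector_space "scale V" using assms by (simp add: vsub_def)
  show ?thesis using vsub_scale[OF assms, of "- 1"] by simp
qed

lemma vsub_diff: "vsub V \<Longrightarrow> x \<in> space V \<Longrightarrow> y \<in> space V \<Longrightarrow> x - y \<in> space V"
  using vsub_add[of V x "- y"] vsub_minus[of V y] by simp

lemma lin_on_add: "lin_on S s1 s2 f \<Longrightarrow> x \<in> S \<Longrightarrow> y \<in> S \<Longrightarrow> f (x + y) = f x + f y"
  and lin_on_scale: "lin_on S s1 s2 f \<Longrightarrow> x \<in> S \<Longrightarrow> f (s1 c x) = s2 c (f x)"
  unfolding lin_on_def by blast+

lemma lin_on_0: "lin_on S s1 s2 f \<Longrightarrow> 0 \<in> S \<Longrightarrow> f 0 = 0"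
  using lin_on_add[of S s1 s2 f 0 0] by simp

lemma lin_on_diff:
  assumes "lin_on (space V) (scale V) s2 f" "vsub V" "x \<in> space V" "y \<in> space V"
  shows "f (x - y) = f x - f y"
  using lin_on_add[OF assms(1), of "x - y" y] vsub_diff[OF assms(2-4)] assms(4) by (simp add: eq_diff_eq)

lemma lin_on_minus:
  assumes "lin_on (space V) (scale V) s2 f" "vsub V" "y \<in> space V"
  shows "f (- y) = - f y"
  using lin_on_diff[OF assms(1,2) vsub_0[OF assms(2)] assms(3)] lin_on_0[OF assms(1) vsub_0[OF assms(2)]]
  by simp

text \<open>Precomposition with a linear projection onto \<open>space V\<close>.\<close>

lemma lin_on_extend:
  assumes "vsub V" "lin_on (space V) (scale V) s2 f" "vector_space s2"
  obtains g where "Vector_Spaces.linear (scale V) s2 g" "\<And>x. x \<in> space V \<Longrightarrow> g x = f x"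
proof -
  obtain \<pi> where "Vector_Spaces.linear (scale V) (scale V) \<pi>" "range \<pi> \<subseteq> space V"
    "\<And>x. x \<in> space V \<Longrightarrow> \<pi> x = x"
    by (rule subspace_projection[of "scale V" "space V"]) (use assms(1) in \<open>auto simp: vsub_def\<close>)
  thus ?thesis
    using linear_lin_on_projection[OF assms(2) _ _ assms(3)] that[of "\<lambda>x. f (\<pi> x)"] by simp
qed

text \<open>A nonzero difference \<open>x - y\<close> is independent, so some functional on the
  ambient space takes the value 1 on it.\<close>

lemma lin_on_functionals_separate:
  assumes V: "vsub V" and x: "x \<in> space V" "y \<in> space V"
    and eq: "\<And>\<phi>. lin_on (space V) (scale V) (*) \<phi> \<Longrightarrow> \<phi> x = \<phi> y"
  shows "x = y"
proof (rule ccontr)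
  interpret V: vector_space "scale V" using V by (simp add: vsub_def)
  interpret P: vector_space_pair "scale V" "(*) :: 'c \<Rightarrow> 'c \<Rightarrow> 'c"
    by (intro vector_space_pair.intro V.vector_space_axioms vector_space_mult)
  assume "x \<noteq> y"
  hence ind: "V.independent {x - y}" by (simp add: V.dependent_single)
  define \<phi> where "\<phi> = P.construct {x - y} (\<lambda>_. 1)"
  have lin: "Vector_Spaces.linear (scale V) (*) \<phi>"
    unfolding \<phi>_def by (rule P.linear_construct[OF ind])
  have "\<phi> (x - y) = 1" unfolding \<phi>_def by (rule P.construct_basis[OF ind]) simp
  moreover have l: "lin_on (space V) (scale V) (*) \<phi>"
    using lin by (auto simp: linear_iff_lin_on lin_on_def)
  ultimately show False using lin_on_diff[OF l V x] eq[OF l] by simp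
qed

text \<open>A form must be multilinear on the ambient type, a test function is so on
  \<open>space M\<close> only. Composing with a projection onto \<open>space M\<close> turns the
  latter into the former without changing it on generators.\<close>

lemma multi_form_MA:
  fixes g :: "'m::ab_group_add \<times> 'a::ring_1 list \<Rightarrow> 'k::field"
  assumes A: "vector_space (bscale A)" and M: "vsub M"
    and lin: "\<And>m bs i. m \<in> space M \<Longrightarrow> length bs = p \<Longrightarrow> i < p \<Longrightarrow>
           lin_on UNIV (bscale A) (*) (\<lambda>x. g (m, bs[i := x]))"
       "\<And>bs. length bs = p \<Longrightarrow> lin_on (space M) (scale M) (*) (\<lambda>x. g (x, bs))"
  shows "\<exists>\<beta>\<in>forms (MA A M p). \<forall>x\<in>gens (MA A M p). \<beta> x = g x"
proof -
  obtain \<pi> where \<pi>: "Vector_Spaces.linear (scale M) (scale M) \<pi>" "range \<pi> \<subseteq> space M"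
    "\<And>x. x \<in> space M \<Longrightarrow> \<pi> x = x"
    by (rule subspace_projection[of "scale M" "space M"]) (use M in \<open>auto simp: vsub_def\<close>)
  have \<pi>M: "\<pi> m \<in> space M" for m using \<pi>(2) by auto
  have 1: "Vector_Spaces.linear (bscale A) (*) (\<lambda>x. g (\<pi> m, bs[i := x]))"
    if "length bs = p" "i < p" for m bs i
    using lin(1)[OF \<pi>M that] A by (simp add: linear_iff_lin_on vector_space_mult)
  have 2: "Vector_Spaces.linear (scale M) (*) (\<lambda>x. g (\<pi> x, bs))" if "length bs = p" for bs
    by (rule linear_lin_on_projection[OF lin(2)[OF that] \<pi>(1,2) vector_space_mult])
  show ?thesis
    by (rule bexI[of _ "\<lambda>(m, bs). g (\<pi> m, bs)"]) (simp_all add: MA_def split_beta 1 2 \<pi>(3))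
qed

lemma multi_form_AM:
  fixes g :: "'a::ring_1 list \<times> 'm::ab_group_add \<Rightarrow> 'k::field"
  assumes A: "vector_space (bscale A)" and M: "vsub M"
    and lin: "\<And>m bs i. m \<in> space M \<Longrightarrow> length bs = p \<Longrightarrow> i < p \<Longrightarrow>
           lin_on UNIV (bscale A) (*) (\<lambda>x. g (bs[i := x], m))"
       "\<And>bs. length bs = p \<Longrightarrow> lin_on (space M) (scale M) (*) (\<lambda>x. g (bs, x))"
  shows "\<exists>\<beta>\<in>forms (AM A p M). \<forall>x\<in>gens (AM A p M). \<beta> x = g x"
proof -
  obtain \<pi> where \<pi>: "Vector_Spaces.linear (scale M) (scale M) \<pi>" "range \<pi> \<subseteq> space M"
    "\<And>x. x \<in> space M \<Longrightarrow> \<pi> x = x"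
    by (rule subspace_projection[of "scale M" "space M"]) (use M in \<open>auto simp: vsub_def\<close>)
  have \<pi>M: "\<pi> m \<in> space M" for m using \<pi>(2) by auto
  have 1: "Vector_Spaces.linear (bscale A) (*) (\<lambda>x. g (bs[i := x], \<pi> m))"
    if "length bs = p" "i < p" for m bs i
    using lin(1)[OF \<pi>M that] A by (simp add: linear_iff_lin_on vector_space_mult)
  have 2: "Vector_Spaces.linear (scale M) (*) (\<lambda>x. g (bs, \<pi> x))" if "length bs = p" for bs
    by (rule linear_lin_on_projection[OF lin(2)[OF that] \<pi>(1,2) vector_space_mult])
  show ?thesis
    by (rule bexI[of _ "\<lambda>(bs, m). g (bs, \<pi> m)"]) (simp_all add: AM_def split_beta 1 2 \<pi>(3))
qed

section \<open>Moving scalars into a tensor factor\<close>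

lemma absorbs_MA: "vsub M \<Longrightarrow> absorbs (MA A M p)"
  unfolding absorbs_def
proof (intro allI ballI)
  fix c x assume M: "vsub M" and x: "x \<in> gens (MA A M p)"
  have "pure (MA A M p) (scale M c (fst x), snd x) = fscale c (pure (MA A M p) x)"
    using x by (auto simp: pure_def fscale_def MA_def fun_eq_iff linear_iff_lin_on lin_on_def)
  thus "\<exists>x'\<in>gens (MA A M p). pure (MA A M p) x' = fscale c (pure (MA A M p) x)"
    using x vsub_scale[OF M] by (intro bexI[of _ "(scale M c (fst x), snd x)"]) (auto simp: MA_def)
qed

lemma absorbs_AM: "vsub M \<Longrightarrow> absorbs (AM A p M)"
  unfolding absorbs_def
proof (intro allI ballI)
  fix c x assume M: "vsub M" and x: "x \<in> gens (AM A p M)"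
  have "pure (AM A p M) (fst x, scale M c (snd x)) = fscale c (pure (AM A p M) x)"
    using x by (auto simp: pure_def fscale_def AM_def fun_eq_iff linear_iff_lin_on lin_on_def)
  thus "\<exists>x'\<in>gens (AM A p M). pure (AM A p M) x' = fscale c (pure (AM A p M) x)"
    using x vsub_scale[OF M] by (intro bexI[of _ "(fst x, scale M c (snd x))"]) (auto simp: AM_def)
qed

lemma absorbs_Apow: "absorbs (Apow A (Suc n))"
  unfolding absorbs_def
proof (intro allI ballI)
  fix c x assume x: "x \<in> gens (Apow A (Suc n))"
  have "\<beta> (x[0 := bscale A c (x ! 0)]) = c * \<beta> (x[0 := x ! 0])" if "\<beta> \<in> forms (Apow A (Suc n))" for \<beta>
    using that x by (auto simp: Apow_def linear_iff_lin_on lin_on_def)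
  hence "pure (Apow A (Suc n)) (x[0 := bscale A c (x ! 0)]) = fscale c (pure (Apow A (Suc n)) x)"
    by (auto simp: pure_def fscale_def fun_eq_iff)
  thus "\<exists>x'\<in>gens (Apow A (Suc n)). pure (Apow A (Suc n)) x' = fscale c (pure (Apow A (Suc n)) x)"
    using x by (intro bexI[of _ "x[0 := bscale A c (x ! 0)]"]) (auto simp: Apow_def)
qed

text \<open>With \<open>1\<close> rewritten to \<open>Suc 0\<close>, facts about \<open>MA A V 1\<close> would no longer match.\<close>

declare One_nat_def [simp del]

lemma gens_MA_1: "x \<in> gens (MA A V 1) \<longleftrightarrow> (\<exists>y\<in>space V. \<exists>u. x = (y, [u]))"
  by (cases x) (auto simp: MA_def length_Suc_conv One_nat_def)

lemma gens_MA_2: "x \<in> gens (MA A V 2) \<longleftrightarrow> (\<exists>y\<in>space V. \<exists>u v. x = (y, [u, v]))"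
  by (cases x) (auto simp: MA_def length_Suc_conv numeral_2_eq_2)

lemma gens_MA_0: "x \<in> gens (MA A V 0) \<longleftrightarrow> (\<exists>y\<in>space V. x = (y, []))"
  by (cases x) (auto simp: MA_def)

lemma gens_Apow_2: "x \<in> gens (Apow A 2) \<longleftrightarrow> (\<exists>u v. x = [u, v])"
  by (auto simp: Apow_def length_Suc_conv numeral_2_eq_2)

lemma fscale_apply: "fscale c t i = c * t i"
  by (simp add: fscale_def)

lemma lin_on_comp:
  "lin_on T s2 s3 f \<Longrightarrow> lin_on S s1 s2 h \<Longrightarrow> (\<And>x. x \<in> S \<Longrightarrow> h x \<in> T) \<Longrightarrow>
   lin_on S s1 s3 (\<lambda>x. f (h x))"
  by (simp add: lin_on_def)

lemma lin_on_UNIV_comp: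
  "lin_on UNIV s2 s3 f \<Longrightarrow> lin_on S s1 s2 h \<Longrightarrow> lin_on S s1 s3 (\<lambda>x. f (h x))"
  by (simp add: lin_on_def)

lemma lin_on_plus:
  fixes f g :: "'v::ab_group_add \<Rightarrow> 'k::field"
  shows "lin_on S s (*) f \<Longrightarrow> lin_on S s (*) g \<Longrightarrow> lin_on S s (*) (\<lambda>x. f x + g x)"
  by (simp add: lin_on_def algebra_simps)

lemma lin_on_minus_fun:
  fixes f g :: "'v::ab_group_add \<Rightarrow> 'k::field"
  shows "lin_on S s (*) f \<Longrightarrow> lin_on S s (*) g \<Longrightarrow> lin_on S s (*) (\<lambda>x. f x - g x)"
  by (simp add: lin_on_def algebra_simps)

lemma lin_on_mult_left:
  fixes f :: "'v::ab_group_add \<Rightarrow> 'k::field"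
  shows "lin_on S s (*) f \<Longrightarrow> lin_on S s (*) (\<lambda>x. c * f x)"
  by (simp add: lin_on_def algebra_simps)

lemma lin_on_mult_right:
  fixes f :: "'v::ab_group_add \<Rightarrow> 'k::field"
  shows "lin_on S s (*) f \<Longrightarrow> lin_on S s (*) (\<lambda>x. f x * c)"
  by (simp add: lin_on_def algebra_simps)

text \<open>The tensor, hence its decomposition, stays fixed while \<open>v\<close> varies, so
  linearity holds term by term.\<close>

lemma lin_on_tsum:
  fixes H :: "'v::ab_group_add \<Rightarrow> 'x \<Rightarrow> 'k::field"
  assumes "absorbs T" "t \<in> tspace T" "\<And>x. x \<in> gens T \<Longrightarrow> lin_on S s (*) (\<lambda>v. H v x)"
    "\<And>v w. v \<in> S \<Longrightarrow> w \<in> S \<Longrightarrow> v + w \<in> S" "\<And>c v. v \<in> S \<Longrightarrow> s c v \<in> S"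
  shows "lin_on S s (*) (\<lambda>v. tsum T (H v) t)"
  unfolding lin_on_def
proof (intro conjI ballI allI)
  fix v w assume vw: "v \<in> S" "w \<in> S"
  have "tsum T (H (v + w)) t = tsum T (\<lambda>x. H v x + H w x) t"
    by (rule tsum_cong) (use assms vw in \<open>auto simp: lin_on_def\<close>)
  thus "tsum T (H (v + w)) t = tsum T (H v) t + tsum T (H w) t" by (simp add: tsum_plus)
next
  fix c v assume v: "v \<in> S"
  have "tsum T (H (s c v)) t = tsum T (\<lambda>x. c * H v x) t"
    by (rule tsum_cong) (use assms v in \<open>auto simp: lin_on_def\<close>)
  thus "tsum T (H (s c v)) t = c * tsum T (H v) t" by (simp add: tsum_mult)
qed

section \<open>Sweedler calculus with scalar values\<close>

locale sweedler =
  fixes A :: "('a::ring_1, 'k::field) bialg"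
  assumes bialg: "bialgebra A"
begin

lemma A_vs: "vector_space (bscale A)"
  and A_mult: "bscale A c x * y = bscale A c (x * y)" "x * bscale A c y = bscale A c (x * y)"
  and comult_in: "comult A a \<in> tspace (Apow A 2)"
  and comult_lin: "lin_on UNIV (bscale A) fscale (comult A)"
  and counit_lin: "lin_on UNIV (bscale A) (*) (counit A)"
  and counit_left: "tsum (Apow A 2) (\<lambda>l. bscale A (counit A (l ! 0)) (l ! 1)) (comult A a) = a"
  using bialg by (auto simp: bialgebra_def linear_iff_lin_on)

lemma mult_lin: "lin_on UNIV (bscale A) (bscale A) (\<lambda>x. x * y)"
  "lin_on UNIV (bscale A) (bscale A) (\<lambda>x. y * x)"
  by (auto simp: lin_on_def A_mult algebra_simps)

text \<open>\<open>bil\<close> and \<open>tril\<close> describe, in curried shape and restricted to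
  \<open>space V\<close>, the forms on \<open>V \<otimes> A\<close> and
  \<open>V \<otimes> A \<otimes> A\<close>; \<open>bilA\<close> does the same for
  \<open>A \<otimes> A\<close>.\<close>

definition bil :: "('v::ab_group_add, 'a, 'k) yd \<Rightarrow> ('v \<Rightarrow> 'a \<Rightarrow> 'k) \<Rightarrow> bool" where
  "bil V G \<longleftrightarrow> (\<forall>y\<in>space V. lin_on UNIV (bscale A) (*) (G y)) \<and>
     (\<forall>u. lin_on (space V) (scale V) (*) (\<lambda>y. G y u))"

definition tril :: "('v::ab_group_add, 'a, 'k) yd \<Rightarrow> ('v \<Rightarrow> 'a \<Rightarrow> 'a \<Rightarrow> 'k) \<Rightarrow> bool" where
  "tril V G \<longleftrightarrow> (\<forall>y\<in>space V. \<forall>u. lin_on UNIV (bscale A) (*) (G y u)) \<and>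
     (\<forall>y\<in>space V. \<forall>v. lin_on UNIV (bscale A) (*) (\<lambda>u. G y u v)) \<and>
     (\<forall>u v. lin_on (space V) (scale V) (*) (\<lambda>y. G y u v))"

definition bilA :: "('a \<Rightarrow> 'a \<Rightarrow> 'k) \<Rightarrow> bool" where
  "bilA G \<longleftrightarrow> (\<forall>u. lin_on UNIV (bscale A) (*) (G u)) \<and> (\<forall>v. lin_on UNIV (bscale A) (*) (\<lambda>u. G u v))"

abbreviation tens :: "('v::ab_group_add, 'a, 'k) yd \<Rightarrow> ('v \<times> 'a list, 'k) tensor set" where
  "tens V \<equiv> tspace (MA A V 1)"

text \<open>The target is general because both kinds of values occur: scalar-valued \<open>G\<close>
  test a tensor, tensor-valued \<open>G\<close> construct one.\<close>

definition ev :: "('v::ab_group_add, 'a, 'k) yd \<Rightarrow> ('v \<times> 'a list, 'k) tensor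
    \<Rightarrow> ('v \<Rightarrow> 'a \<Rightarrow> 'w::comm_monoid_add) \<Rightarrow> 'w" where
  "ev V t G = tsum (MA A V 1) (\<lambda>x. G (fst x) (snd x ! 0)) t"

abbreviation rho :: "('v::ab_group_add, 'a, 'k) yd \<Rightarrow> 'v \<Rightarrow> ('v \<Rightarrow> 'a \<Rightarrow> 'w::comm_monoid_add) \<Rightarrow> 'w" where
  "rho V m G \<equiv> ev V (coact V m) G"

definition sd :: "'a \<Rightarrow> ('a \<Rightarrow> 'a \<Rightarrow> 'w::comm_monoid_add) \<Rightarrow> 'w" where
  "sd a G = tsum (Apow A 2) (\<lambda>l. G (l ! 0) (l ! 1)) (comult A a)"

lemma absorbs_A2: "absorbs (Apow A 2)"
  using absorbs_Apow[of A 1] by (simp add: numeral_2_eq_2)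

lemma bil_form:
  assumes "vsub V" "bil V G"
  shows "\<exists>\<beta>\<in>forms (MA A V 1). \<forall>x\<in>gens (MA A V 1). \<beta> x = G (fst x) (snd x ! 0)"
  by (rule multi_form_MA) (use assms A_vs in \<open>auto simp: bil_def\<close>)

lemma form_bil: "\<beta> \<in> forms (MA A V 1) \<Longrightarrow> bil V (\<lambda>y u. \<beta> (y, [u]))"
proof -
  assume \<beta>: "\<beta> \<in> forms (MA A V 1)"
  have *: "length as = 1 \<Longrightarrow> i < 1 \<Longrightarrow> lin_on UNIV (bscale A) (*) (\<lambda>x. \<beta> (y, as[i := x]))"
    "length as = 1 \<Longrightarrow> lin_on UNIV (scale V) (*) (\<lambda>x. \<beta> (x, as))" for as i y
    using \<beta> unfolding MA_def linear_iff_lin_on by auto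
  show ?thesis
    using *(1)[of "[u]" 0 for u] *(2)[of "[u]" for u] by (auto simp: bil_def lin_on_def)
qed

lemma tril_form:
  assumes "vsub V" "tril V G"
  shows "\<exists>\<beta>\<in>forms (MA A V 2). \<forall>x\<in>gens (MA A V 2). \<beta> x = G (fst x) (snd x ! 0) (snd x ! 1)"
  by (rule multi_form_MA)
    (use assms A_vs in \<open>auto simp: tril_def less_2_cases_iff length_Suc_conv numeral_2_eq_2 less_Suc_eq\<close>)

lemma form_tril:
  assumes "\<beta> \<in> forms (MA A V 2)"
  shows "tril V (\<lambda>y u v. \<beta> (y, [u, v]))"
proof -
  have *: "length as = 2 \<Longrightarrow> i < 2 \<Longrightarrow> lin_on UNIV (bscale A) (*) (\<lambda>x. \<beta> (y, as[i := x]))"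
    "length as = 2 \<Longrightarrow> lin_on UNIV (scale V) (*) (\<lambda>x. \<beta> (x, as))" for as i y
    using assms unfolding MA_def linear_iff_lin_on by auto
  show ?thesis
    using *(1)[of "[u, v]" 0 for u v] *(1)[of "[u, v]" 1 for u v] *(2)[of "[u, v]" for u v]
    by (auto simp: tril_def lin_on_def One_nat_def)
qed

lemma bilA_form:
  assumes "bilA G"
  shows "\<exists>\<beta>\<in>forms (Apow A 2). \<forall>x\<in>gens (Apow A 2). \<beta> x = G (x ! 0) (x ! 1)"
  by (rule bexI[of _ "\<lambda>x. G (x ! 0) (x ! 1)"])
    (use assms in \<open>auto simp: Apow_def bilA_def length_Suc_conv numeral_2_eq_2 less_Suc_eq
      linear_iff_lin_on vector_space_mult A_vs\<close>)

text \<open>One form computes \<open>ev V t G\<close> for all \<open>t\<close> at once, so linearity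
  of \<open>ev\<close> in the tensor is read off from the pointwise operations on functions.\<close>

lemma ev_form:
  assumes "vsub V" "bil V G"
  obtains \<beta> where "\<beta> \<in> forms (MA A V 1)" "\<And>x. x \<in> gens (MA A V 1) \<Longrightarrow> \<beta> x = G (fst x) (snd x ! 0)"
    "\<And>t. t \<in> tens V \<Longrightarrow> ev V t G = t \<beta>"
proof -
  obtain \<beta> where \<beta>: "\<beta> \<in> forms (MA A V 1)"
    "\<And>x. x \<in> gens (MA A V 1) \<Longrightarrow> \<beta> x = G (fst x) (snd x ! 0)"
    using bil_form[OF assms] by blast
  show ?thesis
    by (rule that[OF \<beta>]) (auto simp: ev_def intro!: tsum_form absorbs_MA assms \<beta>)
qed

lemma ev_add: "vsub V \<Longrightarrow> bil V G \<Longrightarrow> s \<in> tens V \<Longrightarrow> t \<in> tens V \<Longrightarrow> ev V (s + t) G = ev V s G + ev V t G"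
  and ev_diff: "vsub V \<Longrightarrow> bil V G \<Longrightarrow> s \<in> tens V \<Longrightarrow> t \<in> tens V \<Longrightarrow> ev V (s - t) G = ev V s G - ev V t G"
  and ev_scale: "vsub V \<Longrightarrow> bil V G \<Longrightarrow> t \<in> tens V \<Longrightarrow> ev V (fscale c t) G = c * ev V t G"
  and ev_zero: "vsub V \<Longrightarrow> bil V G \<Longrightarrow> ev V 0 G = 0"
  by (erule (1) ev_form, simp add: tspace_add tspace_diff tspace_scale tspace_0 fscale_apply)+

lemma ev_lin: "vsub V \<Longrightarrow> bil V G \<Longrightarrow> lin_on (tens V) fscale (*) (\<lambda>t. ev V t G)"
  by (simp add: lin_on_def ev_add ev_scale)

lemma ev_eqI:
  assumes "vsub V" "s \<in> tens V" "t \<in> tens V" "\<And>G. bil V G \<Longrightarrow> ev V s G = ev V t G"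
  shows "s = t"
proof (rule tspace_eqI[OF assms(2,3)])
  fix \<beta> assume \<beta>: "\<beta> \<in> forms (MA A V 1)"
  have "ev V t (\<lambda>y u. \<beta> (y, [u])) = t \<beta>" if "t \<in> tens V" for t
    unfolding ev_def
    by (rule tsum_form) (use that \<beta> assms(1) in \<open>auto simp: absorbs_MA gens_MA_1\<close>)
  thus "s \<beta> = t \<beta>" using assms(4)[OF form_bil[OF \<beta>]] assms(2,3) by simp
qed

lemma ev_plus: "ev V t (\<lambda>y u. G y u + H y u) = ev V t G + ev V t H"
  by (simp add: ev_def tsum_plus)

lemma ev_mult: "ev V t (\<lambda>y u. c * G y u) = c * ev V t G" for c :: "'w::ring"
  by (simp add: ev_def tsum_mult)

lemma ev_cong:
  assumes "vsub V" "t \<in> tens V" "\<And>y u. y \<in> space V \<Longrightarrow> G y u = H y u"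
  shows "ev V t G = ev V t H"
  unfolding ev_def by (rule tsum_cong) (use assms in \<open>auto simp: absorbs_MA gens_MA_1\<close>)

lemma ev_param:
  assumes "vsub V" "t \<in> tens V" "\<And>y u. y \<in> space V \<Longrightarrow> lin_on S s (*) (\<lambda>x. H x y u :: 'k)"
    "\<And>v w. v \<in> S \<Longrightarrow> w \<in> S \<Longrightarrow> v + w \<in> S" "\<And>c v. v \<in> S \<Longrightarrow> s c v \<in> S"
  shows "lin_on S s (*) (\<lambda>x. ev V t (H x))"
  unfolding ev_def by (rule lin_on_tsum) (use assms in \<open>auto simp: absorbs_MA gens_MA_1\<close>)

lemmas ev_param_UNIV = ev_param[where S = UNIV, simplified]

lemma ev_pure_sum:
  assumes "vsub V" "bil V G" "absorbs T" "t \<in> tspace T" "\<And>x. x \<in> gens T \<Longrightarrow> h x \<in> gens (MA A V 1)"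
  shows "tsum T (\<lambda>x. pure (MA A V 1) (h x)) t \<in> tens V"
    and "ev V (tsum T (\<lambda>x. pure (MA A V 1) (h x)) t) G = tsum T (\<lambda>x. G (fst (h x)) (snd (h x) ! 0)) t"
proof -
  show "tsum T (\<lambda>x. pure (MA A V 1) (h x)) t \<in> tens V"
    by (rule tsum_in_tspace) (use assms in \<open>auto intro: tspace_pure\<close>)
  obtain \<beta> where \<beta>: "\<beta> \<in> forms (MA A V 1)"
    "\<And>x. x \<in> gens (MA A V 1) \<Longrightarrow> \<beta> x = G (fst x) (snd x ! 0)"
    using ev_form[OF assms(1,2)] by blast
  show "ev V (tsum T (\<lambda>x. pure (MA A V 1) (h x)) t) G = tsum T (\<lambda>x. G (fst (h x)) (snd (h x) ! 0)) t"
    unfolding ev_def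
    by (rule tsum_pure_form[OF assms(3-5) absorbs_MA[OF assms(1)] \<beta>(1)]) (auto intro: \<beta>(2))
qed

lemma tsum_MA_ev: "tsum (MA A V 1) h t = ev V t (\<lambda>y u. h (y, [u]))"
  if "vsub V" "t \<in> tens V"
  unfolding ev_def by (rule tsum_cong) (use that in \<open>auto simp: absorbs_MA gens_MA_1\<close>)

lemma push_in:
  assumes "vsub W" "t \<in> tens W" "\<And>y u. y \<in> space W \<Longrightarrow> h y u \<in> space V"
  shows "ev W t (\<lambda>y u. pure (MA A V 1) (h y u, [k y u])) \<in> tens V"
  unfolding ev_def
  by (rule tsum_in_tspace) (use assms in \<open>auto simp: absorbs_MA gens_MA_1 intro!: tspace_pure\<close>)

text \<open>Both sides run over the same chosen decomposition of \<open>t\<close>, and evaluation at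
  the form of \<open>G\<close> commutes with finite sums; this is why \<open>h\<close> and
  \<open>k\<close> can be arbitrary.\<close>

lemma ev_push:
  assumes "vsub V" "bil V G" "vsub W" "t \<in> tens W" "\<And>y u. y \<in> space W \<Longrightarrow> h y u \<in> space V"
  shows "ev V (ev W t (\<lambda>y u. pure (MA A V 1) (h y u, [k y u]))) G = ev W t (\<lambda>y u. G (h y u) (k y u))"
  unfolding ev_def[of W]
  by (subst ev_pure_sum(2)) (use assms in \<open>auto simp: absorbs_MA gens_MA_1\<close>)

lemma sd_plus: "sd a (\<lambda>b c. G b c + H b c) = sd a G + sd a H"
  by (simp add: sd_def tsum_plus)

lemma sd_mult: "sd a (\<lambda>b d. c * G b d) = c * sd a G" for c :: "'w::ring"
  by (simp add: sd_def tsum_mult)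

lemma sd_param:
  assumes "\<And>b c. lin_on S s (*) (\<lambda>x. H x b c :: 'k)"
    "\<And>v w. v \<in> S \<Longrightarrow> w \<in> S \<Longrightarrow> v + w \<in> S" "\<And>c v. v \<in> S \<Longrightarrow> s c v \<in> S"
  shows "lin_on S s (*) (\<lambda>x. sd a (H x))"
  unfolding sd_def by (rule lin_on_tsum) (use assms in \<open>auto simp: absorbs_A2 comult_in\<close>)

lemma sd_param_sub:
  assumes "vsub W" "\<And>b c. lin_on (space W) (scale W) (*) (\<lambda>x. H x b c :: 'k)"
  shows "lin_on (space W) (scale W) (*) (\<lambda>x. sd a (H x))"
  by (rule sd_param) (use assms in \<open>auto simp: vsub_add vsub_scale\<close>)

text \<open>Here the tensor itself varies: \<open>G\<close> is a fixed form and the comultiplication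
  is linear.\<close>

lemma sd_lin:
  assumes "bilA G"
  shows "lin_on UNIV (bscale A) (*) (\<lambda>a. sd a G)"
proof -
  obtain \<beta> where \<beta>: "\<beta> \<in> forms (Apow A 2)" "\<And>x. x \<in> gens (Apow A 2) \<Longrightarrow> \<beta> x = G (x ! 0) (x ! 1)"
    using bilA_form[OF assms] by blast
  have "sd a G = comult A a \<beta>" for a
    unfolding sd_def by (rule tsum_form) (use \<beta> in \<open>auto simp: absorbs_A2 comult_in\<close>)
  thus ?thesis using comult_lin by (simp add: lin_on_def fscale_def)
qed

lemma sd_additive:
  assumes "f 0 = 0" "\<And>x y. f (x + y) = f x + f y"
  shows "f (sd a G) = sd a (\<lambda>b c. f (G b c))"
  unfolding sd_def by (rule tsum_additive) (use assms in auto)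

lemma sd_counit_left:
  assumes "lin_on UNIV (bscale A) (*) \<phi>"
  shows "sd a (\<lambda>b c. counit A b * \<phi> c) = \<phi> a"
proof -
  have "\<phi> (sd a (\<lambda>b c. bscale A (counit A b) c)) = sd a (\<lambda>b c. \<phi> (bscale A (counit A b) c))"
    by (rule sd_additive) (use assms in \<open>auto simp: lin_on_add lin_on_0\<close>)
  thus ?thesis using counit_left[of a] assms by (simp add: sd_def lin_on_def)
qed

lemma nth_pair_1: "[x, y] ! 1 = y" "Suc 0 = 1"
  by (simp_all add: One_nat_def)

lemma trilinear_tensor_eq_iff:
  fixes L R :: "('v::ab_group_add \<times> 'a list, 'k) tensor"
  assumes V: "vsub V" and L: "L \<in> tspace (MA A V 2)" and R: "R \<in> tspace (MA A V 2)"
  shows "L = R \<longleftrightarrow> (\<forall>G. tril V G \<longrightarrow>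
    tsum (MA A V 2) (\<lambda>x. G (fst x) (snd x ! 0) (snd x ! 1)) L =
    tsum (MA A V 2) (\<lambda>x. G (fst x) (snd x ! 0) (snd x ! 1)) R)" (is "_ \<longleftrightarrow> ?rhs")
proof
  assume r: ?rhs
  show "L = R"
  proof (rule tspace_eqI[OF L R])
    fix \<beta> assume \<beta>: "\<beta> \<in> forms (MA A V 2)"
    have "tsum (MA A V 2) (\<lambda>x. \<beta> (fst x, [snd x ! 0, snd x ! 1])) t = t \<beta>"
      if "t \<in> tspace (MA A V 2)" for t
      by (rule tsum_form) (use that \<beta> V in \<open>auto simp: absorbs_MA gens_MA_2 nth_pair_1\<close>)
    thus "L \<beta> = R \<beta>" using r[rule_format, OF form_tril[OF \<beta>]] L R by simp
  qed
qed simp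

text \<open>
  \<open>yd_module\<close> with every axiom that equates tensors or vectors tested on scalar-valued multilinear
  functions, which may be defined on \<open>space V\<close> only.
\<close>

definition coassoc :: "('v::ab_group_add, 'a, 'k) yd \<Rightarrow> bool" where
  "coassoc V \<longleftrightarrow> (\<forall>m\<in>space V. \<forall>G::'v \<Rightarrow> 'a \<Rightarrow> 'a \<Rightarrow> 'k. tril V G \<longrightarrow>
     rho V m (\<lambda>y u. rho V y (\<lambda>z v. G z v u)) = rho V m (\<lambda>y u. sd u (G y)))"

definition counital :: "('v::ab_group_add, 'a, 'k) yd \<Rightarrow> bool" where
  "counital V \<longleftrightarrow> (\<forall>m\<in>space V. \<forall>\<phi>::'v \<Rightarrow> 'k. lin_on (space V) (scale V) (*) \<phi> \<longrightarrow>
     rho V m (\<lambda>y u. counit A u * \<phi> y) = \<phi> m)"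

definition yd_compat :: "('v::ab_group_add, 'a, 'k) yd \<Rightarrow> bool" where
  "yd_compat V \<longleftrightarrow> (\<forall>a. \<forall>m\<in>space V. \<forall>G::'v \<Rightarrow> 'a \<Rightarrow> 'k. bil V G \<longrightarrow>
     sd a (\<lambda>b c. rho V (act V c m) (\<lambda>y u. G y (u * b))) =
     sd a (\<lambda>b c. rho V m (\<lambda>y u. G (act V b y) (c * u))))"

definition left_mod :: "('v::ab_group_add, 'a, 'k) yd \<Rightarrow> bool" where
  "left_mod V \<longleftrightarrow> vsub V \<and>
     (\<forall>a. \<forall>m\<in>space V. act V a m \<in> space V) \<and>
     (\<forall>a. lin_on (space V) (scale V) (scale V) (act V a)) \<and>
     (\<forall>m\<in>space V. lin_on UNIV (bscale A) (scale V) (\<lambda>a. act V a m)) \<and>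
     (\<forall>m\<in>space V. act V 1 m = m) \<and>
     (\<forall>a b. \<forall>m\<in>space V. act V (a * b) m = act V a (act V b m))"

definition coact_lin :: "('v::ab_group_add, 'a, 'k) yd \<Rightarrow> bool" where
  "coact_lin V \<longleftrightarrow> (\<forall>m\<in>space V. coact V m \<in> tens V) \<and> lin_on (space V) (scale V) fscale (coact V)"

text \<open>At a form both tensors in the axiom become nested sums of scalars, and every trilinear
  test function agrees with a form on generators.\<close>

lemma coassoc_iff:
  assumes V: "vsub V" and c: "coact_lin V"
  shows "(\<forall>m\<in>space V.
        tsum (MA A V 1) (\<lambda>(m\<^sub>0, u). tsum (MA A V 1)
          (\<lambda>(m\<^sub>0', v). pure (MA A V 2) (m\<^sub>0', [v ! 0, u ! 0])) (coact V m\<^sub>0)) (coact V m) =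
        tsum (MA A V 1) (\<lambda>(m\<^sub>0, u). tsum (Apow A 2)
          (\<lambda>l. pure (MA A V 2) (m\<^sub>0, [l ! 0, l ! 1])) (comult A (u ! 0))) (coact V m)) \<longleftrightarrow> coassoc V"
proof -
  have ct: "coact V m \<in> tens V" if "m \<in> space V" for m using c that by (simp add: coact_lin_def)
  note ab = absorbs_MA[OF V] absorbs_A2
  { fix m assume m: "m \<in> space V"
    let ?L = "tsum (MA A V 1) (\<lambda>(m\<^sub>0, u). tsum (MA A V 1)
          (\<lambda>(m\<^sub>0', v). pure (MA A V 2) (m\<^sub>0', [v ! 0, u ! 0])) (coact V m\<^sub>0)) (coact V m)"
    let ?R = "tsum (MA A V 1) (\<lambda>(m\<^sub>0, u). tsum (Apow A 2)
          (\<lambda>l. pure (MA A V 2) (m\<^sub>0, [l ! 0, l ! 1])) (comult A (u ! 0))) (coact V m)"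
    have L: "?L \<in> tspace (MA A V 2)"
      by (intro tsum_in_tspace ab ct m)
        (auto simp: gens_MA_1 gens_MA_2 ct intro!: tsum_in_tspace ab tspace_pure)
    have R: "?R \<in> tspace (MA A V 2)"
      by (intro tsum_in_tspace ab ct m)
        (auto simp: gens_MA_1 gens_MA_2 comult_in intro!: tsum_in_tspace ab tspace_pure)
    have "?L = ?R \<longleftrightarrow> (\<forall>G. tril V G \<longrightarrow>
      rho V m (\<lambda>y u. rho V y (\<lambda>z v. G z v u)) = rho V m (\<lambda>y u. sd u (G y)))"
      unfolding trilinear_tensor_eq_iff[OF V L R]
    proof (intro all_cong1 imp_cong refl)
      fix G :: "_ \<Rightarrow> 'a \<Rightarrow> 'a \<Rightarrow> 'k" assume G: "tril V G"
      then obtain \<beta> where \<beta>: "\<beta> \<in> forms (MA A V 2)"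
        "\<And>x. x \<in> gens (MA A V 2) \<Longrightarrow> \<beta> x = G (fst x) (snd x ! 0) (snd x ! 1)"
        using tril_form[OF V] by blast
      have eq: "tsum (MA A V 2) (\<lambda>x. G (fst x) (snd x ! 0) (snd x ! 1)) t = t \<beta>"
        if "t \<in> tspace (MA A V 2)" for t
        by (rule tsum_form) (use that \<beta> in \<open>auto intro: ab\<close>)
      have "?L \<beta> = rho V m (\<lambda>y u. rho V y (\<lambda>z v. G z v u))"
        unfolding ev_def tsum_apply
        by (intro tsum_cong ab ct m)
          (auto simp: gens_MA_1 tsum_apply pure_def \<beta>(1) gens_MA_2 \<beta>(2) ct nth_pair_1
            intro!: tsum_cong ab)
      moreover have "?R \<beta> = rho V m (\<lambda>y u. sd u (G y))"
        unfolding ev_def sd_def tsum_apply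
        by (intro tsum_cong ab ct m)
          (auto simp: gens_MA_1 tsum_apply pure_def \<beta>(1) gens_MA_2 \<beta>(2) comult_in nth_pair_1
            intro!: tsum_cong ab)
      ultimately show "(tsum (MA A V 2) (\<lambda>x. G (fst x) (snd x ! 0) (snd x ! 1)) ?L =
         tsum (MA A V 2) (\<lambda>x. G (fst x) (snd x ! 0) (snd x ! 1)) ?R) \<longleftrightarrow>
         (rho V m (\<lambda>y u. rho V y (\<lambda>z v. G z v u)) = rho V m (\<lambda>y u. sd u (G y)))"
        using eq[OF L] eq[OF R] by simp
    qed }
  thus ?thesis unfolding coassoc_def by (intro ball_cong refl) blast
qed

lemma counital_iff:
  assumes V: "vsub V" and c: "coact_lin V"
  shows "(\<forall>m\<in>space V. tsum (MA A V 1) (\<lambda>(m\<^sub>0, u). scale V (counit A (u ! 0)) m\<^sub>0) (coact V m) = m)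
    \<longleftrightarrow> counital V"
proof -
  note ab = absorbs_MA[OF V]
  { fix m assume m: "m \<in> space V"
    have ct: "coact V m \<in> tens V" using c m by (simp add: coact_lin_def)
    let ?x = "tsum (MA A V 1) (\<lambda>(m\<^sub>0, u). scale V (counit A (u ! 0)) m\<^sub>0) (coact V m)"
    have "(\<Sum>x\<leftarrow>r. scale V (counit A (snd x ! 0)) (fst x)) \<in> space V" if "set r \<subseteq> gens (MA A V 1)" for r
      using that by (induction r) (auto simp: gens_MA_1 vsub_0 vsub_add vsub_scale V)
    hence x: "?x \<in> space V"
      using tsum_rep(1)[OF ab ct] unfolding tsum_def split_beta by blast
    have ev: "\<phi> ?x = rho V m (\<lambda>y u. counit A u * \<phi> y)" if \<phi>: "lin_on (space V) (scale V) (*) \<phi>" for \<phi> :: "'b \<Rightarrow> 'k"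
    proof -
      \<comment> \<open>\<open>tsum_additive\<close> asks for additivity on the whole type, so the
        functional is first extended from \<open>space V\<close>.\<close>
      obtain \<psi> where \<psi>: "Vector_Spaces.linear (scale V) (*) \<psi>" "\<And>x. x \<in> space V \<Longrightarrow> \<psi> x = \<phi> x"
        using lin_on_extend[OF V \<phi> vector_space_mult] by blast
      hence l: "lin_on UNIV (scale V) (*) \<psi>" by (simp add: linear_iff_lin_on)
      have "\<phi> ?x = \<psi> ?x" using x \<psi> by simp
      also have "\<dots> = tsum (MA A V 1) (\<lambda>x. \<psi> (case x of (m\<^sub>0, u) \<Rightarrow> scale V (counit A (u ! 0)) m\<^sub>0)) (coact V m)"
        by (rule tsum_additive) (use l in \<open>auto simp: lin_on_add lin_on_0\<close>)
      also have "\<dots> = rho V m (\<lambda>y u. counit A u * \<phi> y)"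
        unfolding ev_def
        by (rule tsum_cong[OF ab ct]) (use l \<psi>(2) in \<open>auto simp: gens_MA_1 lin_on_def\<close>)
      finally show ?thesis .
    qed
    have "?x = m \<longleftrightarrow> (\<forall>\<phi>::'b \<Rightarrow> 'k. lin_on (space V) (scale V) (*) \<phi> \<longrightarrow>
       rho V m (\<lambda>y u. counit A u * \<phi> y) = \<phi> m)" (is "_ \<longleftrightarrow> ?Q")
    proof
      assume ?Q
      show "?x = m"
        by (rule lin_on_functionals_separate[OF V x m]) (use \<open>?Q\<close> ev in auto)
    next
      assume "?x = m" thus ?Q using ev by metis
    qed }
  thus ?thesis unfolding counital_def by (intro ball_cong refl) blast
qed

lemma tensor_eq_iff_ev:
  assumes "vsub V" "L \<in> tens V" "R \<in> tens V"
  shows "L = R \<longleftrightarrow> (\<forall>G. bil V G \<longrightarrow> ev V L G = ev V R G)"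
  using ev_eqI[OF assms] by blast

lemma sd_in_tspace: "(\<And>b c. h b c \<in> tspace T) \<Longrightarrow> sd a h \<in> tspace T"
  unfolding sd_def by (rule tsum_in_tspace[OF absorbs_A2 comult_in])

lemma ev_sd:
  assumes V: "vsub V" "bil V G" "\<And>b c. h b c \<in> tens V"
  shows "ev V (sd a h) G = sd a (\<lambda>b c. ev V (h b c) G)"
proof -
  obtain \<beta> where \<beta>: "\<And>t. t \<in> tens V \<Longrightarrow> ev V t G = t \<beta>"
    using ev_form[OF V(1,2)] by blast
  have "ev V (sd a h) G = sd a h \<beta>"
    by (rule \<beta>) (rule sd_in_tspace, rule V(3))
  also have "\<dots> = sd a (\<lambda>b c. h b c \<beta>)" by (simp add: sd_def tsum_apply)
  finally show ?thesis using \<beta>[OF V(3)] by simp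
qed

lemma yd_compat_iff:
  assumes V: "vsub V" and c: "coact_lin V" and act: "\<And>a m. m \<in> space V \<Longrightarrow> act V a m \<in> space V"
  shows "(\<forall>a. \<forall>m\<in>space V.
        tsum (Apow A 2) (\<lambda>l. tsum (MA A V 1)
          (\<lambda>(x\<^sub>0, u). pure (MA A V 1) (x\<^sub>0, [u ! 0 * l ! 0])) (coact V (act V (l ! 1) m)))
          (comult A a) =
        tsum (Apow A 2) (\<lambda>l. tsum (MA A V 1)
          (\<lambda>(m\<^sub>0, u). pure (MA A V 1) (act V (l ! 0) m\<^sub>0, [l ! 1 * u ! 0])) (coact V m))
          (comult A a)) \<longleftrightarrow> yd_compat V"
proof -
  have ct: "coact V m \<in> tens V" if "m \<in> space V" for m using c that by (simp add: coact_lin_def)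
  { fix a m assume m: "m \<in> space V"
    let ?L = "sd a (\<lambda>b c. rho V (act V c m) (\<lambda>y u. pure (MA A V 1) (y, [u * b])))"
    let ?R = "sd a (\<lambda>b c. rho V m (\<lambda>y u. pure (MA A V 1) (act V b y, [c * u])))"
    have in1: "rho V (act V c m) (\<lambda>y u. pure (MA A V 1) (y, [u * b])) \<in> tens V" for b c
      by (intro push_in V ct act m)
    have in2: "rho V m (\<lambda>y u. pure (MA A V 1) (act V b y, [c * u])) \<in> tens V" for b c
      by (intro push_in V ct act m)
    have "?L = ?R \<longleftrightarrow> (\<forall>G. bil V G \<longrightarrow>
       sd a (\<lambda>b c. rho V (act V c m) (\<lambda>y u. G y (u * b))) =
       sd a (\<lambda>b c. rho V m (\<lambda>y u. G (act V b y) (c * u))))"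
      by (subst tensor_eq_iff_ev)
        (auto simp: V ev_sd in1 in2 ev_push ct act m intro!: sd_in_tspace) }
  note eq = this
  show ?thesis
    unfolding yd_compat_def
    by (intro all_cong1 ball_cong refl) (use eq in \<open>simp add: sd_def ev_def case_prod_unfold\<close>)
qed

text \<open>The translations of the tensor axioms presuppose a left module and a linear coaction
  with values in \<open>V \<otimes> A\<close>; where these fail, both sides are false.\<close>

lemma yd_module_iff:
  "yd_module A V \<longleftrightarrow> left_mod V \<and> coact_lin V \<and> coassoc V \<and> counital V \<and> yd_compat V"
proof (cases "left_mod V \<and> coact_lin V")
  case True
  hence V: "vsub V" and act: "\<And>a m. m \<in> space V \<Longrightarrow> act V a m \<in> space V" and c: "coact_lin V"
    by (auto simp: left_mod_def)
  show ?thesis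
    unfolding yd_module_def coassoc_iff[OF V c] counital_iff[OF V c] yd_compat_iff[OF V c act, simplified]
    using True by (auto simp: left_mod_def coact_lin_def vsub_def)
next
  case False
  thus ?thesis unfolding yd_module_def left_mod_def coact_lin_def vsub_def by blast
qed

lemma bil_comp:
  assumes "bil W G" "lin_on (space V) (scale V) (scale W) f" "\<And>x. x \<in> space V \<Longrightarrow> f x \<in> space W"
  shows "bil V (\<lambda>y u. G (f y) u)"
  using assms unfolding bil_def
  by (auto intro: lin_on_comp[of "space W" "scale W" "(*)" "\<lambda>y. G y u" for u])

lemma tril_comp:
  assumes "tril W G" "lin_on (space V) (scale V) (scale W) f" "\<And>x. x \<in> space V \<Longrightarrow> f x \<in> space W"
  shows "tril V (\<lambda>y u. G (f y) u)"
  using assms unfolding tril_def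
  by (auto intro: lin_on_comp[of "space W" "scale W" "(*)" "\<lambda>y. G y u v" for u v])

text \<open>
  The quotient map of a Baer sum starts from a pullback, about which only the assumptions made on
  \<open>V\<close> are known.
\<close>

lemma yd_hom_iff:
  assumes V: "vsub V" "\<And>m. m \<in> space V \<Longrightarrow> coact V m \<in> tens V"
    and W: "vsub W" "\<And>m. m \<in> space W \<Longrightarrow> coact W m \<in> tens W"
  shows "yd_hom A V W f \<longleftrightarrow> f ` space V \<subseteq> space W \<and> lin_on (space V) (scale V) (scale W) f \<and>
     (\<forall>a. \<forall>m\<in>space V. f (act V a m) = act W a (f m)) \<and>
     (\<forall>m\<in>space V. \<forall>G::_ \<Rightarrow> _ \<Rightarrow> 'k. bil W G \<longrightarrow> rho W (f m) G = rho V m (\<lambda>y u. G (f y) u))"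
    (is "_ \<longleftrightarrow> ?r")
proof (cases "f ` space V \<subseteq> space W")
  case True
  have "(coact W (f m) = tsum (MA A V 1) (\<lambda>(m\<^sub>0, u). pure (MA A W 1) (f m\<^sub>0, u)) (coact V m)) \<longleftrightarrow>
     (\<forall>G::_ \<Rightarrow> _ \<Rightarrow> 'k. bil W G \<longrightarrow> rho W (f m) G = rho V m (\<lambda>y u. G (f y) u))"
    if m: "m \<in> space V" for m
  proof -
    have f: "\<And>y. y \<in> space V \<Longrightarrow> f y \<in> space W" using True by auto
    have eq: "tsum (MA A V 1) (\<lambda>(m\<^sub>0, u). pure (MA A W 1) (f m\<^sub>0, u)) (coact V m) =
       rho V m (\<lambda>y u. pure (MA A W 1) (f y, [u]))"
      by (subst tsum_MA_ev) (auto simp: V m)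
    show ?thesis unfolding eq
      by (subst tensor_eq_iff_ev) (auto simp: V W m f push_in ev_push)
  qed
  thus ?thesis unfolding yd_hom_def by auto
qed (auto simp: yd_hom_def)

end

section \<open>Consequences of the axioms, and new test functions from actions and coactions\<close>

context sweedler
begin

lemma yd_vsub: "yd_module A V \<Longrightarrow> vsub V"
  and yd_act_in: "yd_module A V \<Longrightarrow> m \<in> space V \<Longrightarrow> act V a m \<in> space V"
  and yd_act_lin: "yd_module A V \<Longrightarrow> lin_on (space V) (scale V) (scale V) (act V a)"
  and yd_act_lin_alg: "yd_module A V \<Longrightarrow> m \<in> space V \<Longrightarrow> lin_on UNIV (bscale A) (scale V) (\<lambda>a. act V a m)"
  and yd_act_one: "yd_module A V \<Longrightarrow> m \<in> space V \<Longrightarrow> act V 1 m = m"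
  and yd_act_mult: "yd_module A V \<Longrightarrow> m \<in> space V \<Longrightarrow> act V (a * b) m = act V a (act V b m)"
  and yd_coact_in: "yd_module A V \<Longrightarrow> m \<in> space V \<Longrightarrow> coact V m \<in> tens V"
  and yd_coact_lin: "yd_module A V \<Longrightarrow> lin_on (space V) (scale V) fscale (coact V)"
  and yd_coassoc: "yd_module A V \<Longrightarrow> m \<in> space V \<Longrightarrow> tril V G \<Longrightarrow>
     rho V m (\<lambda>y u. rho V y (\<lambda>z v. G z v u)) = rho V m (\<lambda>y u. sd u (G y))"
  and yd_counit: "yd_module A V \<Longrightarrow> m \<in> space V \<Longrightarrow> lin_on (space V) (scale V) (*) \<phi> \<Longrightarrow>
     rho V m (\<lambda>y u. counit A u * \<phi> y) = \<phi> m"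
  and yd_compatD: "yd_module A V \<Longrightarrow> m \<in> space V \<Longrightarrow> bil V H \<Longrightarrow>
     sd a (\<lambda>b c. rho V (act V c m) (\<lambda>y u. H y (u * b))) =
     sd a (\<lambda>b c. rho V m (\<lambda>y u. H (act V b y) (c * u)))"
  unfolding yd_module_iff left_mod_def coact_lin_def coassoc_def counital_def yd_compat_def by blast+

lemma bilD1: "bil V G \<Longrightarrow> y \<in> space V \<Longrightarrow> lin_on UNIV (bscale A) (*) (G y)"
  and bilD2: "bil V G \<Longrightarrow> lin_on (space V) (scale V) (*) (\<lambda>y. G y u)"
  by (auto simp: bil_def)

lemma bil_mult_right: "bil V G \<Longrightarrow> bil V (\<lambda>y u. G y (u * b))"
  and bil_mult_left: "bil V G \<Longrightarrow> bil V (\<lambda>y u. G y (b * u))"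
  unfolding bil_def by (auto intro: lin_on_UNIV_comp[OF _ mult_lin(1)] lin_on_UNIV_comp[OF _ mult_lin(2)])

lemma rho_lin: "yd_module A V \<Longrightarrow> bil V G \<Longrightarrow> lin_on (space V) (scale V) (*) (\<lambda>m. rho V m G)"
  by (rule lin_on_comp[OF ev_lin yd_coact_lin]) (auto simp: yd_vsub yd_coact_in)

text \<open>Makes the inner sum of a nested Sweedler sum a legitimate test function for the outer
  one; \<open>\<tau>\<close> will be a coaction or a cochain \<open>\<theta>\<close>.\<close>

lemma bil_rho_tril:
  assumes V: "vsub V" "\<And>x. x \<in> space V \<Longrightarrow> \<tau> x \<in> tens W" "lin_on (space V) (scale V) fscale \<tau>"
    and W: "vsub W" and G: "tril W G"
  shows "bil V (\<lambda>y u. ev W (\<tau> y) (\<lambda>z v. G z v u))"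
  unfolding bil_def
proof (intro conjI ballI allI)
  fix y assume "y \<in> space V"
  thus "lin_on UNIV (bscale A) (*) (\<lambda>u. ev W (\<tau> y) (\<lambda>z v. G z v u))"
    using G by (intro ev_param_UNIV W V) (auto simp: tril_def)
next
  fix u
  have "bil W (\<lambda>z v. G z v u)" using G by (auto simp: tril_def bil_def)
  thus "lin_on (space V) (scale V) (*) (\<lambda>y. ev W (\<tau> y) (\<lambda>z v. G z v u))"
    by (intro lin_on_comp[OF ev_lin V(3)] W V) auto
qed

lemma bil_sd_tril: "vsub V \<Longrightarrow> tril V G \<Longrightarrow> bil V (\<lambda>y u. sd u (G y))"
  unfolding bil_def tril_def
  by (intro conjI ballI allI sd_lin sd_param_sub) (auto simp: bilA_def)

lemma tril_bil: "tril V G \<Longrightarrow> bil V (\<lambda>z v. G z v u)"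
  by (auto simp: tril_def bil_def)

lemma bil_act:
  assumes "yd_module A V" "bil V G"
  shows "bil V (\<lambda>y u. G (act V b y) u)"
  by (rule bil_comp[OF assms(2)]) (use assms in \<open>auto simp: yd_act_lin yd_act_in\<close>)

section \<open>Transport of structure\<close>

text \<open>Every element of \<open>F\<close> is some \<open>f x\<close>, and a test function on
  \<open>F\<close> becomes one on \<open>E\<close> by composition with \<open>f\<close>; each axiom
  of \<open>F\<close> is then the axiom of \<open>E\<close> read through \<open>f\<close>.
  Splittings of extensions, shears and copies on another type are all handled by this one
  transport.\<close>

lemma yd_image:
  assumes E: "yd_module A E" and F: "vsub F"
    and f: "lin_on (space E) (scale E) (scale F) f" "f ` space E = space F"
    and act: "\<And>a x. x \<in> space E \<Longrightarrow> act F a (f x) = f (act E a x)"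
    and ct: "\<And>x. x \<in> space E \<Longrightarrow> coact F (f x) \<in> tens F"
    and rho: "\<And>x G::_ \<Rightarrow> _ \<Rightarrow> 'k. x \<in> space E \<Longrightarrow> bil F G \<Longrightarrow> rho F (f x) G = rho E x (\<lambda>y u. G (f y) u)"
  shows "yd_module A F" "yd_hom A E F f"
proof -
  note Ev = yd_vsub[OF E]
  have fin: "x \<in> space E \<Longrightarrow> f x \<in> space F" for x using f(2) by auto
  have surj: "(\<And>x. x \<in> space E \<Longrightarrow> P (f x)) \<Longrightarrow> \<forall>y\<in>space F. P y" for P
    unfolding f(2)[symmetric] by blast
  have fadd: "f (x + y) = f x + f y" if "x \<in> space E" "y \<in> space E" for x y
    using lin_on_add[OF f(1)] that by simp
  have fsc: "f (scale E c x) = scale F c (f x)" if "x \<in> space E" for x c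
    using lin_on_scale[OF f(1)] that by simp
  note Ein = vsub_add[OF Ev] vsub_scale[OF Ev] yd_act_in[OF E]
  have lm: "left_mod F"
    unfolding left_mod_def
  proof (intro conjI allI surj)
    show "vsub F" by fact
    show "act F a (f x) \<in> space F" if "x \<in> space E" for a x
      using that by (simp add: act fin Ein)
    show "lin_on (space F) (scale F) (scale F) (act F a)" for a
      unfolding lin_on_def
      by (intro conjI allI surj)
        (simp_all add: fadd[symmetric] fsc[symmetric] act Ein lin_on_add[OF yd_act_lin[OF E]]
          lin_on_scale[OF yd_act_lin[OF E]])
    show "lin_on UNIV (bscale A) (scale F) (\<lambda>a. act F a (f x))" if x: "x \<in> space E" for x
      using yd_act_lin_alg[OF E x] x by (auto simp: lin_on_def act fadd fsc Ein)
    show "act F 1 (f x) = f x" if "x \<in> space E" for x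
      using that by (simp add: act yd_act_one[OF E])
    show "act F (a * b) (f x) = act F a (act F b (f x))" if "x \<in> space E" for a b x
      using that by (simp add: act yd_act_mult[OF E] Ein)
  qed
  have bf: "bil E (\<lambda>y u. G (f y) u)" if "bil F G" for G by (rule bil_comp[OF that f(1) fin])
  note rl = lin_on_add[OF rho_lin[OF E bf]] lin_on_scale[OF rho_lin[OF E bf]]
  have cl: "coact_lin F"
    unfolding coact_lin_def
  proof (intro conjI surj ct)
    \<comment> \<open>Tested on bilinear functions, linearity of this coaction is linearity of the
      coaction of \<open>E\<close>.\<close>
    show "lin_on (space F) (scale F) fscale (coact F)"
      unfolding lin_on_def
      by (intro conjI allI surj; rule ev_eqI[OF F])
        (simp_all add: fadd[symmetric] fsc[symmetric] ct Ein tspace_add tspace_scale ev_add ev_scale F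
          rho rl)
  qed
  have "coassoc F"
    unfolding coassoc_def
  proof (intro surj allI impI)
    fix x and G :: "_ \<Rightarrow> 'a \<Rightarrow> 'a \<Rightarrow> 'k" assume x: "x \<in> space E" and G: "tril F G"
    \<comment> \<open>\<open>rho\<close> can be applied to the outer sum only if the inner sum is
      bilinear, which rests on the linearity of the coaction of \<open>F\<close> obtained
      above.\<close>
    have "bil F (\<lambda>y u. rho F y (\<lambda>z v. G z v u))"
      by (rule bil_rho_tril) (use cl in \<open>auto simp: coact_lin_def F G\<close>)
    hence "rho F (f x) (\<lambda>y u. rho F y (\<lambda>z v. G z v u)) = rho E x (\<lambda>y u. rho F (f y) (\<lambda>z v. G z v u))"
      by (rule rho[OF x])
    also have "\<dots> = rho E x (\<lambda>y u. rho E y (\<lambda>z v. G (f z) v u))"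
      by (intro ev_cong Ev yd_coact_in E x rho tril_bil G)
    also have "\<dots> = rho E x (\<lambda>y u. sd u (G (f y)))"
      by (rule yd_coassoc[OF E x tril_comp[OF G f(1) fin]])
    also have "\<dots> = rho F (f x) (\<lambda>y u. sd u (G y))"
      by (rule rho[OF x bil_sd_tril[OF F G], symmetric])
    finally show "rho F (f x) (\<lambda>y u. rho F y (\<lambda>z v. G z v u)) = rho F (f x) (\<lambda>y u. sd u (G y))" .
  qed
  moreover have "counital F"
    unfolding counital_def
  proof (intro surj allI impI)
    fix x and \<phi> :: "_ \<Rightarrow> 'k" assume x: "x \<in> space E" and \<phi>: "lin_on (space F) (scale F) (*) \<phi>"
    have "bil F (\<lambda>y u. counit A u * \<phi> y)"
      using \<phi> counit_lin by (auto simp: bil_def intro: lin_on_mult_left lin_on_mult_right)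
    hence "rho F (f x) (\<lambda>y u. counit A u * \<phi> y) = rho E x (\<lambda>y u. counit A u * \<phi> (f y))"
      by (rule rho[OF x])
    also have "\<dots> = \<phi> (f x)"
      by (rule yd_counit[OF E x lin_on_comp[OF \<phi> f(1) fin]])
    finally show "rho F (f x) (\<lambda>y u. counit A u * \<phi> y) = \<phi> (f x)" .
  qed
  moreover have "yd_compat F"
    unfolding yd_compat_def
  proof (intro surj allI impI)
    fix a x and G :: "_ \<Rightarrow> 'a \<Rightarrow> 'k" assume x: "x \<in> space E" and G: "bil F G"
    have "bil F (\<lambda>y u. G (act F b y) (c * u))" for b c
      by (rule bil_mult_left, rule bil_comp[OF G]) (use lm in \<open>auto simp: left_mod_def\<close>)
    hence "sd a (\<lambda>b c. rho F (f x) (\<lambda>y u. G (act F b y) (c * u))) =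
      sd a (\<lambda>b c. rho E x (\<lambda>y u. G (act F b (f y)) (c * u)))"
      by (simp add: rho x)
    also have "\<dots> = sd a (\<lambda>b c. rho E x (\<lambda>y u. G (f (act E b y)) (c * u)))"
      by (intro arg_cong[of _ _ "sd a"] ext ev_cong Ev yd_coact_in E x) (simp add: act)
    also have "\<dots> = sd a (\<lambda>b c. rho E (act E c x) (\<lambda>y u. G (f y) (u * b)))"
      using yd_compatD[OF E x bf[OF G], of a] by simp
    also have "\<dots> = sd a (\<lambda>b c. rho F (act F c (f x)) (\<lambda>y u. G y (u * b)))"
      by (simp add: act x rho Ein bil_mult_right G)
    finally show "sd a (\<lambda>b c. rho F (act F c (f x)) (\<lambda>y u. G y (u * b))) =
      sd a (\<lambda>b c. rho F (f x) (\<lambda>y u. G (act F b y) (c * u)))" by simp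
  qed
  ultimately show "yd_module A F" using lm cl by (simp add: yd_module_iff)
  show "yd_hom A E F f"
    using cl f(1) fin act rho by (subst yd_hom_iff) (auto simp: Ev F coact_lin_def yd_coact_in[OF E])
qed

section \<open>Modules twisted by a cochain\<close>

text \<open>The record is completed in two stages because the coaction takes values in tensors over
  the record itself; \<open>MA\<close> reads only the space and the scaling, which the provisional
  \<open>S\<close> already has. \<open>\<theta> y\<close> is added to the coaction of
  \<open>x\<close> before both are carried along \<open>n \<mapsto> (n, 0)\<close>, so one Sweedler
  sum covers them.\<close>

definition tw :: "('m::ab_group_add, 'a, 'k) yd \<Rightarrow> ('n::ab_group_add, 'a, 'k) yd
    \<Rightarrow> ('m \<Rightarrow> ('n \<times> 'a list, 'k) tensor) \<Rightarrow> ('a \<Rightarrow> 'm \<Rightarrow> 'n) \<Rightarrow> ('n \<times> 'm, 'a, 'k) yd" where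
  "tw M N \<theta> \<omega> =
     (let S = \<lparr>space = space N \<times> space M,
               scale = (\<lambda>c (x, y). (scale N c x, scale M c y)),
               act = (\<lambda>a (x, y). (act N a x + \<omega> a y, act M a y)),
               coact = (\<lambda>_. 0)\<rparr>
      in S\<lparr>coact := (\<lambda>(x, y).
            tsum (MA A N 1) (\<lambda>(x\<^sub>0, u). pure (MA A S 1) ((x\<^sub>0, 0), u)) (coact N x + \<theta> y) +
            tsum (MA A M 1) (\<lambda>(y\<^sub>0, u). pure (MA A S 1) ((0, y\<^sub>0), u)) (coact M y))\<rparr>)"

lemma tw_simps:
  "space (tw M N \<theta> \<omega>) = space N \<times> space M"
  "scale (tw M N \<theta> \<omega>) c (x, y) = (scale N c x, scale M c y)"
  "act (tw M N \<theta> \<omega>) a (x, y) = (act N a x + \<omega> a y, act M a y)"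
  by (simp_all add: tw_def Let_def)

lemma tw_scale: "scale (tw M N \<theta> \<omega>) = (\<lambda>c (x, y). (scale N c x, scale M c y))"
  by (simp add: tw_def Let_def)

lemma tw_coact:
  "coact (tw M N \<theta> \<omega>) (x, y) =
     tsum (MA A N 1) (\<lambda>(x\<^sub>0, u). pure (MA A (tw M N \<theta> \<omega>) 1) ((x\<^sub>0, 0), u)) (coact N x + \<theta> y) +
     tsum (MA A M 1) (\<lambda>(y\<^sub>0, u). pure (MA A (tw M N \<theta> \<omega>) 1) ((0, y\<^sub>0), u)) (coact M y)"
proof -
  have "MA A (tw M N \<theta> \<omega>) 1 = MA A \<lparr>space = space N \<times> space M,
               scale = (\<lambda>c (x, y). (scale N c x, scale M c y)),
               act = (\<lambda>a (x, y). (act N a x + \<omega> a y, act M a y)),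
               coact = (\<lambda>_. 0)\<rparr> 1"
    by (simp add: MA_def tw_def Let_def)
  thus ?thesis by (simp add: tw_def Let_def)
qed

lemma tw_zero: "tw M N (\<lambda>_. 0) (\<lambda>_ _. 0) = yd_sum A N M"
  by (simp add: tw_def yd_sum_def)

text \<open>The linear half of the data: a pair of cochains with no identities imposed, so that
  these can be compared with the axioms of \<open>tw M N \<theta> \<omega>\<close> one at a
  time.\<close>

definition datum :: "('m::ab_group_add, 'a, 'k) yd \<Rightarrow> ('n::ab_group_add, 'a, 'k) yd
    \<Rightarrow> ('m \<Rightarrow> ('n \<times> 'a list, 'k) tensor) \<Rightarrow> ('a \<Rightarrow> 'm \<Rightarrow> 'n) \<Rightarrow> bool" where
  "datum M N \<theta> \<omega> \<longleftrightarrow>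
     (\<forall>m\<in>space M. \<theta> m \<in> tens N) \<and> lin_on (space M) (scale M) fscale \<theta> \<and>
     (\<forall>a. \<forall>m\<in>space M. \<omega> a m \<in> space N) \<and>
     (\<forall>a. lin_on (space M) (scale M) (scale N) (\<omega> a)) \<and>
     (\<forall>m\<in>space M. lin_on UNIV (bscale A) (scale N) (\<lambda>a. \<omega> a m))"

text \<open>
  For a pair \<open>\<theta> : M \<rightarrow> N \<otimes> A\<close>, \<open>\<omega> : A \<otimes> M \<rightarrow> N\<close>, the three conditions are \<open>d\<^sub>m \<omega> = 0\<close>, \<open>d\<^sub>c \<theta> = 0\<close>
  and \<open>d\<^sub>m \<theta> = d\<^sub>c \<omega>\<close>, with all terms on the side where they have a plus sign.
\<close>

definition cocycle :: "('m::ab_group_add, 'a, 'k) yd \<Rightarrow> ('n::ab_group_add, 'a, 'k) yd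
    \<Rightarrow> ('m \<Rightarrow> ('n \<times> 'a list, 'k) tensor) \<Rightarrow> ('a \<Rightarrow> 'm \<Rightarrow> 'n) \<Rightarrow> bool" where
  "cocycle M N \<theta> \<omega> \<longleftrightarrow>
     (\<forall>a b. \<forall>m\<in>space M. \<omega> (a * b) m = act N a (\<omega> b m) + \<omega> a (act M b m)) \<and>
     (\<forall>m\<in>space M. \<forall>G::'n \<Rightarrow> 'a \<Rightarrow> 'a \<Rightarrow> 'k. tril N G \<longrightarrow>
        ev N (\<theta> m) (\<lambda>y u. rho N y (\<lambda>z v. G z v u)) + rho M m (\<lambda>x u. ev N (\<theta> x) (\<lambda>z v. G z v u)) =
        ev N (\<theta> m) (\<lambda>y u. sd u (G y))) \<and>
     (\<forall>a. \<forall>m\<in>space M. \<forall>G::'n \<Rightarrow> 'a \<Rightarrow> 'k. bil N G \<longrightarrow>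
        sd a (\<lambda>b c. ev N (\<theta> (act M c m)) (\<lambda>y u. G y (u * b))) +
        sd a (\<lambda>b c. rho N (\<omega> c m) (\<lambda>y u. G y (u * b))) =
        sd a (\<lambda>b c. ev N (\<theta> m) (\<lambda>y u. G (act N b y) (c * u))) +
        sd a (\<lambda>b c. rho M m (\<lambda>x u. G (\<omega> b x) (c * u))))"

lemma datumD:
  assumes "datum M N \<theta> \<omega>"
  shows "m \<in> space M \<Longrightarrow> \<theta> m \<in> tens N" "lin_on (space M) (scale M) fscale \<theta>"
    "m \<in> space M \<Longrightarrow> \<omega> a m \<in> space N" "lin_on (space M) (scale M) (scale N) (\<omega> a)"
    "m \<in> space M \<Longrightarrow> lin_on UNIV (bscale A) (scale N) (\<lambda>a. \<omega> a m)"
  using assms unfolding datum_def by blast+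

lemma tw_vsub:
  assumes "vsub M" "vsub N"
  shows "vsub (tw M N \<theta> \<omega>)"
proof -
  have m: "vector_space (scale M)" "vector_space (scale N)" using assms by (auto simp: vsub_def)
  have v: "vector_space (scale (tw M N \<theta> \<omega>))"
    using m unfolding vector_space_def by (auto simp: tw_scale)
  show ?thesis
    unfolding vsub_def module.subspace_def[OF v[folded module_iff_vector_space]]
    using v assms by (auto simp: tw_simps vsub_0 vsub_add vsub_scale zero_prod_def)
qed

lemma tw_bil_comp:
  assumes "vsub M" "vsub N" "bil (tw M N \<theta> \<omega>) G"
  shows "bil N (\<lambda>y u. G (y, 0) u)" "bil M (\<lambda>x u. G (0, x) u)"
    "y \<in> space N \<Longrightarrow> x \<in> space M \<Longrightarrow> G (y, x) u = G (y, 0) u + G (0, x) u"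
proof -
  interpret M: vector_space "scale M" using assms by (simp add: vsub_def)
  interpret N: vector_space "scale N" using assms by (simp add: vsub_def)
  show "bil N (\<lambda>y u. G (y, 0) u)"
    by (rule bil_comp[OF assms(3)]) (auto simp: lin_on_def tw_simps vsub_0 assms)
  show "bil M (\<lambda>x u. G (0, x) u)"
    by (rule bil_comp[OF assms(3)]) (auto simp: lin_on_def tw_simps vsub_0 assms)
  show "y \<in> space N \<Longrightarrow> x \<in> space M \<Longrightarrow> G (y, x) u = G (y, 0) u + G (0, x) u"
    using lin_on_add[OF bilD2[OF assms(3)], of "(y, 0)" "(0, x)" u] by (simp add: tw_simps vsub_0 assms)
qed

lemma tw_tril_comp:
  assumes "vsub M" "vsub N" "tril (tw M N \<theta> \<omega>) G"
  shows "tril N (\<lambda>y u. G (y, 0) u)" "tril M (\<lambda>x u. G (0, x) u)"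
proof -
  interpret M: vector_space "scale M" using assms by (simp add: vsub_def)
  interpret N: vector_space "scale N" using assms by (simp add: vsub_def)
  show "tril N (\<lambda>y u. G (y, 0) u)"
    by (rule tril_comp[OF assms(3)]) (auto simp: lin_on_def tw_simps vsub_0 assms)
  show "tril M (\<lambda>x u. G (0, x) u)"
    by (rule tril_comp[OF assms(3)]) (auto simp: lin_on_def tw_simps vsub_0 assms)
qed

end

section \<open>When a twisted module is Yetter-Drinfel'd\<close>

locale yd_pair = sweedler A for A :: "('a::ring_1, 'k::field) bialg" +
  fixes M :: "('m::ab_group_add, 'a, 'k) yd" and N :: "('n::ab_group_add, 'a, 'k) yd"
  assumes M: "yd_module A M" and N: "yd_module A N"
begin

lemmas vM = yd_vsub[OF M]
lemmas vN = yd_vsub[OF N]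
lemmas tw_vs = tw_vsub[OF vM vN]
lemmas tw_bil = tw_bil_comp[OF vM vN]
lemmas tw_tril = tw_tril_comp[OF vM vN]

lemma tw_coact_ev:
  assumes d: "datum M N \<theta> \<omega>" and xy: "x \<in> space N" "y \<in> space M"
  shows "coact (tw M N \<theta> \<omega>) (x, y) =
     ev N (coact N x + \<theta> y) (\<lambda>z u. pure (MA A (tw M N \<theta> \<omega>) 1) ((z, 0), [u])) +
     ev M (coact M y) (\<lambda>z u. pure (MA A (tw M N \<theta> \<omega>) 1) ((0, z), [u]))"
  unfolding tw_coact using d xy
  by (simp add: tsum_MA_ev vM vN yd_coact_in M N tspace_add datumD)

lemma tw_coact_in:
  assumes d: "datum M N \<theta> \<omega>" and xy: "x \<in> space N" "y \<in> space M"
  shows "coact (tw M N \<theta> \<omega>) (x, y) \<in> tens (tw M N \<theta> \<omega>)"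
  unfolding tw_coact_ev[OF assms] using d xy
  by (intro tspace_add push_in)
    (auto simp: vM vN yd_coact_in M N tspace_add datumD tw_simps vsub_0)

text \<open>To a test function the twisted coaction is a sum of three terms: the coactions of
  \<open>N\<close> and \<open>M\<close>, and the twist. The axioms for twisted modules are treated
  by expanding with this formula and cancelling what \<open>N\<close> and \<open>M\<close> satisfy
  by themselves.\<close>

lemma tw_rho:
  fixes G :: "_ \<Rightarrow> _ \<Rightarrow> 'k"
  assumes d: "datum M N \<theta> \<omega>" and xy: "x \<in> space N" "y \<in> space M" and G: "bil (tw M N \<theta> \<omega>) G"
  shows "rho (tw M N \<theta> \<omega>) (x, y) G =
     rho N x (\<lambda>z u. G (z, 0) u) + ev N (\<theta> y) (\<lambda>z u. G (z, 0) u) + rho M y (\<lambda>z u. G (0, z) u)"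
  unfolding tw_coact_ev[OF d xy]
  by (subst ev_add[OF tw_vs G])
    (use d xy G in \<open>simp_all add: push_in ev_push ev_add tw_bil tw_vs vM vN yd_coact_in M N
        tspace_add datumD tw_simps vsub_0\<close>)

lemma tw_coact_lin:
  assumes d: "datum M N \<theta> \<omega>"
  shows "coact_lin (tw M N \<theta> \<omega>)"
proof -
  note ct = tw_coact_in[OF d] and l = rho_lin[OF N] rho_lin[OF M] lin_on_comp[OF ev_lin datumD(2)[OF d]]
  have l': "lin_on (space M) (scale M) (*) (\<lambda>y. ev N (\<theta> y) G)" if "bil N G" for G
    by (rule lin_on_comp[OF ev_lin datumD(2)[OF d]]) (use that d in \<open>auto simp: vN datumD\<close>)
  show ?thesis
    unfolding coact_lin_def
  proof (intro conjI ballI)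
    show "coact (tw M N \<theta> \<omega>) m \<in> tens (tw M N \<theta> \<omega>)" if "m \<in> space (tw M N \<theta> \<omega>)" for m
      using that by (cases m) (simp add: tw_simps ct)
    show "lin_on (space (tw M N \<theta> \<omega>)) (scale (tw M N \<theta> \<omega>)) fscale (coact (tw M N \<theta> \<omega>))"
      unfolding lin_on_def tw_simps(1)
    proof (intro conjI ballI allI; clarify; rule ev_eqI[OF tw_vs])
      fix n m n' m' and G :: "_ \<Rightarrow> _ \<Rightarrow> 'k"
      assume nm: "n \<in> space N" "m \<in> space M" "n' \<in> space N" "m' \<in> space M" and G: "bil (tw M N \<theta> \<omega>) G"
      show "rho (tw M N \<theta> \<omega>) ((n, m) + (n', m')) G =
        ev (tw M N \<theta> \<omega>) (coact (tw M N \<theta> \<omega>) (n, m) + coact (tw M N \<theta> \<omega>) (n', m')) G"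
        using nm by (simp add: ev_add tw_vs G ct tw_rho[OF d _ _ G] vsub_add vM vN tw_bil[OF G]
            lin_on_add[OF rho_lin[OF N tw_bil(1)[OF G]]] lin_on_add[OF rho_lin[OF M tw_bil(2)[OF G]]]
            lin_on_add[OF l'])
    next
      fix c n m and G :: "_ \<Rightarrow> _ \<Rightarrow> 'k"
      assume nm: "n \<in> space N" "m \<in> space M" and G: "bil (tw M N \<theta> \<omega>) G"
      show "rho (tw M N \<theta> \<omega>) (scale (tw M N \<theta> \<omega>) c (n, m)) G =
        ev (tw M N \<theta> \<omega>) (fscale c (coact (tw M N \<theta> \<omega>) (n, m))) G"
        using nm by (simp add: ev_scale tw_vs G ct tw_rho[OF d _ _ G] vsub_scale vM vN tw_bil[OF G]
            lin_on_scale[OF rho_lin[OF N tw_bil(1)[OF G]]] lin_on_scale[OF rho_lin[OF M tw_bil(2)[OF G]]]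
            lin_on_scale[OF l'] tw_simps algebra_simps)
    qed (auto simp: ct tspace_add tspace_scale vsub_add vsub_scale vM vN tw_simps)
  qed
qed

text \<open>After two uses of \<open>tw_rho\<close> the pure \<open>N\<close>-terms and pure
  \<open>M\<close>-terms cancel by coassociativity of \<open>N\<close> and \<open>M\<close>. There
  remain the twist followed by the coaction of \<open>N\<close>, the coaction of \<open>M\<close>
  followed by the twist, and the twist followed by the comultiplication.\<close>

lemma tw_coassoc_at:
  fixes G :: "_ \<Rightarrow> _ \<Rightarrow> _ \<Rightarrow> 'k"
  assumes d: "datum M N \<theta> \<omega>" and xy: "x \<in> space N" "y \<in> space M" and G: "tril (tw M N \<theta> \<omega>) G"
  shows "rho (tw M N \<theta> \<omega>) (x, y) (\<lambda>y u. rho (tw M N \<theta> \<omega>) y (\<lambda>z v. G z v u)) =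
     rho (tw M N \<theta> \<omega>) (x, y) (\<lambda>y u. sd u (G y)) \<longleftrightarrow>
     ev N (\<theta> y) (\<lambda>y u. rho N y (\<lambda>z v. G (z, 0) v u)) +
       rho M y (\<lambda>x u. ev N (\<theta> x) (\<lambda>z v. G (z, 0) v u)) =
     ev N (\<theta> y) (\<lambda>y u. sd u (G (y, 0)))"
proof -
  let ?T = "tw M N \<theta> \<omega>"
  note c = tw_coact_lin[OF d]
  have 1: "bil ?T (\<lambda>y u. rho ?T y (\<lambda>z v. G z v u))"
    by (rule bil_rho_tril) (use c in \<open>auto simp: coact_lin_def tw_vs G\<close>)
  have 2: "bil ?T (\<lambda>y u. sd u (G y))" by (rule bil_sd_tril[OF tw_vs G])
  have b: "bil ?T (\<lambda>z v. G z v u)" for u by (rule tril_bil[OF G])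
  note b' = tw_bil[OF b]
  have 0: "bil M G \<Longrightarrow> rho M 0 G = 0" "bil N H \<Longrightarrow> rho N 0 H = 0" "bil N H \<Longrightarrow> ev N (\<theta> 0) H = 0" for G H
    using lin_on_0[OF yd_coact_lin[OF M]] lin_on_0[OF yd_coact_lin[OF N]] lin_on_0[OF datumD(2)[OF d]]
    by (simp_all add: vsub_0 vM vN ev_zero)
  have N1: "rho N x (\<lambda>z u. rho ?T (z, 0) (\<lambda>w v. G w v u)) = rho N x (\<lambda>z u. rho N z (\<lambda>w v. G (w, 0) v u))"
    by (rule ev_cong) (simp_all add: vN vM yd_coact_in N xy tw_rho[OF d _ _ b] vsub_0 0 b')
  have N2: "ev N (\<theta> y) (\<lambda>z u. rho ?T (z, 0) (\<lambda>w v. G w v u)) = ev N (\<theta> y) (\<lambda>z u. rho N z (\<lambda>w v. G (w, 0) v u))"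
    by (rule ev_cong) (simp_all add: vN vM datumD(1)[OF d] xy tw_rho[OF d _ _ b] vsub_0 0 b')
  \<comment> \<open>On \<open>(0, x)\<close> the twisted coaction has a component in
    \<open>N \<otimes> A\<close>, namely \<open>\<theta> x\<close>, besides the coaction of
    \<open>M\<close>; on \<open>(z, 0)\<close> the twist contributes nothing since
    \<open>\<theta> 0 = 0\<close>.\<close>
  have M1: "rho M y (\<lambda>x u. rho ?T (0, x) (\<lambda>w v. G w v u)) =
     rho M y (\<lambda>x u. ev N (\<theta> x) (\<lambda>z v. G (z, 0) v u) + rho M x (\<lambda>z v. G (0, z) v u))"
    by (rule ev_cong) (simp_all add: vN vM yd_coact_in M xy tw_rho[OF d _ _ b] vsub_0 0 b')
  show ?thesis
    unfolding tw_rho[OF d xy 1] tw_rho[OF d xy 2] N1 N2 M1 ev_plus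
      yd_coassoc[OF N xy(1) tw_tril(1)[OF G]] yd_coassoc[OF M xy(2) tw_tril(2)[OF G]]
    by (simp add: algebra_simps)
qed

text \<open>A test function that ignores \<open>M\<close>; used at a point \<open>(0, m)\<close>, it
  isolates the \<open>N\<close>-component of an axiom and so recovers the cocycle identity from
  it.\<close>

lemma tril_fst:
  assumes "tril N G"
  shows "tril (tw M N \<theta> \<omega>) (\<lambda>x. G (fst x))"
  by (rule tril_comp[OF assms]) (auto simp: lin_on_def tw_simps)

lemma bil_fst:
  assumes "bil N G"
  shows "bil (tw M N \<theta> \<omega>) (\<lambda>x. G (fst x))"
  by (rule bil_comp[OF assms]) (auto simp: lin_on_def tw_simps)

lemma tw_coassoc_iff:
  assumes d: "datum M N \<theta> \<omega>"
  shows "coassoc (tw M N \<theta> \<omega>) \<longleftrightarrow>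
    (\<forall>m\<in>space M. \<forall>G::'n \<Rightarrow> 'a \<Rightarrow> 'a \<Rightarrow> 'k. tril N G \<longrightarrow>
        ev N (\<theta> m) (\<lambda>y u. rho N y (\<lambda>z v. G z v u)) + rho M m (\<lambda>x u. ev N (\<theta> x) (\<lambda>z v. G z v u)) =
        ev N (\<theta> m) (\<lambda>y u. sd u (G y)))" (is "_ \<longleftrightarrow> ?r")
proof
  assume c: "coassoc (tw M N \<theta> \<omega>)"
  show ?r
  proof (intro ballI allI impI)
    fix m G assume m: "m \<in> space M" and G: "tril N (G :: 'n \<Rightarrow> 'a \<Rightarrow> 'a \<Rightarrow> 'k)"
    show "ev N (\<theta> m) (\<lambda>y u. rho N y (\<lambda>z v. G z v u)) + rho M m (\<lambda>x u. ev N (\<theta> x) (\<lambda>z v. G z v u)) =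
        ev N (\<theta> m) (\<lambda>y u. sd u (G y))"
      using c[unfolded coassoc_def, rule_format, OF _ tril_fst[OF G], of "(0, m)"]
        tw_coassoc_at[OF d vsub_0[OF vN] m tril_fst[OF G]] m
      by (simp add: tw_simps vsub_0 vN)
  qed
next
  assume r: ?r
  show "coassoc (tw M N \<theta> \<omega>)"
    unfolding coassoc_def
  proof (intro ballI allI impI)
    fix p and G :: "_ \<Rightarrow> _ \<Rightarrow> _ \<Rightarrow> 'k" assume "p \<in> space (tw M N \<theta> \<omega>)" and G: "tril (tw M N \<theta> \<omega>) G"
    then obtain x y where p: "p = (x, y)" "x \<in> space N" "y \<in> space M" by (auto simp: tw_simps)
    show "rho (tw M N \<theta> \<omega>) p (\<lambda>y u. rho (tw M N \<theta> \<omega>) y (\<lambda>z v. G z v u)) =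
       rho (tw M N \<theta> \<omega>) p (\<lambda>y u. sd u (G y))"
      unfolding p(1) tw_coassoc_at[OF d p(2,3) G]
      using r[rule_format, OF p(3) tw_tril(1)[OF G]] .
  qed
qed

lemma tw_act_in: "datum M N \<theta> \<omega> \<Longrightarrow> x \<in> space (tw M N \<theta> \<omega>) \<Longrightarrow> act (tw M N \<theta> \<omega>) a x \<in> space (tw M N \<theta> \<omega>)"
  by (cases x) (auto simp: tw_simps vsub_add vN yd_act_in M N datumD)

lemma tw_act_lin:
  assumes "datum M N \<theta> \<omega>"
  shows "lin_on (space (tw M N \<theta> \<omega>)) (scale (tw M N \<theta> \<omega>)) (scale (tw M N \<theta> \<omega>)) (act (tw M N \<theta> \<omega>) a)"
proof -
  interpret Nv: vector_space "scale N" using vN by (simp add: vsub_def)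
  show ?thesis
    using yd_act_lin[OF M, of a] yd_act_lin[OF N, of a] datumD(4)[OF assms, of a]
    by (auto simp: lin_on_def tw_simps Nv.scale_right_distrib)
qed

text \<open>Both sides expand to four terms. Compatibility of \<open>N\<close> cancels those that
  involve \<open>x\<close>, compatibility of \<open>M\<close> those seen through the
  \<open>M\<close>-component; each of the surviving terms contains \<open>\<theta>\<close> or
  \<open>\<omega>\<close> exactly once.\<close>

lemma tw_yd_at:
  fixes G :: "_ \<Rightarrow> _ \<Rightarrow> 'k"
  assumes d: "datum M N \<theta> \<omega>" and xy: "x \<in> space N" "y \<in> space M" and G: "bil (tw M N \<theta> \<omega>) G"
  shows "sd a (\<lambda>b c. rho (tw M N \<theta> \<omega>) (act (tw M N \<theta> \<omega>) c (x, y)) (\<lambda>y u. G y (u * b))) =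
     sd a (\<lambda>b c. rho (tw M N \<theta> \<omega>) (x, y) (\<lambda>y u. G (act (tw M N \<theta> \<omega>) b y) (c * u))) \<longleftrightarrow>
     sd a (\<lambda>b c. ev N (\<theta> (act M c y)) (\<lambda>y u. G (y, 0) (u * b))) +
        sd a (\<lambda>b c. rho N (\<omega> c y) (\<lambda>y u. G (y, 0) (u * b))) =
        sd a (\<lambda>b c. ev N (\<theta> y) (\<lambda>y u. G (act N b y, 0) (c * u))) +
        sd a (\<lambda>b c. rho M y (\<lambda>x u. G (\<omega> b x, 0) (c * u)))"
proof -
  let ?T = "tw M N \<theta> \<omega>"
  have 1: "bil ?T (\<lambda>y u. G y (u * b))" for b by (rule bil_mult_right[OF G])
  have 2: "bil ?T (\<lambda>y u. G (act ?T b y) (c * u))" for b c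
    by (rule bil_mult_left, rule bil_comp[OF G tw_act_lin[OF d] tw_act_in[OF d]])
  note G12 = tw_bil[OF G]
  have o: "\<omega> b 0 = 0" "act M b 0 = 0" for b
    using lin_on_0[OF datumD(4)[OF d]] lin_on_0[OF yd_act_lin[OF M]] by (auto simp: vsub_0 vM)
  have "rho ?T (act ?T c (x, y)) (\<lambda>y u. G y (u * b)) =
     rho N (act N c x) (\<lambda>y u. G (y, 0) (u * b)) + rho N (\<omega> c y) (\<lambda>y u. G (y, 0) (u * b)) +
     ev N (\<theta> (act M c y)) (\<lambda>y u. G (y, 0) (u * b)) + rho M (act M c y) (\<lambda>y u. G (0, y) (u * b))" for b c
    unfolding tw_simps
    by (subst tw_rho[OF d _ _ 1])
      (use xy in \<open>simp_all add: vsub_add vN yd_act_in M N datumD[OF d]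
         lin_on_add[OF rho_lin[OF N bil_mult_right[OF G12(1)]]]\<close>)
  moreover have "rho ?T (x, y) (\<lambda>y u. G (act ?T b y) (c * u)) =
     rho N x (\<lambda>y u. G (act N b y, 0) (c * u)) + ev N (\<theta> y) (\<lambda>y u. G (act N b y, 0) (c * u)) +
     rho M y (\<lambda>x u. G (\<omega> b x, 0) (c * u)) + rho M y (\<lambda>x u. G (0, act M b x) (c * u))" for b c
  proof -
    have "rho M y (\<lambda>z u. G (\<omega> b z, act M b z) (c * u)) =
      rho M y (\<lambda>x u. G (\<omega> b x, 0) (c * u) + G (0, act M b x) (c * u))"
      by (rule ev_cong) (use xy in \<open>simp_all add: vM yd_coact_in M G12(3) datumD[OF d] yd_act_in\<close>)
    moreover have "act N b 0 = 0" using lin_on_0[OF yd_act_lin[OF N]] by (simp add: vsub_0 vN)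
    ultimately show ?thesis
      by (subst tw_rho[OF d xy 2]) (simp add: tw_simps o ev_plus)
  qed
  ultimately show ?thesis
    using yd_compatD[OF N xy(1) G12(1), of a] yd_compatD[OF M xy(2) G12(2), of a]
    by (simp add: sd_plus algebra_simps)
qed

lemma tw_yd_compat_iff:
  assumes d: "datum M N \<theta> \<omega>"
  shows "yd_compat (tw M N \<theta> \<omega>) \<longleftrightarrow>
     (\<forall>a. \<forall>m\<in>space M. \<forall>G::'n \<Rightarrow> 'a \<Rightarrow> 'k. bil N G \<longrightarrow>
        sd a (\<lambda>b c. ev N (\<theta> (act M c m)) (\<lambda>y u. G y (u * b))) +
        sd a (\<lambda>b c. rho N (\<omega> c m) (\<lambda>y u. G y (u * b))) =
        sd a (\<lambda>b c. ev N (\<theta> m) (\<lambda>y u. G (act N b y) (c * u))) +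
        sd a (\<lambda>b c. rho M m (\<lambda>x u. G (\<omega> b x) (c * u))))" (is "_ \<longleftrightarrow> ?r")
proof
  assume c: "yd_compat (tw M N \<theta> \<omega>)"
  show ?r
  proof (intro ballI allI impI)
    fix a m G assume m: "m \<in> space M" and G: "bil N (G :: 'n \<Rightarrow> 'a \<Rightarrow> 'k)"
    show "sd a (\<lambda>b c. ev N (\<theta> (act M c m)) (\<lambda>y u. G y (u * b))) +
        sd a (\<lambda>b c. rho N (\<omega> c m) (\<lambda>y u. G y (u * b))) =
        sd a (\<lambda>b c. ev N (\<theta> m) (\<lambda>y u. G (act N b y) (c * u))) +
        sd a (\<lambda>b c. rho M m (\<lambda>x u. G (\<omega> b x) (c * u)))"
      using c[unfolded yd_compat_def, rule_format, OF _ bil_fst[OF G], of "(0, m)"]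
        tw_yd_at[OF d vsub_0[OF vN] m bil_fst[OF G]] m
      by (simp add: tw_simps vsub_0 vN)
  qed
next
  assume r: ?r
  show "yd_compat (tw M N \<theta> \<omega>)"
    unfolding yd_compat_def
  proof (intro ballI allI impI)
    fix a p and G :: "_ \<Rightarrow> _ \<Rightarrow> 'k" assume "p \<in> space (tw M N \<theta> \<omega>)" and G: "bil (tw M N \<theta> \<omega>) G"
    then obtain x y where p: "p = (x, y)" "x \<in> space N" "y \<in> space M" by (auto simp: tw_simps)
    show "sd a (\<lambda>b c. rho (tw M N \<theta> \<omega>) (act (tw M N \<theta> \<omega>) c p) (\<lambda>y u. G y (u * b))) =
     sd a (\<lambda>b c. rho (tw M N \<theta> \<omega>) p (\<lambda>y u. G (act (tw M N \<theta> \<omega>) b y) (c * u)))"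
      unfolding p(1) tw_yd_at[OF d p(2,3) G]
      using r[rule_format, OF p(3) tw_bil(1)[OF G]] .
  qed
qed

lemma tw_left_mod_iff:
  assumes d: "datum M N \<theta> \<omega>"
  shows "left_mod (tw M N \<theta> \<omega>) \<longleftrightarrow>
     (\<forall>a b. \<forall>m\<in>space M. \<omega> (a * b) m = act N a (\<omega> b m) + \<omega> a (act M b m))" (is "_ \<longleftrightarrow> ?r")
proof
  assume l: "left_mod (tw M N \<theta> \<omega>)"
  show ?r
  proof (intro allI ballI)
    fix a b m assume m: "m \<in> space M"
    have "(0, m) \<in> space (tw M N \<theta> \<omega>)" using m by (simp add: tw_simps vsub_0 vN)
    hence "act (tw M N \<theta> \<omega>) (a * b) (0, m) = act (tw M N \<theta> \<omega>) a (act (tw M N \<theta> \<omega>) b (0, m))"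
      using l unfolding left_mod_def by blast
    thus "\<omega> (a * b) m = act N a (\<omega> b m) + \<omega> a (act M b m)"
      using lin_on_0[OF yd_act_lin[OF N]] by (simp add: tw_simps vsub_0 vN yd_act_mult[OF M m])
  qed
next
  assume r: ?r
  \<comment> \<open>With \<open>a = b = 1\<close> the identity says that \<open>\<omega> 1 m\<close>
    equals twice itself.\<close>
  have 1: "\<omega> 1 m = 0" if "m \<in> space M" for m
  proof -
    have "\<omega> (1 * 1) m = act N 1 (\<omega> 1 m) + \<omega> 1 (act M 1 m)" using r that by blast
    thus ?thesis using that datumD(3)[OF d that, of 1] by (simp add: yd_act_one[OF M] yd_act_one[OF N])
  qed
  interpret Nv: vector_space "scale N" using vN by (simp add: vsub_def)
  show "left_mod (tw M N \<theta> \<omega>)"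
    unfolding left_mod_def
  proof (intro conjI allI ballI)
    fix m assume "m \<in> space (tw M N \<theta> \<omega>)"
    then obtain x y where m: "m = (x, y)" "x \<in> space N" "y \<in> space M" by (auto simp: tw_simps)
    show "act (tw M N \<theta> \<omega>) a m \<in> space (tw M N \<theta> \<omega>)" for a
      by (rule tw_act_in[OF d]) fact
    show "act (tw M N \<theta> \<omega>) 1 m = m"
      using m by (simp add: tw_simps 1 yd_act_one M N)
    show "lin_on UNIV (bscale A) (scale (tw M N \<theta> \<omega>)) (\<lambda>a. act (tw M N \<theta> \<omega>) a m)"
      using m yd_act_lin_alg[OF N m(2)] yd_act_lin_alg[OF M m(3)] datumD(5)[OF d m(3)]
      by (simp add: tw_simps lin_on_def Nv.scale_right_distrib)
    show "act (tw M N \<theta> \<omega>) (a * b) m = act (tw M N \<theta> \<omega>) a (act (tw M N \<theta> \<omega>) b m)" for a b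
      using m r by (simp add: tw_simps yd_act_mult M N yd_act_in datumD[OF d]
          lin_on_add[OF yd_act_lin[OF N]] add.assoc)
  qed (use tw_vs tw_act_lin[OF d] in auto)
qed

lemma tril_counit2:
  assumes "lin_on (space N) (scale N) (*) \<phi>"
  shows "tril N (\<lambda>y u v. counit A u * (counit A v * \<phi> y))"
  using assms counit_lin unfolding tril_def
  by (intro conjI ballI allI lin_on_mult_left lin_on_mult_right) auto

text \<open>The coassociativity identity for \<open>\<theta>\<close> is tested on the product of two
  counits with the restriction of \<open>\<phi>\<close> to \<open>N\<close>. By the counit axioms of
  \<open>N\<close>, \<open>M\<close> and \<open>A\<close> each of its three terms equals one scalar
  \<open>e y\<close>, the counit defect of \<open>\<theta>\<close>. Hence
  \<open>e y + e y = e y\<close>, and the defect vanishes.\<close>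

lemma tw_counital:
  assumes d: "datum M N \<theta> \<omega>" and c: "coassoc (tw M N \<theta> \<omega>)"
  shows "counital (tw M N \<theta> \<omega>)"
  unfolding counital_def
proof (intro ballI allI impI)
  fix p and \<phi> :: "_ \<Rightarrow> 'k"
  assume "p \<in> space (tw M N \<theta> \<omega>)" and \<phi>: "lin_on (space (tw M N \<theta> \<omega>)) (scale (tw M N \<theta> \<omega>)) (*) \<phi>"
  then obtain x y where p: "p = (x, y)" "x \<in> space N" "y \<in> space M" by (auto simp: tw_simps)
  interpret M: vector_space "scale M" using vM by (simp add: vsub_def)
  interpret N: vector_space "scale N" using vN by (simp add: vsub_def)
  have \<phi>1: "lin_on (space N) (scale N) (*) (\<lambda>y. \<phi> (y, 0))"
    by (rule lin_on_comp[OF \<phi>]) (auto simp: lin_on_def tw_simps vsub_0 vM)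
  have \<phi>2: "lin_on (space M) (scale M) (*) (\<lambda>y. \<phi> (0, y))"
    by (rule lin_on_comp[OF \<phi>]) (auto simp: lin_on_def tw_simps vsub_0 vN)
  define e where "e m = ev N (\<theta> m) (\<lambda>y u. counit A u * \<phi> (y, 0))" for m
  have bN: "bil N (\<lambda>y u. counit A u * \<phi> (y, 0))"
    using \<phi>1 counit_lin by (auto simp: bil_def intro: lin_on_mult_left lin_on_mult_right)
  have e: "lin_on (space M) (scale M) (*) e"
    unfolding e_def[abs_def]
    by (rule lin_on_comp[OF ev_lin datumD(2)[OF d]]) (auto simp: vN bN datumD[OF d])
  have "ev N (\<theta> y) (\<lambda>y u. rho N y (\<lambda>z v. counit A v * (counit A u * \<phi> (z, 0)))) +
     rho M y (\<lambda>x u. ev N (\<theta> x) (\<lambda>z v. counit A v * (counit A u * \<phi> (z, 0)))) =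
     ev N (\<theta> y) (\<lambda>y u. sd u (\<lambda>b c. counit A b * (counit A c * \<phi> (y, 0))))"
    using c[unfolded tw_coassoc_iff[OF d], rule_format, OF p(3) tril_counit2[OF \<phi>1]] .
  moreover have "ev N (\<theta> y) (\<lambda>y u. rho N y (\<lambda>z v. counit A v * (counit A u * \<phi> (z, 0)))) = e y"
    unfolding e_def
    by (intro ev_cong vN datumD[OF d] p yd_counit N lin_on_mult_left \<phi>1)
  moreover have "rho M y (\<lambda>x u. ev N (\<theta> x) (\<lambda>z v. counit A v * (counit A u * \<phi> (z, 0)))) = e y"
  proof -
    have "ev N (\<theta> x) (\<lambda>z v. counit A v * (counit A u * \<phi> (z, 0))) = counit A u * e x" for x u
      unfolding e_def ev_mult[symmetric] by (simp add: ac_simps)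
    thus ?thesis using yd_counit[OF M p(3) e] by simp
  qed
  moreover have "sd u (\<lambda>b c. counit A b * (counit A c * \<phi> (y, 0))) = counit A u * \<phi> (y, 0)" for u y
    by (rule sd_counit_left) (intro lin_on_mult_right counit_lin)
  ultimately have "e y + e y = e y" by (simp only: e_def)
  hence 0: "e y = 0" by (metis add_cancel_right_right)
  have b: "bil (tw M N \<theta> \<omega>) (\<lambda>y u. counit A u * \<phi> y)"
    using \<phi> counit_lin by (auto simp: bil_def intro: lin_on_mult_left lin_on_mult_right)
  have "\<phi> (x, y) = \<phi> (x, 0) + \<phi> (0, y)"
    using lin_on_add[OF \<phi>, of "(x, 0)" "(0, y)"] p by (simp add: tw_simps vsub_0 vM vN)
  thus "rho (tw M N \<theta> \<omega>) p (\<lambda>y u. counit A u * \<phi> y) = \<phi> p"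
    unfolding p(1) tw_rho[OF d p(2,3) b]
    using 0 yd_counit[OF N p(2) \<phi>1] yd_counit[OF M p(3) \<phi>2] by (simp add: e_def)
qed

text \<open>Read from left to right, this extracts the cocycle identities from a module structure
  known for other reasons; read from right to left, it builds an extension from a cocycle.\<close>

theorem tw_yd_module_iff:
  assumes d: "datum M N \<theta> \<omega>"
  shows "yd_module A (tw M N \<theta> \<omega>) \<longleftrightarrow> cocycle M N \<theta> \<omega>"
  unfolding yd_module_iff tw_left_mod_iff[OF d] tw_yd_compat_iff[OF d] cocycle_def
  using tw_coact_lin[OF d] tw_counital[OF d] tw_coassoc_iff[OF d] by blast

end

context sweedler
begin

section \<open>Extensions\<close>

lemma yd_homI:
  assumes "yd_module A V" "yd_module A W" "\<And>x. x \<in> space V \<Longrightarrow> f x \<in> space W"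
    "lin_on (space V) (scale V) (scale W) f"
    "\<And>a m. m \<in> space V \<Longrightarrow> f (act V a m) = act W a (f m)"
    "\<And>m G::_ \<Rightarrow> _ \<Rightarrow> 'k. m \<in> space V \<Longrightarrow> bil W G \<Longrightarrow> rho W (f m) G = rho V m (\<lambda>y u. G (f y) u)"
  shows "yd_hom A V W f"
  using assms by (subst yd_hom_iff) (auto simp: yd_vsub yd_coact_in)

lemma yd_homD:
  assumes "yd_hom A V W f" "yd_module A V" "yd_module A W"
  shows "x \<in> space V \<Longrightarrow> f x \<in> space W" "lin_on (space V) (scale V) (scale W) f"
    "m \<in> space V \<Longrightarrow> f (act V a m) = act W a (f m)"
    "m \<in> space V \<Longrightarrow> bil W G \<Longrightarrow> rho W (f m) G = rho V m (\<lambda>y u. G (f y) u :: 'k)"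
    "bil W G \<Longrightarrow> bil V (\<lambda>y u. G (f y) u)"
proof -
  have *: "f ` space V \<subseteq> space W \<and> lin_on (space V) (scale V) (scale W) f \<and>
     (\<forall>a. \<forall>m\<in>space V. f (act V a m) = act W a (f m)) \<and>
     (\<forall>m\<in>space V. \<forall>G::_ \<Rightarrow> _ \<Rightarrow> 'k. bil W G \<longrightarrow> rho W (f m) G = rho V m (\<lambda>y u. G (f y) u))"
    using assms(1) by (subst (asm) yd_hom_iff) (auto simp: yd_vsub yd_coact_in assms(2,3))
  from * show "x \<in> space V \<Longrightarrow> f x \<in> space W" "lin_on (space V) (scale V) (scale W) f"
    "m \<in> space V \<Longrightarrow> f (act V a m) = act W a (f m)"
    "m \<in> space V \<Longrightarrow> bil W G \<Longrightarrow> rho W (f m) G = rho V m (\<lambda>y u. G (f y) u :: 'k)"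
    by blast+
  from * show "bil W G \<Longrightarrow> bil V (\<lambda>y u. G (f y) u)"
    by (intro bil_comp[of W G V f]) auto
qed

lemma yd_hom_comp:
  assumes f: "yd_hom A U V f" and g: "yd_hom A V W g"
    and yd: "yd_module A U" "yd_module A V" "yd_module A W"
  shows "yd_hom A U W (\<lambda>x. g (f x))"
proof (rule yd_homI[OF yd(1,3)])
  note f = yd_homD[OF f yd(1,2)] and g = yd_homD[OF g yd(2,3)]
  show "lin_on (space U) (scale U) (scale W) (\<lambda>x. g (f x))" by (rule lin_on_comp[OF g(2) f(2) f(1)])
  show "rho W (g (f m)) G = rho U m (\<lambda>y u. G (g (f y)) u)" if "m \<in> space U" "bil W G"
    for m and G :: "_ \<Rightarrow> _ \<Rightarrow> 'k"
    using that by (simp add: g(4) f(1) f(4)[OF _ g(5)])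
qed (simp_all add: yd_homD[OF f yd(1,2)] yd_homD[OF g yd(2,3)])

lemma yd_hom_inverse:
  assumes f: "yd_hom A V W f" "bij_betw f (space V) (space W)" and yd: "yd_module A V" "yd_module A W"
  shows "yd_hom A W V (inv_into (space V) f)"
proof -
  note fD = yd_homD[OF f(1) yd]
  let ?g = "inv_into (space V) f"
  have gf: "?g (f x) = x" if "x \<in> space V" for x
    by (rule bij_betw_inv_into_left[OF f(2) that])
  have surj: "P y" if P: "\<And>x. x \<in> space V \<Longrightarrow> P (f x)" and y: "y \<in> space W" for P y
  proof -
    obtain x where "x \<in> space V" "y = f x" using f(2) y by (auto simp: bij_betw_def)
    thus ?thesis using P by simp
  qed
  show ?thesis
  proof (rule yd_homI[OF yd(2,1)])
    show "?g y \<in> space V" if "y \<in> space W" for y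
      using that by (rule surj[rotated]) (simp add: gf)
    show "lin_on (space W) (scale W) (scale V) ?g"
      unfolding lin_on_def
    proof (intro conjI ballI allI)
      fix x y assume x: "x \<in> space W" and y: "y \<in> space W"
      show "?g (x + y) = ?g x + ?g y"
        by (rule surj[OF _ x], rule surj[OF _ y])
          (simp add: gf lin_on_add[OF fD(2), symmetric] vsub_add yd_vsub yd)
      show "?g (scale W c x) = scale V c (?g x)" for c
        by (rule surj[OF _ x]) (simp add: gf lin_on_scale[OF fD(2), symmetric] vsub_scale yd_vsub yd)
    qed
    show "?g (act W a m) = act V a (?g m)" if m: "m \<in> space W" for a m
      by (rule surj[OF _ m]) (simp add: gf fD(3)[symmetric] yd_act_in yd)
    fix m and G :: "_ \<Rightarrow> _ \<Rightarrow> 'k" assume m: "m \<in> space W" and G: "bil V G"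
    have "bil W (\<lambda>y u. G (?g y) u)"
      by (rule bil_comp[OF G]) fact+
    hence "rho V (?g (f x)) G = rho W (f x) (\<lambda>y u. G (?g y) u)" if "x \<in> space V" for x
      unfolding fD(4)[OF that \<open>bil W _\<close>] using that
      by (simp add: gf) (rule ev_cong, simp_all add: gf yd_vsub yd yd_coact_in)
    thus "rho V (?g m) G = rho W m (\<lambda>y u. G (?g y) u)"
      by (rule surj[OF _ m])
  qed
qed

end

section \<open>Extensions up to equivalence, and their linear splittings\<close>

context yd_pair
begin

lemma extD:
  assumes "(E, i, p) \<in> extensions A M N"
  shows "yd_module A E" "yd_hom A N E i" "yd_hom A E M p" "inj_on i (space N)"
    "\<And>e. e \<in> space E \<Longrightarrow> p e = 0 \<longleftrightarrow> e \<in> i ` space N" "i ` space N \<subseteq> space E" "p ` space E = space M"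
    "\<And>n. n \<in> space N \<Longrightarrow> i n \<in> space E" "\<And>n. n \<in> space N \<Longrightarrow> p (i n) = 0"
  using assms unfolding extensions_def by auto

text \<open>The three extensions may live on different types, as is needed to pass between twisted
  extensions on \<open>'n \<times> 'm\<close> and members of \<open>Ext1\<close> on
  \<open>'e\<close>.\<close>

lemma ext_equiv_trans:
  assumes "X \<in> extensions A M N" "Y \<in> extensions A M N" "Z \<in> extensions A M N"
    "ext_equiv A M N X Y" "ext_equiv A M N Y Z"
  shows "ext_equiv A M N X Z"
proof -
  obtain D i p E j q F k r where XYZ: "X = (D, i, p)" "Y = (E, j, q)" "Z = (F, k, r)"
    by (metis prod_cases3)
  note d = extD(1)[OF assms(1)[unfolded XYZ]] extD(1)[OF assms(2)[unfolded XYZ]]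
    extD(1)[OF assms(3)[unfolded XYZ]]
  obtain f g where f: "yd_hom A D E f" "bij_betw f (space D) (space E)"
      "\<And>x. x \<in> space N \<Longrightarrow> f (i x) = j x" "\<And>d. d \<in> space D \<Longrightarrow> q (f d) = p d"
    and g: "yd_hom A E F g" "bij_betw g (space E) (space F)"
      "\<And>x. x \<in> space N \<Longrightarrow> g (j x) = k x" "\<And>d. d \<in> space E \<Longrightarrow> r (g d) = q d"
    using assms(4,5) unfolding XYZ ext_equiv_def by blast
  show ?thesis
    unfolding XYZ ext_equiv_def split
  proof (intro exI conjI ballI)
    show "yd_hom A D F (\<lambda>x. g (f x))" by (rule yd_hom_comp[OF f(1) g(1) d])
    show "bij_betw (\<lambda>x. g (f x)) (space D) (space F)"
      using bij_betw_trans[OF f(2) g(2)] by (simp add: o_def)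
    show "r (g (f d)) = p d" if "d \<in> space D" for d
      using that f g yd_homD(1)[OF f(1) d(1,2)] by simp
  qed (simp add: f g)
qed

lemma ext_equiv_sym:
  assumes "X \<in> extensions A M N" "Y \<in> extensions A M N" "ext_equiv A M N X Y"
  shows "ext_equiv A M N Y X"
proof -
  obtain D i p E j q where XY: "X = (D, i, p)" "Y = (E, j, q)"
    by (metis prod_cases3)
  note dX = extD[OF assms(1)[unfolded XY]] and dY = extD[OF assms(2)[unfolded XY]]
  obtain f where f: "yd_hom A D E f" "bij_betw f (space D) (space E)"
      "\<And>x. x \<in> space N \<Longrightarrow> f (i x) = j x" "\<And>d. d \<in> space D \<Longrightarrow> q (f d) = p d"
    using assms(3) unfolding XY ext_equiv_def by blast
  have gf: "inv_into (space D) f (f x) = x" if "x \<in> space D" for x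
    by (rule bij_betw_inv_into_left[OF f(2) that])
  show ?thesis
    unfolding XY ext_equiv_def split
  proof (intro exI conjI ballI)
    show "yd_hom A E D (inv_into (space D) f)" by (rule yd_hom_inverse[OF f(1,2) dX(1) dY(1)])
    show "bij_betw (inv_into (space D) f) (space E) (space D)" by (rule bij_betw_inv_into[OF f(2)])
    show "inv_into (space D) f (j x) = i x" if "x \<in> space N" for x
      using gf[OF dX(8)[OF that]] f(3)[OF that] by simp
    show "p (inv_into (space D) f e) = q e" if "e \<in> space E" for e
    proof -
      obtain d where "d \<in> space D" "e = f d" using f(2) \<open>e \<in> space E\<close> by (auto simp: bij_betw_def)
      thus ?thesis by (simp add: gf f(4))
    qed
  qed
qed

definition tw_ext :: "('m \<Rightarrow> ('n \<times> 'a list, 'k) tensor) \<Rightarrow> ('a \<Rightarrow> 'm \<Rightarrow> 'n)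
    \<Rightarrow> ('n \<times> 'm, 'm, 'n, 'a, 'k) ext" where
  "tw_ext \<theta> \<omega> = (tw M N \<theta> \<omega>, (\<lambda>n. (n, 0)), snd)"

lemma rho_0:
  "bil M G \<Longrightarrow> rho M 0 G = 0" "bil N H \<Longrightarrow> rho N 0 H = 0"
  using lin_on_0[OF yd_coact_lin[OF M]] lin_on_0[OF yd_coact_lin[OF N]]
  by (simp_all add: vsub_0 vM vN ev_zero)

lemma datum_0:
  assumes "datum M N \<theta> \<omega>"
  shows "\<theta> 0 = 0" "\<omega> a 0 = 0"
  using lin_on_0[OF datumD(2)[OF assms]] lin_on_0[OF datumD(4)[OF assms]] by (simp_all add: vsub_0 vM)

lemma act_0: "act M a 0 = 0" "act N a 0 = 0"
  using lin_on_0[OF yd_act_lin[OF M]] lin_on_0[OF yd_act_lin[OF N]] by (simp_all add: vsub_0 vM vN)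

lemma ev_zero_fun: "ev V t (\<lambda>_ _. 0) = 0"
  by (simp add: ev_def tsum_zero)

lemma scale_0: "scale M c 0 = 0" "scale N c 0 = 0"
proof -
  interpret M: vector_space "scale M" using vM by (simp add: vsub_def)
  interpret N: vector_space "scale N" using vN by (simp add: vsub_def)
  show "scale M c 0 = 0" "scale N c 0 = 0" by simp_all
qed

lemma tw_extension:
  assumes d: "datum M N \<theta> \<omega>" and c: "cocycle M N \<theta> \<omega>"
  shows "tw_ext \<theta> \<omega> \<in> extensions A M N"
proof -
  let ?T = "tw M N \<theta> \<omega>"
  have T: "yd_module A ?T" using tw_yd_module_iff[OF d] c by simp
  have "yd_hom A N ?T (\<lambda>n. (n, 0))"
  proof (rule yd_homI[OF N T])
    show "rho ?T (m, 0) G = rho N m (\<lambda>y u. G (y, 0) u)" if "m \<in> space N" "bil ?T G" for m G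
      unfolding tw_rho[OF d that(1) vsub_0[OF vM] that(2)]
      by (simp add: datum_0[OF d] ev_zero vN tw_bil[OF that(2)] rho_0)
  qed (auto simp: tw_simps vsub_0 vM lin_on_def datum_0[OF d] act_0 scale_0)
  moreover have "yd_hom A ?T M snd"
  proof (rule yd_homI[OF T M])
    fix m G assume m: "m \<in> space ?T" and G: "bil M (G :: _ \<Rightarrow> _ \<Rightarrow> 'k)"
    then obtain x y where xy: "m = (x, y)" "x \<in> space N" "y \<in> space M" by (auto simp: tw_simps)
    have b: "bil ?T (\<lambda>y u. G (snd y) u)"
      by (rule bil_comp[OF G]) (auto simp: tw_simps lin_on_def)
    \<comment> \<open>Elements of \<open>N\<close> project to 0, so both \<open>N\<close>-terms of
      the twisted coaction vanish under this test function.\<close>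
    have "G 0 = (\<lambda>_. 0)" by (rule ext) (rule lin_on_0[OF bilD2[OF G] vsub_0[OF vM]])
    thus "rho M (snd m) G = rho ?T m (\<lambda>y u. G (snd y) u)"
      unfolding xy(1) tw_rho[OF d xy(2,3) b] by (simp add: ev_zero_fun)
  qed (auto simp: tw_simps lin_on_def)
  ultimately show ?thesis
    unfolding tw_ext_def extensions_def using T vsub_0[OF vN]
    by (auto simp: tw_simps inj_on_def vsub_0[OF vM] image_iff)
qed

text \<open>\<open>p\<close> is extended to the ambient type; over a field a linear map has a right
  inverse on the image of a subspace, with values in that subspace.\<close>

lemma linear_section:
  assumes "yd_module A E" "lin_on (space E) (scale E) (scale M) p" "p ` space E = space M"
  obtains s where "lin_on (space M) (scale M) (scale E) s" "\<And>m. m \<in> space M \<Longrightarrow> s m \<in> space E"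
    "\<And>m. m \<in> space M \<Longrightarrow> p (s m) = m"
proof -
  have vE: "vsub E" by (rule yd_vsub) fact
  obtain q where q: "Vector_Spaces.linear (scale E) (scale M) q" "\<And>x. x \<in> space E \<Longrightarrow> q x = p x"
    using lin_on_extend[OF vE assms(2)] vM unfolding vsub_def by blast
  interpret P: vector_space_pair "scale E" "scale M"
    using vE vM by (auto simp: vsub_def intro: vector_space_pair.intro)
  have "\<exists>g. range g \<subseteq> space E \<and> Vector_Spaces.linear (scale M) (scale E) g \<and> (\<forall>v\<in>q ` space E. q (g v) = v)"
    by (rule P.linear_exists_right_inverse_on[OF q(1)]) (use vE in \<open>simp add: vsub_def\<close>)
  then obtain g where g: "range g \<subseteq> space E" "Vector_Spaces.linear (scale M) (scale E) g"
    "\<And>v. v \<in> q ` space E \<Longrightarrow> q (g v) = v"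
    by blast
  have im: "q ` space E = space M" using q(2) assms(3) by (metis image_cong)
  show ?thesis
  proof (rule that[of g])
    show "lin_on (space M) (scale M) (scale E) g"
      using g(2) by (auto simp: linear_iff_lin_on lin_on_def)
    show "g m \<in> space E" for m using g(1) by auto
    thus "p (g m) = m" if "m \<in> space M" for m
      using g(3)[of m] im q(2)[of "g m"] that by auto
  qed
qed

text \<open>For a linear section \<open>s\<close> of \<open>p\<close>, every \<open>x\<close> is
  uniquely \<open>i (\<nu> x) + s (p x)\<close>, and the twist is the \<open>N\<close>-part of what
  the structure of \<open>E\<close> does to \<open>s m\<close>. Transport along
  \<open>x \<mapsto> (\<nu> x, p x)\<close> makes the twisted module Yetter-Drinfel'd, and the
  cocycle identities follow from that.\<close>

lemma extension_is_twisted: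
  assumes X: "(E, i, p) \<in> extensions A M N"
  shows "\<exists>\<theta> \<omega>. datum M N \<theta> \<omega> \<and> cocycle M N \<theta> \<omega> \<and> ext_equiv A M N (tw_ext \<theta> \<omega>) (E, i, p)"
proof -
  note e = extD[OF X]
  note E = e(1) and vE = yd_vsub[OF e(1)]
  note i = yd_homD[OF e(2) N E] and p = yd_homD[OF e(3) E M]
  obtain s where s: "lin_on (space M) (scale M) (scale E) s" "\<And>m. m \<in> space M \<Longrightarrow> s m \<in> space E"
    "\<And>m. m \<in> space M \<Longrightarrow> p (s m) = m"
    using linear_section[OF E p(2) e(7)] by blast
  \<comment> \<open>The \<open>N\<close>-coordinate relative to \<open>s\<close>:
    \<open>x - s (p x)\<close> lies in the kernel of \<open>p\<close>, which is the image of
    \<open>i\<close>.\<close>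
  define \<nu> where "\<nu> x = inv_into (space N) i (x - s (p x))" for x
  have pd: "p (x - y) = p x - p y" if "x \<in> space E" "y \<in> space E" for x y
    using lin_on_diff[OF p(2) vE that] .
  have \<nu>: "\<nu> x \<in> space N" "i (\<nu> x) + s (p x) = x" if "x \<in> space E" for x
  proof -
    have *: "x - s (p x) \<in> space E" using that s p(1) by (auto intro: vsub_diff vE)
    have "p (x - s (p x)) = 0" using that s p(1) by (simp add: pd)
    hence "x - s (p x) \<in> i ` space N" using e(5)[OF *] by simp
    thus "\<nu> x \<in> space N" "i (\<nu> x) + s (p x) = x"
      unfolding \<nu>_def by (auto simp: inv_into_into f_inv_into_f)
  qed
  have iadd: "i (x + y) = i x + i y" if "x \<in> space N" "y \<in> space N" for x y
    using lin_on_add[OF i(2) that] .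
  have \<nu>_eq: "\<nu> x = n" if "x \<in> space E" "n \<in> space N" "i n + s (p x) = x" for x n
    using \<nu>[OF that(1)] that e(4) by (metis add_right_cancel inj_onD)
  have \<nu>_lin: "lin_on (space E) (scale E) (scale N) \<nu>"
    unfolding lin_on_def
  proof (intro conjI ballI allI)
    fix x y assume xy: "x \<in> space E" "y \<in> space E"
    have "i (\<nu> x + \<nu> y) + s (p (x + y)) = i (\<nu> x) + i (\<nu> y) + (s (p x) + s (p y))"
      using xy by (simp add: iadd \<nu> lin_on_add[OF p(2)] lin_on_add[OF s(1)] p(1))
    also have "\<dots> = x + y" using \<nu>(2)[OF xy(1)] \<nu>(2)[OF xy(2)] by (simp add: algebra_simps)
    finally show "\<nu> (x + y) = \<nu> x + \<nu> y"
      by (intro \<nu>_eq) (use xy in \<open>simp_all add: vsub_add vE vN \<nu>\<close>)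
  next
    fix c x assume x: "x \<in> space E"
    interpret Ev: vector_space "scale E" using vE by (simp add: vsub_def)
    have "i (scale N c (\<nu> x)) + s (p (scale E c x)) = scale E c (i (\<nu> x) + s (p x))"
      using x by (simp add: lin_on_scale[OF i(2)] \<nu> lin_on_scale[OF p(2)] lin_on_scale[OF s(1)] p(1)
          flip: Ev.scale_right_distrib)
    also have "\<dots> = scale E c x" using \<nu>(2)[OF x] by simp
    finally show "\<nu> (scale E c x) = scale N c (\<nu> x)"
      by (intro \<nu>_eq) (use x in \<open>simp_all add: vsub_scale vE vN \<nu>\<close>)
  qed
  have s0: "s 0 = 0" by (rule lin_on_0[OF s(1) vsub_0[OF vM]])
  have i0: "i 0 = 0" by (rule lin_on_0[OF i(2) vsub_0[OF vN]])
  have \<nu>i: "\<nu> (i n) = n" if "n \<in> space N" for n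
    by (rule \<nu>_eq) (simp_all add: that e(8,9) s0)
  have \<nu>s: "\<nu> (s m) = 0" if "m \<in> space M" for m
    by (rule \<nu>_eq) (use that in \<open>simp_all add: s vsub_0 vN i0\<close>)
  \<comment> \<open>\<open>\<theta>\<close> is the failure of \<open>s\<close> to be colinear,
    \<open>(\<nu> \<otimes> id) \<circ> \<rho> \<circ> s\<close>; in the same way
    \<open>\<omega>\<close> is its failure to be linear over \<open>A\<close>.\<close>
  define \<theta> where "\<theta> m = rho E (s m) (\<lambda>y u. pure (MA A N 1) (\<nu> y, [u]))" for m
  define \<omega> where "\<omega> a m = \<nu> (act E a (s m))" for a m
  have ev_\<theta>: "ev N (\<theta> m) G = rho E (s m) (\<lambda>y u. G (\<nu> y) u)" if "m \<in> space M" "bil N G"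
    for m and G :: "_ \<Rightarrow> _ \<Rightarrow> 'k"
    unfolding \<theta>_def
    by (rule ev_push) (use that in \<open>simp_all add: vN vE yd_coact_in E s \<nu>\<close>)
  have \<theta>_in: "\<theta> m \<in> tens N" if "m \<in> space M" for m
    unfolding \<theta>_def by (rule push_in) (use that in \<open>simp_all add: vN vE yd_coact_in E s \<nu>\<close>)
  have b\<nu>: "bil E (\<lambda>y u. G (\<nu> y) u)" if "bil N G" for G
    by (rule bil_comp[OF that \<nu>_lin \<nu>(1)])
  have d: "datum M N \<theta> \<omega>"
    unfolding datum_def
  proof (intro conjI allI ballI)
    show "lin_on (space M) (scale M) fscale \<theta>"
      unfolding lin_on_def
      by (intro conjI ballI allI; rule ev_eqI[OF vN])
        (simp_all add: \<theta>_in tspace_add tspace_scale vsub_add vsub_scale vM ev_add ev_scale vN ev_\<theta>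
          lin_on_add[OF s(1)] lin_on_scale[OF s(1)] s(2)
          lin_on_add[OF rho_lin[OF E b\<nu>]] lin_on_scale[OF rho_lin[OF E b\<nu>]])
    show "\<omega> a m \<in> space N" if "m \<in> space M" for a m
      unfolding \<omega>_def using that by (simp add: \<nu> yd_act_in E s)
    show "lin_on (space M) (scale M) (scale N) (\<omega> a)" for a
      unfolding \<omega>_def
      by (rule lin_on_comp[OF \<nu>_lin], rule lin_on_comp[OF yd_act_lin[OF E] s(1)])
        (simp_all add: yd_act_in E s)
    show "lin_on UNIV (bscale A) (scale N) (\<lambda>a. \<omega> a m)" if "m \<in> space M" for m
      unfolding \<omega>_def
      by (rule lin_on_comp[OF \<nu>_lin yd_act_lin_alg[OF E]]) (use that in \<open>simp_all add: yd_act_in E s\<close>)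
  qed (rule \<theta>_in)
  let ?T = "tw M N \<theta> \<omega>"
  let ?f = "\<lambda>x. (\<nu> x, p x)"
  have f_lin: "lin_on (space E) (scale E) (scale ?T) ?f"
    using \<nu>_lin p(2) by (auto simp: lin_on_def tw_simps)
  have f_in: "?f x \<in> space ?T" if "x \<in> space E" for x using that \<nu> p(1) by (simp add: tw_simps)
  have f_onto: "?f (i n + s m) = (n, m)" if "n \<in> space N" "m \<in> space M" for n m
    using that by (simp add: lin_on_add[OF \<nu>_lin] lin_on_add[OF p(2)] e(8,9) s \<nu>i \<nu>s)
  have f_surj: "?f ` space E = space ?T"
  proof
    show "space ?T \<subseteq> ?f ` space E"
    proof
      fix z assume "z \<in> space ?T"
      then obtain n m where z: "z = (n, m)" "n \<in> space N" "m \<in> space M" by (auto simp: tw_simps)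
      have "z = ?f (i n + s m)" "i n + s m \<in> space E"
        using f_onto[OF z(2,3)] z by (simp_all add: vsub_add vE e(8) s(2))
      thus "z \<in> ?f ` space E" by (rule image_eqI)
    qed
  qed (use f_in in auto)
  have T: "yd_module A ?T" and f: "yd_hom A E ?T ?f"
  proof -
    have a: "act ?T a (?f x) = ?f (act E a x)" if x: "x \<in> space E" for a x
    proof -
      have px: "p x \<in> space M" using p(1) x .
      have "act E a x = act E a (i (\<nu> x) + s (p x))" using \<nu>(2)[OF x] by simp
      also have "\<dots> = i (act N a (\<nu> x)) + act E a (s (p x))"
        using \<nu>(1)[OF x] px by (simp add: lin_on_add[OF yd_act_lin[OF E]] e(8) s(2) i(3))
      finally have "\<nu> (act E a x) = act N a (\<nu> x) + \<nu> (act E a (s (p x)))"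
        using \<nu>(1)[OF x] px by (simp add: lin_on_add[OF \<nu>_lin] e(8) s(2) yd_act_in E N \<nu>i)
      thus ?thesis using x by (simp add: tw_simps \<omega>_def p(3))
    qed
    have ct: "coact ?T (?f x) \<in> tens ?T" if "x \<in> space E" for x
      using tw_coact_in[OF d] that \<nu> p(1) by simp
    have r: "rho ?T (?f x) G = rho E x (\<lambda>y u. G (?f y) u)" if x: "x \<in> space E" and G: "bil ?T G"
      for x and G :: "_ \<Rightarrow> _ \<Rightarrow> 'k"
    proof -
      have px: "p x \<in> space M" using p(1) x .
      note b = tw_bil[OF G]
      have bE: "bil E (\<lambda>y u. G (?f y) u)" by (rule bil_comp[OF G f_lin f_in])
      have bp: "bil E (\<lambda>y u. G (0, p y) u)" using p(5)[OF b(2)] .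
      \<comment> \<open>Split \<open>x\<close> along the section: \<open>i (\<nu> x)\<close>
        contributes the coaction of \<open>N\<close>, and \<open>s (p x)\<close> contributes
        \<open>\<theta>\<close> together with the coaction of \<open>M\<close>.\<close>
      have "rho E x (\<lambda>y u. G (?f y) u) =
        rho E (i (\<nu> x)) (\<lambda>y u. G (?f y) u) + rho E (s (p x)) (\<lambda>y u. G (?f y) u)"
        using lin_on_add[OF rho_lin[OF E bE], of "i (\<nu> x)" "s (p x)"] \<nu>[OF x] px e(8) s(2) by simp
      also have "rho E (i (\<nu> x)) (\<lambda>y u. G (?f y) u) = rho N (\<nu> x) (\<lambda>y u. G (?f (i y)) u)"
        by (rule i(4)[OF \<nu>(1)[OF x] bE])
      also have "\<dots> = rho N (\<nu> x) (\<lambda>y u. G (y, 0) u)"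
        by (rule ev_cong) (use \<nu>(1)[OF x] in \<open>simp_all add: vN yd_coact_in N \<nu>i e(9)\<close>)
      also have "rho E (s (p x)) (\<lambda>y u. G (?f y) u) =
        rho E (s (p x)) (\<lambda>y u. G (\<nu> y, 0) u + G (0, p y) u)"
        by (rule ev_cong) (simp_all add: vE yd_coact_in E s(2) px b(3) \<nu>(1) p(1))
      also have "\<dots> = ev N (\<theta> (p x)) (\<lambda>y u. G (y, 0) u) + rho M (p x) (\<lambda>y u. G (0, y) u)"
        unfolding ev_plus by (simp add: ev_\<theta> px b p(4)[OF s(2)[OF px] b(2), symmetric] s(3))
      finally show ?thesis
        unfolding tw_rho[OF d \<nu>(1)[OF x] px G] by simp
    qed
    show "yd_module A ?T" "yd_hom A E ?T ?f"
      using yd_image[OF E tw_vs f_lin f_surj a ct r] by blast+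
  qed
  have "inj_on ?f (space E)"
    by (rule inj_onI) (metis \<nu>(2) prod.inject)
  hence "ext_equiv A M N (E, i, p) (tw_ext \<theta> \<omega>)"
    unfolding ext_equiv_def tw_ext_def split
    by (intro exI[of _ ?f] conjI f) (auto simp: bij_betw_def f_surj[simplified] \<nu>i e(9))
  moreover have c: "cocycle M N \<theta> \<omega>" using tw_yd_module_iff[OF d] T by simp
  ultimately show ?thesis
    using ext_equiv_sym[OF X tw_extension[OF d c]] d c by blast
qed

text \<open>The condition that \<open>(x, y) \<mapsto> (x + \<phi> y, y)\<close> is a morphism \<open>tw M N \<theta> \<omega> \<rightarrow> tw M N \<theta>' \<omega>'\<close>.\<close>

definition cobound :: "('m \<Rightarrow> ('n \<times> 'a list, 'k) tensor) \<Rightarrow> ('a \<Rightarrow> 'm \<Rightarrow> 'n)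
    \<Rightarrow> ('m \<Rightarrow> ('n \<times> 'a list, 'k) tensor) \<Rightarrow> ('a \<Rightarrow> 'm \<Rightarrow> 'n) \<Rightarrow> ('m \<Rightarrow> 'n) \<Rightarrow> bool" where
  "cobound \<theta> \<omega> \<theta>' \<omega>' \<phi> \<longleftrightarrow> (\<forall>m\<in>space M. \<phi> m \<in> space N) \<and> lin_on (space M) (scale M) (scale N) \<phi> \<and>
     (\<forall>a. \<forall>m\<in>space M. \<omega> a m + \<phi> (act M a m) = act N a (\<phi> m) + \<omega>' a m) \<and>
     (\<forall>m\<in>space M. \<forall>G::'n \<Rightarrow> 'a \<Rightarrow> 'k. bil N G \<longrightarrow>
        ev N (\<theta> m) G + rho M m (\<lambda>x u. G (\<phi> x) u) = rho N (\<phi> m) G + ev N (\<theta>' m) G)"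

text \<open>The shear is a linear bijection and the equations in \<open>cobound\<close> say that it
  respects action and coaction. Transport therefore gives the target its module structure, and with
  it the cocycle identities for the second pair.\<close>

lemma shear:
  assumes d: "datum M N \<theta> \<omega>" and c: "cocycle M N \<theta> \<omega>" and d': "datum M N \<theta>' \<omega>'"
    and cb: "cobound \<theta> \<omega> \<theta>' \<omega>' \<phi>"
  shows "cocycle M N \<theta>' \<omega>'" "ext_equiv A M N (tw_ext \<theta> \<omega>) (tw_ext \<theta>' \<omega>')"
proof -
  let ?T = "tw M N \<theta> \<omega>" and ?T' = "tw M N \<theta>' \<omega>'"
  let ?f = "\<lambda>z. (fst z + \<phi> (snd z), snd z)"
  have T: "yd_module A ?T" using tw_yd_module_iff[OF d] c by simp
  have \<phi>: "\<And>m. m \<in> space M \<Longrightarrow> \<phi> m \<in> space N" "lin_on (space M) (scale M) (scale N) \<phi>"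
    "\<And>a m. m \<in> space M \<Longrightarrow> \<omega> a m + \<phi> (act M a m) = act N a (\<phi> m) + \<omega>' a m"
    "\<And>m G::'n \<Rightarrow> 'a \<Rightarrow> 'k. m \<in> space M \<Longrightarrow> bil N G \<Longrightarrow>
        ev N (\<theta> m) G + rho M m (\<lambda>x u. G (\<phi> x) u) = rho N (\<phi> m) G + ev N (\<theta>' m) G"
    using cb unfolding cobound_def by blast+
  interpret Nv: vector_space "scale N" using vN by (simp add: vsub_def)
  have \<phi>0: "\<phi> 0 = 0" by (rule lin_on_0[OF \<phi>(2) vsub_0[OF vM]])
  have f_lin: "lin_on (space ?T) (scale ?T) (scale ?T') ?f"
    using \<phi>(2) by (auto simp: lin_on_def tw_simps Nv.scale_right_distrib)
  have f_in: "?f z \<in> space ?T'" if "z \<in> space ?T" for z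
    using that by (auto simp: tw_simps vsub_add vN \<phi>(1))
  have f_surj: "?f ` space ?T = space ?T'"
  proof
    show "space ?T' \<subseteq> ?f ` space ?T"
    proof
      fix z assume z: "z \<in> space ?T'"
      show "z \<in> ?f ` space ?T"
        by (rule image_eqI[of _ _ "(fst z - \<phi> (snd z), snd z)"])
          (use z in \<open>auto simp: tw_simps vsub_diff vN \<phi>(1)\<close>)
    qed
  qed (use f_in in auto)
  have a: "act ?T' a (?f z) = ?f (act ?T a z)" if z: "z \<in> space ?T" for a z
    using z \<phi>(3)[of "snd z" a] \<phi>(1)
    by (auto simp: tw_simps lin_on_add[OF yd_act_lin[OF N]] add.assoc)
  have ct: "coact ?T' (?f z) \<in> tens ?T'" if "z \<in> space ?T" for z
    using tw_coact_in[OF d'] f_in[OF that] by (auto simp: tw_simps)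
  have r: "rho ?T' (?f z) G = rho ?T z (\<lambda>y u. G (?f y) u)" if z: "z \<in> space ?T" and G: "bil ?T' G"
    for z and G :: "_ \<Rightarrow> _ \<Rightarrow> 'k"
  proof -
    obtain n m where nm: "z = (n, m)" "n \<in> space N" "m \<in> space M" using z by (auto simp: tw_simps)
    note b = tw_bil[OF G]
    have bf: "bil ?T (\<lambda>y u. G (?f y) u)" by (rule bil_comp[OF G f_lin f_in])
    have "rho M m (\<lambda>x u. G (\<phi> x, x) u) = rho M m (\<lambda>x u. G (\<phi> x, 0) u + G (0, x) u)"
      by (rule ev_cong) (simp_all add: vM yd_coact_in M nm b(3) \<phi>(1))
    moreover have "rho ?T' (n + \<phi> m, m) G = rho N n (\<lambda>y u. G (y, 0) u) + rho N (\<phi> m) (\<lambda>y u. G (y, 0) u) +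
      ev N (\<theta>' m) (\<lambda>y u. G (y, 0) u) + rho M m (\<lambda>y u. G (0, y) u)"
      by (subst tw_rho[OF d' _ _ G])
        (simp_all add: nm vsub_add vN \<phi>(1) lin_on_add[OF rho_lin[OF N b(1)]])
    ultimately show ?thesis
      unfolding nm(1) tw_rho[OF d nm(2,3) bf] using \<phi>(4)[OF nm(3) b(1)]
      by (simp add: \<phi>0 ev_plus algebra_simps)
  qed
  have T': "yd_module A ?T'" and f: "yd_hom A ?T ?T' ?f"
    using yd_image[OF T tw_vs f_lin f_surj a ct r] by blast+
  show "cocycle M N \<theta>' \<omega>'" using tw_yd_module_iff[OF d'] T' by simp
  have "inj_on ?f (space ?T)" by (auto simp: inj_on_def)
  thus "ext_equiv A M N (tw_ext \<theta> \<omega>) (tw_ext \<theta>' \<omega>')"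
    unfolding ext_equiv_def tw_ext_def split
    by (intro exI[of _ ?f] conjI f) (auto simp: bij_betw_def f_surj[simplified] \<phi>0)
qed

text \<open>An equivalence fixes \<open>N\<close> and induces the identity on \<open>M\<close>, so
  by additivity it has the form \<open>(n, m) \<mapsto> (n + \<phi> m, m)\<close>.\<close>

lemma tw_ext_equiv_iff:
  assumes d: "datum M N \<theta> \<omega>" and c: "cocycle M N \<theta> \<omega>"
    and d': "datum M N \<theta>' \<omega>'" and c': "cocycle M N \<theta>' \<omega>'"
  shows "ext_equiv A M N (tw_ext \<theta> \<omega>) (tw_ext \<theta>' \<omega>') \<longleftrightarrow> (\<exists>\<phi>. cobound \<theta> \<omega> \<theta>' \<omega>' \<phi>)"
proof
  assume "\<exists>\<phi>. cobound \<theta> \<omega> \<theta>' \<omega>' \<phi>"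
  thus "ext_equiv A M N (tw_ext \<theta> \<omega>) (tw_ext \<theta>' \<omega>')" using shear(2)[OF d c d'] by blast
next
  let ?T = "tw M N \<theta> \<omega>" and ?T' = "tw M N \<theta>' \<omega>'"
  have T: "yd_module A ?T" "yd_module A ?T'" using tw_yd_module_iff[OF d] tw_yd_module_iff[OF d'] c c' by auto
  assume "ext_equiv A M N (tw_ext \<theta> \<omega>) (tw_ext \<theta>' \<omega>')"
  then obtain f where f: "yd_hom A ?T ?T' f" "\<And>n. n \<in> space N \<Longrightarrow> f (n, 0) = (n, 0)"
    "\<And>z. z \<in> space ?T \<Longrightarrow> snd (f z) = snd z"
    unfolding ext_equiv_def tw_ext_def by auto
  note fD = yd_homD[OF f(1) T]
  define \<phi> where "\<phi> m = fst (f (0, m))" for m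
  have f0: "f (0, m) = (\<phi> m, m)" if "m \<in> space M" for m
    using f(3)[of "(0, m)"] that by (simp add: \<phi>_def tw_simps vsub_0 vN prod_eq_iff)
  have f1: "f (n, m) = (n + \<phi> m, m)" if "n \<in> space N" "m \<in> space M" for n m
    using lin_on_add[OF fD(2), of "(n, 0)" "(0, m)"] that
    by (simp add: tw_simps vsub_0 vN vM f0 f(2))
  have in0: "(0, m) \<in> space ?T" if "m \<in> space M" for m using that by (simp add: tw_simps vsub_0 vN)
  have "cobound \<theta> \<omega> \<theta>' \<omega>' \<phi>"
    unfolding cobound_def
  proof (intro conjI ballI allI impI)
    fix m assume m: "m \<in> space M"
    show \<phi>m: "\<phi> m \<in> space N" using fD(1)[OF in0[OF m]] by (simp add: f0 m tw_simps)
    have \<phi>in: "\<phi> x \<in> space N" if "x \<in> space M" for x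
      using fD(1)[OF in0[OF that]] by (simp add: f0 that tw_simps)
    show "\<omega> a m + \<phi> (act M a m) = act N a (\<phi> m) + \<omega>' a m" for a
      using fD(3)[OF in0[OF m], of a] m
      by (simp add: tw_simps f0 f1 act_0 datumD[OF d] yd_act_in M)
    fix G :: "'n \<Rightarrow> 'a \<Rightarrow> 'k" assume G: "bil N G"
    have b: "bil ?T' (\<lambda>y u. G (fst y) u)"
      by (rule bil_comp[OF G]) (auto simp: tw_simps lin_on_def)
    \<comment> \<open>When only the first component is tested, the \<open>M\<close>-term of the
      twisted coaction drops out; what remains is the equation required by
      \<open>cobound\<close>.\<close>
    have "G 0 = (\<lambda>_. 0)" by (rule ext) (rule lin_on_0[OF bilD2[OF G] vsub_0[OF vN]])
    hence 1: "rho ?T' (f (0, m)) (\<lambda>y u. G (fst y) u) = rho N (\<phi> m) G + ev N (\<theta>' m) G"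
      unfolding f0[OF m] tw_rho[OF d' \<phi>m m b] by (simp add: ev_zero_fun)
    have 2: "rho ?T (0, m) (\<lambda>y u. G (fst (f y)) u) =
      rho N 0 (\<lambda>y u. G (fst (f (y, 0))) u) + ev N (\<theta> m) (\<lambda>y u. G (fst (f (y, 0))) u) +
      rho M m (\<lambda>x u. G (fst (f (0, x))) u)"
      by (rule tw_rho[OF d vsub_0[OF vN] m fD(5)[OF b]])
    have 3: "rho N 0 (\<lambda>y u. G (fst (f (y, 0))) u) = rho N 0 G"
      by (rule ev_cong) (simp_all add: vN vsub_0 yd_coact_in N f(2))
    have 4: "ev N (\<theta> m) (\<lambda>y u. G (fst (f (y, 0))) u) = ev N (\<theta> m) G"
      by (rule ev_cong) (simp_all add: vN datumD[OF d] m f(2))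
    have 5: "rho M m (\<lambda>x u. G (fst (f (0, x))) u) = rho M m (\<lambda>x u. G (\<phi> x) u)"
      by (rule ev_cong) (simp_all add: vM yd_coact_in M m f0)
    show "ev N (\<theta> m) G + rho M m (\<lambda>x u. G (\<phi> x) u) = rho N (\<phi> m) G + ev N (\<theta>' m) G"
      using fD(4)[OF in0[OF m] b] unfolding 1 2 3 4 5 by (simp add: rho_0 G)
  next
    show "lin_on (space M) (scale M) (scale N) \<phi>"
      unfolding lin_on_def
    proof (intro conjI ballI allI)
      fix x y assume xy: "x \<in> space M" "y \<in> space M"
      show "\<phi> (x + y) = \<phi> x + \<phi> y"
        using lin_on_add[OF fD(2) in0[OF xy(1)] in0[OF xy(2)]] xy by (simp add: f0 vsub_add vM)
      show "\<phi> (scale M c x) = scale N c (\<phi> x)" for c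
        using lin_on_scale[OF fD(2) in0[OF xy(1)], of c] xy by (simp add: f0 vsub_scale vM tw_simps scale_0)
    qed
  qed
  thus "\<exists>\<phi>. cobound \<theta> \<omega> \<theta>' \<omega>' \<phi>" by blast
qed

text \<open>The structure is carried over along the given embedding \<open>j\<close>. This is where
  the universe assumption enters: it gives every cocycle an extension on \<open>'e\<close>.\<close>

lemma extension_in_universe:
  fixes scale_e :: "'k \<Rightarrow> 'e::ab_group_add \<Rightarrow> 'e"
  assumes j: "Vector_Spaces.linear (scale (yd_sum A N M)) scale_e j" "inj_on j (space (yd_sum A N M))"
    and d: "datum M N \<theta> \<omega>" and c: "cocycle M N \<theta> \<omega>"
  shows "\<exists>X\<in>extensions A M N. ext_equiv A M N (tw_ext \<theta> \<omega>) (X :: ('e, 'm, 'n, 'a, 'k) ext)"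
proof -
  let ?T = "tw M N \<theta> \<omega>"
  have T: "yd_module A ?T" using tw_yd_module_iff[OF d] c by simp
  have vT: "vsub ?T" by (rule tw_vs)
  have jl: "lin_on UNIV (scale ?T) scale_e j" and vs: "vector_space scale_e"
    using j(1) by (auto simp: linear_iff_lin_on tw_zero[symmetric] tw_scale)
  have inj: "inj_on j (space ?T)" using j(2) by (simp add: tw_zero[symmetric] tw_simps)
  define g where "g = inv_into (space ?T) j"
  have g: "g (j x) = x" if "x \<in> space ?T" for x
    unfolding g_def by (rule inv_into_f_f[OF inj that])
  \<comment> \<open>Two stages as for \<open>tw\<close>: tensors over \<open>F\<close> depend only
    on its space and scaling.\<close>
  define F0 :: "('e, 'a, 'k) yd" where "F0 = \<lparr>space = j ` space ?T, scale = scale_e,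
      act = (\<lambda>a e. j (act ?T a (g e))), coact = (\<lambda>_. 0)\<rparr>"
  define F where "F = F0\<lparr>coact := \<lambda>e. rho ?T (g e) (\<lambda>y u. pure (MA A F0 1) (j y, [u]))\<rparr>"
  have "MA A F0 1 = MA A F 1" by (simp add: MA_def F_def)
  hence F: "space F = j ` space ?T" "scale F = scale_e" "\<And>a e. act F a e = j (act ?T a (g e))"
    "\<And>e. coact F e = rho ?T (g e) (\<lambda>y u. pure (MA A F 1) (j y, [u]))"
    by (simp_all add: F_def F0_def)
  have vF: "vsub F"
    unfolding vsub_def module.subspace_def[OF vs[folded module_iff_vector_space]] F
  proof (intro conjI ballI allI vs)
    show "0 \<in> j ` space ?T"
      using lin_on_0[OF jl] vsub_0[OF vT] by (metis UNIV_I image_eqI)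
    show "x + y \<in> j ` space ?T" if "x \<in> j ` space ?T" "y \<in> j ` space ?T" for x y
      using that lin_on_add[OF jl] vsub_add[OF vT] by (auto simp flip: lin_on_add[OF jl])
    show "scale_e c x \<in> j ` space ?T" if "x \<in> j ` space ?T" for c x
      using that vsub_scale[OF vT] by (auto simp flip: lin_on_scale[OF jl])
  qed
  have jl': "lin_on (space ?T) (scale ?T) (scale F) j" using jl unfolding lin_on_def F by blast
  have ct: "coact F (j x) \<in> tens F" if "x \<in> space ?T" for x
    unfolding F(4) g[OF that] by (rule push_in) (use that in \<open>simp_all add: vT yd_coact_in T F\<close>)
  have r: "rho F (j x) G = rho ?T x (\<lambda>y u. G (j y) u)" if "x \<in> space ?T" "bil F G"
    for x and G :: "_ \<Rightarrow> _ \<Rightarrow> 'k"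
    unfolding F(4) g[OF that(1)]
    by (rule ev_push) (use that in \<open>simp_all add: vT vF yd_coact_in T F\<close>)
  have yF: "yd_module A F" and jh: "yd_hom A ?T F j"
    using yd_image[OF T vF jl' F(1)[symmetric] _ ct r] by (simp_all add: F(3) g)
  have bij: "bij_betw j (space ?T) (space F)" using inj by (simp add: bij_betw_def F)
  have gh: "yd_hom A F ?T g" unfolding g_def by (rule yd_hom_inverse[OF jh bij T yF])
  note ex = extD[OF tw_extension[OF d c, unfolded tw_ext_def]]
  have "(F, \<lambda>n. j (n, 0), \<lambda>e. snd (g e)) \<in> extensions A M N"
    unfolding extensions_def
  proof (clarsimp, intro conjI)
    show "yd_module A F" by fact
    show "yd_hom A N F (\<lambda>n. j (n, 0))" by (rule yd_hom_comp[OF ex(2) jh N T yF])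
    show "yd_hom A F M (\<lambda>e. snd (g e))" by (rule yd_hom_comp[OF gh ex(3) yF T M])
    show "inj_on (\<lambda>n. j (n, 0)) (space N)"
      by (rule inj_onI, drule inj_onD[OF inj]) (auto simp: tw_simps vsub_0 vM)
    show "(\<lambda>n. j (n, 0)) ` space N = {e \<in> space F. snd (g e) = 0}"
      using vsub_0[OF vM] by (auto simp: F g tw_simps image_iff)
    show "(\<lambda>e. snd (g e)) ` space F = space M"
      using vsub_0[OF vN] by (force simp: F g tw_simps image_iff)
  qed
  moreover have "ext_equiv A M N (tw_ext \<theta> \<omega>) (F, \<lambda>n. j (n, 0), \<lambda>e. snd (g e))"
    unfolding ext_equiv_def tw_ext_def using jh bij g by auto
  ultimately show ?thesis by blast
qed

end

context sweedler
begin

section \<open>Baer sums\<close>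

text \<open>The record \<open>P\<close> of \<open>is_baer_sum\<close>. Its coaction is taken over
  unchanged from the direct sum, so that it takes values in tensors over the pullback has to be
  proved separately.\<close>

definition pullback :: "('d::ab_group_add, 'a, 'k) yd \<Rightarrow> ('e::ab_group_add, 'a, 'k) yd
    \<Rightarrow> ('d \<Rightarrow> 'm) \<Rightarrow> ('e \<Rightarrow> 'm) \<Rightarrow> ('d \<times> 'e, 'a, 'k) yd" where
  "pullback D E p q = (yd_sum A D E)\<lparr>space := {(x, y). x \<in> space D \<and> y \<in> space E \<and> p x = q y}\<rparr>"

lemma pullback_simps:
  "space (pullback D E p q) = {(x, y). x \<in> space D \<and> y \<in> space E \<and> p x = q y}"
  "scale (pullback D E p q) c (x, y) = (scale D c x, scale E c y)"
  "act (pullback D E p q) a (x, y) = (act D a x, act E a y)"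
  by (simp_all add: pullback_def yd_sum_def Let_def)

lemma pullback_scale: "scale (pullback D E p q) = (\<lambda>c (x, y). (scale D c x, scale E c y))"
  by (simp add: pullback_def yd_sum_def Let_def)

text \<open>\<open>pure\<close> looks at \<open>MA\<close> only through its forms, and these depend
  on the scaling but not on the space; shrinking the space leaves the pure tensors
  unchanged.\<close>

lemma pullback_coact:
  "coact (pullback D E p q) (x, y) =
     tsum (MA A D 1) (\<lambda>(x\<^sub>0, u). pure (MA A (pullback D E p q) 1) ((x\<^sub>0, 0), u)) (coact D x) +
     tsum (MA A E 1) (\<lambda>(y\<^sub>0, u). pure (MA A (pullback D E p q) 1) ((0, y\<^sub>0), u)) (coact E y)"
proof -
  have "pure (MA A (pullback D E p q) 1) = pure (MA A \<lparr>space = space D \<times> space E,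
               scale = (\<lambda>c (x, y). (scale D c x, scale E c y)),
               act = (\<lambda>a (x, y). (act D a x, act E a y)),
               coact = (\<lambda>_. 0)\<rparr> 1)"
    by (simp add: fun_eq_iff pure_def MA_def pullback_scale)
  thus ?thesis by (simp add: pullback_def yd_sum_def Let_def)
qed

lemma pullback_vsub:
  assumes "vsub D" "vsub E" "vsub V" "lin_on (space D) (scale D) (scale V) p" "lin_on (space E) (scale E) (scale V) q"
  shows "vsub (pullback D E p q)"
proof -
  have m: "vector_space (scale D)" "vector_space (scale E)" using assms by (auto simp: vsub_def)
  have v: "vector_space (scale (pullback D E p q))"
    using m unfolding vector_space_def by (auto simp: pullback_scale)
  show ?thesis
    unfolding vsub_def module.subspace_def[OF v[folded module_iff_vector_space]]
    using v assms lin_on_0[OF assms(4)] lin_on_0[OF assms(5)]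
    by (auto simp: pullback_simps vsub_0 vsub_add vsub_scale zero_prod_def
        lin_on_add[OF assms(4)] lin_on_add[OF assms(5)] lin_on_scale[OF assms(4)] lin_on_scale[OF assms(5)])
qed

text \<open>Evaluates the coaction merely as a function on forms, before it is known to be a tensor
  over the pullback. Forms are linear on the whole product type, so they can be split into
  coordinates even at points off the pullback.\<close>

lemma pullback_coact_form:
  assumes D: "yd_module A D" "x \<in> space D" and E: "yd_module A E" "y \<in> space E"
    and \<beta>: "\<beta> \<in> forms (MA A (pullback D E p q) 1)"
  shows "coact (pullback D E p q) (x, y) \<beta> =
    rho D x (\<lambda>z u. \<beta> ((z, 0), [u])) + rho E y (\<lambda>z u. \<beta> ((0, z), [u]))"
    "bil D (\<lambda>z u. \<beta> ((z, 0), [u]))" "bil E (\<lambda>z u. \<beta> ((0, z), [u]))"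
    "\<beta> ((z, 0), [u]) + \<beta> ((0, w), [u]) = \<beta> ((z, w), [u])"
proof -
  interpret Dv: vector_space "scale D" using yd_vsub[OF D(1)] by (simp add: vsub_def)
  interpret Ev: vector_space "scale E" using yd_vsub[OF E(1)] by (simp add: vsub_def)
  show "coact (pullback D E p q) (x, y) \<beta> =
    rho D x (\<lambda>z u. \<beta> ((z, 0), [u])) + rho E y (\<lambda>z u. \<beta> ((0, z), [u]))"
    unfolding pullback_coact
    by (simp add: tsum_apply tsum_MA_ev yd_vsub yd_coact_in D E)
      (simp add: ev_def tsum_apply pure_def \<beta>)
  have 1: "lin_on UNIV (scale (pullback D E p q)) (*) (\<lambda>z. \<beta> (z, [u]))" for u
    using \<beta> by (auto simp: MA_def linear_iff_lin_on)
  have 2: "lin_on UNIV (bscale A) (*) (\<lambda>u. \<beta> (z, [u]))" for z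
  proof -
    have "length as = 1 \<Longrightarrow> i < 1 \<Longrightarrow> lin_on UNIV (bscale A) (*) (\<lambda>x. \<beta> (z, as[i := x]))" for as i
      using \<beta> unfolding MA_def linear_iff_lin_on by (cases z) auto
    from this[of "[0]" 0] show ?thesis by simp
  qed
  have 3: "lin_on (space D) (scale D) (*) (\<lambda>z. \<beta> ((z, 0), [u]))" for u
    by (rule lin_on_UNIV_comp[OF 1]) (auto simp: lin_on_def pullback_simps)
  have 4: "lin_on (space E) (scale E) (*) (\<lambda>z. \<beta> ((0, z), [u]))" for u
    by (rule lin_on_UNIV_comp[OF 1]) (auto simp: lin_on_def pullback_simps)
  show "bil D (\<lambda>z u. \<beta> ((z, 0), [u]))" "bil E (\<lambda>z u. \<beta> ((0, z), [u]))"
    unfolding bil_def using 2 3 4 by blast+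
  show "\<beta> ((z, 0), [u]) + \<beta> ((0, w), [u]) = \<beta> ((z, w), [u])"
    using lin_on_add[OF 1, of "(z, 0)" "(0, w)" u] by simp
qed

lemma pullback_coact_off_forms:
  "\<beta> \<notin> forms (MA A (pullback D E p q) 1) \<Longrightarrow> coact (pullback D E p q) (x, y) \<beta> = 0"
  unfolding pullback_coact by (simp add: tsum_apply case_prod_unfold pure_def tsum_zero)

end

section \<open>Linear combinations of cocycles\<close>

context yd_pair
begin

lemma datum_lincomb:
  assumes d: "datum M N \<theta> \<omega>" and d': "datum M N \<theta>' \<omega>'"
  shows "datum M N (\<lambda>m. \<theta> m + fscale r (\<theta>' m)) (\<lambda>a m. \<omega> a m + scale N r (\<omega>' a m))"
proof -
  interpret Nv: vector_space "scale N" using vN by (simp add: vsub_def)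
  interpret F: vector_space "fscale :: 'k \<Rightarrow> (('n \<times> 'a list \<Rightarrow> 'k) \<Rightarrow> 'k) \<Rightarrow> _" by (rule vector_space_fscale)
  show ?thesis
    using datumD[OF d] datumD[OF d'] unfolding datum_def lin_on_def
    by (simp add: tspace_add tspace_scale vsub_add vsub_scale vN Nv.scale_right_distrib
        F.scale_right_distrib mult.commute)
qed

text \<open>All three identities are linear in the pair. The coefficient \<open>r\<close> is used
  with the values 1 and -1, for sums and differences.\<close>

lemma cocycle_lincomb:
  assumes d: "datum M N \<theta> \<omega>" and c: "cocycle M N \<theta> \<omega>" and d': "datum M N \<theta>' \<omega>'" and c': "cocycle M N \<theta>' \<omega>'"
  shows "cocycle M N (\<lambda>m. \<theta> m + fscale r (\<theta>' m)) (\<lambda>a m. \<omega> a m + scale N r (\<omega>' a m))"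
proof -
  interpret Nv: vector_space "scale N" using vN by (simp add: vsub_def)
  note c = c[unfolded cocycle_def] and c' = c'[unfolded cocycle_def]
  have evl: "ev N (\<theta> m + fscale r (\<theta>' m)) G = ev N (\<theta> m) G + r * ev N (\<theta>' m) G"
    if "m \<in> space M" "bil N G" for m and G :: "_ \<Rightarrow> _ \<Rightarrow> 'k"
    using that by (simp add: ev_add ev_scale vN datumD[OF d] datumD[OF d'] tspace_scale)
  show ?thesis
    unfolding cocycle_def
  proof (intro conjI allI ballI impI)
    show "\<omega> (a * b) m + scale N r (\<omega>' (a * b) m) =
      act N a (\<omega> b m + scale N r (\<omega>' b m)) + (\<omega> a (act M b m) + scale N r (\<omega>' a (act M b m)))"
      if m: "m \<in> space M" for a b m
      using c c' m by (simp add: lin_on_add[OF yd_act_lin[OF N]] lin_on_scale[OF yd_act_lin[OF N]]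
          datumD[OF d] datumD[OF d'] vsub_scale vN Nv.scale_right_distrib algebra_simps)
  next
    fix m and G :: "'n \<Rightarrow> 'a \<Rightarrow> 'a \<Rightarrow> 'k" assume m: "m \<in> space M" and G: "tril N G"
    have 1: "bil N (\<lambda>y u. rho N y (\<lambda>z v. G z v u))"
      by (rule bil_rho_tril) (simp_all add: vN yd_coact_in N yd_coact_lin G)
    have "rho M m (\<lambda>x u. ev N (\<theta> x + fscale r (\<theta>' x)) (\<lambda>z v. G z v u)) =
      rho M m (\<lambda>x u. ev N (\<theta> x) (\<lambda>z v. G z v u) + r * ev N (\<theta>' x) (\<lambda>z v. G z v u))"
      by (rule ev_cong) (simp_all add: vM yd_coact_in M m evl tril_bil[OF G])
    also have "\<dots> = rho M m (\<lambda>x u. ev N (\<theta> x) (\<lambda>z v. G z v u)) + r * rho M m (\<lambda>x u. ev N (\<theta>' x) (\<lambda>z v. G z v u))"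
      by (simp add: ev_plus ev_mult)
    finally show "ev N (\<theta> m + fscale r (\<theta>' m)) (\<lambda>y u. rho N y (\<lambda>z v. G z v u)) +
      rho M m (\<lambda>x u. ev N (\<theta> x + fscale r (\<theta>' x)) (\<lambda>z v. G z v u)) =
      ev N (\<theta> m + fscale r (\<theta>' m)) (\<lambda>y u. sd u (G y))"
      using c[THEN conjunct2, THEN conjunct1, rule_format, OF m G, symmetric]
        c'[THEN conjunct2, THEN conjunct1, rule_format, OF m G, symmetric]
      by (simp add: evl m 1 bil_sd_tril vN G algebra_simps)
  next
    fix a m and G :: "'n \<Rightarrow> 'a \<Rightarrow> 'k" assume m: "m \<in> space M" and G: "bil N G"
    have 1: "rho N (\<omega> c m + scale N r (\<omega>' c m)) (\<lambda>y u. G y (u * b)) =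
      rho N (\<omega> c m) (\<lambda>y u. G y (u * b)) + r * rho N (\<omega>' c m) (\<lambda>y u. G y (u * b))" for b c
      by (simp add: lin_on_add[OF rho_lin[OF N bil_mult_right[OF G]]] lin_on_scale[OF rho_lin[OF N bil_mult_right[OF G]]]
          datumD[OF d] datumD[OF d'] m vsub_scale vN)
    have 2: "rho M m (\<lambda>x u. G (\<omega> b x + scale N r (\<omega>' b x)) (c * u)) =
      rho M m (\<lambda>x u. G (\<omega> b x) (c * u)) + r * rho M m (\<lambda>x u. G (\<omega>' b x) (c * u))" for b c
      unfolding ev_mult[symmetric] ev_plus[symmetric]
      by (rule ev_cong) (simp_all add: vM yd_coact_in M m lin_on_add[OF bilD2[OF G]] lin_on_scale[OF bilD2[OF G]]
          datumD[OF d] datumD[OF d'] vsub_scale vN)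
    have 3: "bil N (\<lambda>y u. G (act N b y) (c * u))" for b c
      by (rule bil_act[OF N bil_mult_left[OF G]])
    show "sd a (\<lambda>b c. ev N (\<theta> (act M c m) + fscale r (\<theta>' (act M c m))) (\<lambda>y u. G y (u * b))) +
        sd a (\<lambda>b c. rho N (\<omega> c m + scale N r (\<omega>' c m)) (\<lambda>y u. G y (u * b))) =
        sd a (\<lambda>b c. ev N (\<theta> m + fscale r (\<theta>' m)) (\<lambda>y u. G (act N b y) (c * u))) +
        sd a (\<lambda>b c. rho M m (\<lambda>x u. G (\<omega> b x + scale N r (\<omega>' b x)) (c * u)))"
      using c[THEN conjunct2, THEN conjunct2, rule_format, OF m G, of a]
        arg_cong[of _ _ "(*) r", OF c'[THEN conjunct2, THEN conjunct2, rule_format, OF m G, of a]]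
      by (simp add: evl m yd_act_in M bil_mult_right G 1 2 3 sd_plus sd_mult algebra_simps)
  qed
qed

lemma fscale_one: "fscale 1 t = t"
  by (simp add: fscale_def)

lemma scale_one: "scale N 1 x = x"
proof -
  interpret Nv: vector_space "scale N" using vN by (simp add: vsub_def)
  show ?thesis by simp
qed

lemmas datum_add = datum_lincomb[where r = 1, unfolded fscale_one scale_one]
lemmas cocycle_add = cocycle_lincomb[where r = 1, unfolded fscale_one scale_one]

section \<open>Baer sums in coordinates, with \<open>f\<close> and \<open>g\<close> trivialising the
  two extensions\<close>

context
  fixes E\<^sub>1 :: "('e::ab_group_add, 'a, 'k) yd" and i\<^sub>1 p\<^sub>1 and E\<^sub>2 :: "('e, 'a, 'k) yd" and i\<^sub>2 p\<^sub>2
    and \<theta> \<omega> \<theta>' \<omega>' f g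
  assumes X: "(E\<^sub>1, i\<^sub>1, p\<^sub>1) \<in> extensions A M N" and Y: "(E\<^sub>2, i\<^sub>2, p\<^sub>2) \<in> extensions A M N"
    and d: "datum M N \<theta> \<omega>" and c: "cocycle M N \<theta> \<omega>"
    and d': "datum M N \<theta>' \<omega>'" and c': "cocycle M N \<theta>' \<omega>'"
    and f: "yd_hom A (tw M N \<theta> \<omega>) E\<^sub>1 f" "bij_betw f (space N \<times> space M) (space E\<^sub>1)"
      "\<And>n. n \<in> space N \<Longrightarrow> f (n, 0) = i\<^sub>1 n"
      "\<And>n m. n \<in> space N \<Longrightarrow> m \<in> space M \<Longrightarrow> p\<^sub>1 (f (n, m)) = m"
    and g: "yd_hom A (tw M N \<theta>' \<omega>') E\<^sub>2 g" "bij_betw g (space N \<times> space M) (space E\<^sub>2)"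
      "\<And>n. n \<in> space N \<Longrightarrow> g (n, 0) = i\<^sub>2 n"
      "\<And>n m. n \<in> space N \<Longrightarrow> m \<in> space M \<Longrightarrow> p\<^sub>2 (g (n, m)) = m"
begin

lemma yd_tw: "yd_module A (tw M N \<theta> \<omega>)" "yd_module A (tw M N \<theta>' \<omega>')"
  using tw_yd_module_iff c c' d d' by auto

lemmas E1 = extD(1)[OF X]
lemmas E2 = extD(1)[OF Y]
lemmas fD = yd_homD[OF f(1) yd_tw(1) E1, unfolded tw_simps(1)]
lemmas gD = yd_homD[OF g(1) yd_tw(2) E2, unfolded tw_simps(1)]
lemmas zM = vsub_0[OF vM]
lemmas zN = vsub_0[OF vN]

abbreviation "PB \<equiv> pullback E\<^sub>1 E\<^sub>2 p\<^sub>1 p\<^sub>2"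

lemma P_vsub: "vsub PB"
  by (rule pullback_vsub[OF yd_vsub yd_vsub vM]) (use E1 E2 yd_homD(2)[OF extD(3)] X Y M in auto)

lemma fg_add:
  assumes "n \<in> space N" "m \<in> space M" "n' \<in> space N" "m' \<in> space M"
  shows "f (n + n', m + m') = f (n, m) + f (n', m')" "g (n + n', m + m') = g (n, m) + g (n', m')"
  using lin_on_add[OF fD(2), of "(n, m)" "(n', m')"] lin_on_add[OF gD(2), of "(n, m)" "(n', m')"] assms
  by simp_all

lemma fg_scale:
  assumes "n \<in> space N" "m \<in> space M"
  shows "f (scale N r n, scale M r m) = scale E\<^sub>1 r (f (n, m))" "g (scale N r n, scale M r m) = scale E\<^sub>2 r (g (n, m))"
  using lin_on_scale[OF fD(2), of "(n, m)" r] lin_on_scale[OF gD(2), of "(n, m)" r] assms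
  by (simp_all add: tw_simps)

lemma fg_0: "f (0, 0) = 0" "g (0, 0) = 0"
  using lin_on_0[OF fD(2)] lin_on_0[OF gD(2)] zM zN by (simp_all add: zero_prod_def)

text \<open>\<open>f\<close> and \<open>g\<close> are onto, and the fibre condition equates the two
  \<open>M\<close>-coordinates; in coordinates the pullback is
  \<open>N \<times> N \<times> M\<close>.\<close>

lemma P_cases:
  assumes "z \<in> space PB"
  obtains n n' m where "z = (f (n, m), g (n', m))" "n \<in> space N" "n' \<in> space N" "m \<in> space M"
proof -
  obtain x y where z: "z = (x, y)" "x \<in> space E\<^sub>1" "y \<in> space E\<^sub>2" "p\<^sub>1 x = p\<^sub>2 y"
    using assms by (auto simp: pullback_simps)
  have "x \<in> f ` (space N \<times> space M)" "y \<in> g ` (space N \<times> space M)"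
    using f(2) g(2) z(2,3) by (simp_all add: bij_betw_def)
  then obtain n m n' m' where nm: "x = f (n, m)" "n \<in> space N" "m \<in> space M"
    "y = g (n', m')" "n' \<in> space N" "m' \<in> space M"
    by auto
  hence "m' = m" using z(4) f(4) g(4) by simp
  thus ?thesis using that z(1) nm by blast
qed

lemma P_in: "n \<in> space N \<Longrightarrow> n' \<in> space N \<Longrightarrow> m \<in> space M \<Longrightarrow> (f (n, m), g (n', m)) \<in> space PB"
  using fD(1) gD(1) f(4) g(4) by (simp add: pullback_simps)

lemma P_in': "n \<in> space N \<Longrightarrow> (i\<^sub>1 n, 0) \<in> space PB" "n \<in> space N \<Longrightarrow> (0, i\<^sub>2 n) \<in> space PB"
  "m \<in> space M \<Longrightarrow> (f (0, m), g (0, m)) \<in> space PB"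
  using P_in[of n 0 0] P_in[of 0 n 0] P_in[of 0 0 m] by (simp_all add: zM zN f(3)[symmetric] g(3)[symmetric] fg_0)

text \<open>
  The summands of the defining formula for the coaction of the pullback lie outside \<open>PB \<otimes> A\<close>;
  merging the two copies of the coaction of \<open>M\<close> gives a decomposition inside it.
\<close>

lemma P_coact:
  assumes n: "n \<in> space N" "n' \<in> space N" and m: "m \<in> space M"
  shows "coact PB (f (n, m), g (n', m)) =
    ev N (coact N n + \<theta> m) (\<lambda>z u. pure (MA A PB 1) ((i\<^sub>1 z, 0), [u])) +
    ev N (coact N n' + \<theta>' m) (\<lambda>z u. pure (MA A PB 1) ((0, i\<^sub>2 z), [u])) +
    ev M (coact M m) (\<lambda>x u. pure (MA A PB 1) ((f (0, x), g (0, x)), [u]))" (is "?l = ?r")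
proof
  fix \<beta>
  show "?l \<beta> = ?r \<beta>"
  proof (cases "\<beta> \<in> forms (MA A PB 1)")
    case False
    thus ?thesis
      by (simp add: pullback_coact_off_forms ev_def tsum_apply pure_def tsum_zero)
  next
    case \<beta>: True
    have F: "f (n, m) \<in> space E\<^sub>1" "g (n', m) \<in> space E\<^sub>2" using fD(1) gD(1) n m by auto
    note pb = pullback_coact_form[OF E1 F(1) E2 F(2) \<beta>]
    have 1: "rho E\<^sub>1 (f (n, m)) (\<lambda>z u. \<beta> ((z, 0), [u])) =
      ev N (coact N n) (\<lambda>z u. \<beta> ((i\<^sub>1 z, 0), [u])) + ev N (\<theta> m) (\<lambda>z u. \<beta> ((i\<^sub>1 z, 0), [u])) +
      rho M m (\<lambda>x u. \<beta> ((f (0, x), 0), [u]))"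
    proof -
      have nm: "(n, m) \<in> space N \<times> space M" using n m by simp
      show ?thesis
        unfolding fD(4)[OF nm pb(2)] tw_rho[OF d n(1) m fD(5)[OF pb(2)]]
        by (intro arg_cong2[of _ _ _ _ "(+)"] ev_cong refl)
          (simp_all add: vN yd_coact_in N n datumD[OF d] m f(3))
    qed
    have 2: "rho E\<^sub>2 (g (n', m)) (\<lambda>z u. \<beta> ((0, z), [u])) =
      ev N (coact N n') (\<lambda>z u. \<beta> ((0, i\<^sub>2 z), [u])) + ev N (\<theta>' m) (\<lambda>z u. \<beta> ((0, i\<^sub>2 z), [u])) +
      rho M m (\<lambda>x u. \<beta> ((0, g (0, x)), [u]))"
    proof -
      have nm: "(n', m) \<in> space N \<times> space M" using n m by simp
      show ?thesis
        unfolding gD(4)[OF nm pb(3)] tw_rho[OF d' n(2) m gD(5)[OF pb(3)]]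
        by (intro arg_cong2[of _ _ _ _ "(+)"] ev_cong refl)
          (simp_all add: vN yd_coact_in N n datumD[OF d'] m g(3))
    qed
    have b1: "bil N (\<lambda>z u. \<beta> ((i\<^sub>1 z, 0), [u]))" by (rule yd_homD(5)[OF extD(2)[OF X] N E1 pb(2)])
    have b2: "bil N (\<lambda>z u. \<beta> ((0, i\<^sub>2 z), [u]))" by (rule yd_homD(5)[OF extD(2)[OF Y] N E2 pb(3)])
    have "?r \<beta> = ev N (coact N n + \<theta> m) (\<lambda>z u. \<beta> ((i\<^sub>1 z, 0), [u])) +
      ev N (coact N n' + \<theta>' m) (\<lambda>z u. \<beta> ((0, i\<^sub>2 z), [u])) +
      ev M (coact M m) (\<lambda>x u. \<beta> ((f (0, x), 0), [u]) + \<beta> ((0, g (0, x)), [u]))"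
      unfolding pb(4) by (simp add: ev_def tsum_apply pure_def \<beta>)
    also have "\<dots> = ?l \<beta>"
      unfolding pb(1) 1 2 ev_plus
      by (simp add: ev_add vN b1 b2 yd_coact_in N n m datumD[OF d] datumD[OF d'])
    finally show ?thesis by simp
  qed
qed

text \<open>The three summands in \<open>P_coact\<close> are pushed forward along maps into the
  pullback. This membership is the one fact about the coaction that \<open>yd_hom_iff\<close>
  demands of the source.\<close>

lemma P_coact_in: "z \<in> space PB \<Longrightarrow> coact PB z \<in> tens PB"
proof (erule P_cases)
  fix n n' m assume "z = (f (n, m), g (n', m))" and nm: "n \<in> space N" "n' \<in> space N" "m \<in> space M"
  thus "coact PB z \<in> tens PB"
    by (simp only: P_coact)
      (intro tspace_add push_in, simp_all add: vM vN yd_coact_in M N datumD[OF d] datumD[OF d'] tspace_add P_in' nm)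
qed

lemma P_rho:
  fixes G :: "_ \<Rightarrow> _ \<Rightarrow> 'k"
  assumes n: "n \<in> space N" "n' \<in> space N" and m: "m \<in> space M" and G: "bil PB G"
  shows "rho PB (f (n, m), g (n', m)) G =
    ev N (coact N n + \<theta> m) (\<lambda>z u. G (i\<^sub>1 z, 0) u) + ev N (coact N n' + \<theta>' m) (\<lambda>z u. G (0, i\<^sub>2 z) u) +
    rho M m (\<lambda>x u. G (f (0, x), g (0, x)) u)"
proof -
  have 1: "ev N (coact N n + \<theta> m) (\<lambda>z u. pure (MA A PB 1) ((i\<^sub>1 z, 0), [u])) \<in> tens PB"
    "ev N (coact N n' + \<theta>' m) (\<lambda>z u. pure (MA A PB 1) ((0, i\<^sub>2 z), [u])) \<in> tens PB"
    "rho M m (\<lambda>x u. pure (MA A PB 1) ((f (0, x), g (0, x)), [u])) \<in> tens PB"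
    by (intro push_in, simp_all add: vM vN yd_coact_in M N datumD[OF d] datumD[OF d'] tspace_add P_in' n m)+
  have *: "coact N n + \<theta> m \<in> tens N" "coact N n' + \<theta>' m \<in> tens N" "coact M m \<in> tens M"
    by (simp_all add: yd_coact_in M N datumD[OF d] datumD[OF d'] tspace_add n m)
  show ?thesis
    unfolding P_coact[OF n m]
    by (simp add: ev_add P_vsub G 1 tspace_add ev_push[OF P_vsub G vN *(1)] ev_push[OF P_vsub G vN *(2)]
        ev_push[OF P_vsub G vM *(3)] P_in')
qed

abbreviation "TS \<equiv> tw M N (\<lambda>m. \<theta> m + \<theta>' m) (\<lambda>a m. \<omega> a m + \<omega>' a m)"

lemmas dS = datum_add[OF d d']

lemma yd_S: "yd_module A TS"
  using tw_yd_module_iff[OF dS] cocycle_add[OF d c d' c'] by simp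

text \<open>In coordinates a Baer sum collapses \<open>(n, n', m)\<close> to
  \<open>(n + n', m)\<close>. If \<open>\<pi>\<close> and \<open>\<chi>\<close> correspond on both
  copies of \<open>N\<close> and on the diagonal lift of \<open>M\<close>, so do the coactions, the
  twists adding up. Both implications below rest on this, one starting from \<open>\<pi>\<close> and
  the other from \<open>\<chi>\<close>.\<close>

lemma P_rho_S:
  fixes G :: "_ \<Rightarrow> _ \<Rightarrow> 'k"
  assumes n: "n \<in> space N" "n' \<in> space N" and m: "m \<in> space M"
    and \<chi>: "bil PB (\<lambda>y u. G (\<pi> y) u)" "bil TS (\<lambda>y u. G (\<chi> y) u)"
      "\<And>n. n \<in> space N \<Longrightarrow> \<pi> (i\<^sub>1 n, 0) = \<chi> (n, 0)"
      "\<And>n. n \<in> space N \<Longrightarrow> \<pi> (0, i\<^sub>2 n) = \<chi> (n, 0)"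
      "\<And>m. m \<in> space M \<Longrightarrow> \<pi> (f (0, m), g (0, m)) = \<chi> (0, m)"
  shows "rho PB (f (n, m), g (n', m)) (\<lambda>y u. G (\<pi> y) u) = rho TS (n + n', m) (\<lambda>y u. G (\<chi> y) u)"
proof -
  note b = tw_bil[OF \<chi>(2)]
  have *: "coact N n + \<theta> m \<in> tens N" "coact N n' + \<theta>' m \<in> tens N" "coact M m \<in> tens M"
    by (simp_all add: yd_coact_in M N datumD[OF d] datumD[OF d'] tspace_add n m)
  have "ev N (coact N n + \<theta> m) (\<lambda>z u. G (\<pi> (i\<^sub>1 z, 0)) u) = ev N (coact N n + \<theta> m) (\<lambda>z u. G (\<chi> (z, 0)) u)"
    "ev N (coact N n' + \<theta>' m) (\<lambda>z u. G (\<pi> (0, i\<^sub>2 z)) u) = ev N (coact N n' + \<theta>' m) (\<lambda>z u. G (\<chi> (z, 0)) u)"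
    "rho M m (\<lambda>x u. G (\<pi> (f (0, x), g (0, x))) u) = rho M m (\<lambda>x u. G (\<chi> (0, x)) u)"
    by (rule ev_cong; simp add: vN vM * \<chi>)+
  thus ?thesis
    unfolding P_rho[OF n m \<chi>(1)] tw_rho[OF dS vsub_add[OF vN n] m \<chi>(2)]
    by (simp add: ev_add vN b(1) yd_coact_in N n m datumD[OF d] datumD[OF d']
        lin_on_add[OF rho_lin[OF N b(1)]])
qed

lemma is_baer_sum_pullback:
  "is_baer_sum A M N (E\<^sub>1, i\<^sub>1, p\<^sub>1) (E\<^sub>2, i\<^sub>2, p\<^sub>2) (E, i, p) \<longleftrightarrow>
    (\<exists>\<pi>. yd_hom A PB E \<pi> \<and> \<pi> ` space PB = space E \<and>
            {z \<in> space PB. \<pi> z = 0} = (\<lambda>n. (i\<^sub>1 n, - i\<^sub>2 n)) ` space N \<and>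
            (\<forall>n\<in>space N. i n = \<pi> (i\<^sub>1 n, 0)) \<and>
            (\<forall>(x, y)\<in>space PB. p (\<pi> (x, y)) = p\<^sub>1 x))"
  unfolding is_baer_sum_def by (simp only: split Let_def pullback_def)

text \<open>The quotient map kills every \<open>(i\<^sub>1 n, - i\<^sub>2 n)\<close>, so the second
  copy of \<open>N\<close> can be moved into the first and \<open>\<pi>\<close> depends on
  \<open>n + n'\<close> and \<open>m\<close> alone. Restricting it to the points with
  \<open>n' = 0\<close> gives the equivalence \<open>\<chi>\<close>.\<close>

lemma baer_sum_imp_equiv:
  assumes Z: "(E, i, p) \<in> extensions A M N"
    and baer: "is_baer_sum A M N (E\<^sub>1, i\<^sub>1, p\<^sub>1) (E\<^sub>2, i\<^sub>2, p\<^sub>2) (E, i, p)"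
  shows "ext_equiv A M N (tw_ext (\<lambda>m. \<theta> m + \<theta>' m) (\<lambda>a m. \<omega> a m + \<omega>' a m)) (E, i, p)"
proof -
  note Ez = extD(1)[OF Z]
  note vE = yd_vsub[OF Ez]
  obtain \<pi> where \<pi>: "yd_hom A PB E \<pi>" "\<pi> ` space PB = space E"
    and ker: "{z \<in> space PB. \<pi> z = 0} = (\<lambda>n. (i\<^sub>1 n, - i\<^sub>2 n)) ` space N"
    and \<pi>i: "\<And>n. n \<in> space N \<Longrightarrow> i n = \<pi> (i\<^sub>1 n, 0)"
    and \<pi>p': "\<forall>(x, y)\<in>space PB. p (\<pi> (x, y)) = p\<^sub>1 x"
    using baer unfolding is_baer_sum_pullback by blast
  have \<pi>p: "p (\<pi> (x, y)) = p\<^sub>1 x" if "(x, y) \<in> space PB" for x y using \<pi>p' that by blast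
  have \<pi>D: "\<And>z. z \<in> space PB \<Longrightarrow> \<pi> z \<in> space E" "lin_on (space PB) (scale PB) (scale E) \<pi>"
    "\<And>a z. z \<in> space PB \<Longrightarrow> \<pi> (act PB a z) = act E a (\<pi> z)"
    "\<And>z G::_ \<Rightarrow> _ \<Rightarrow> 'k. z \<in> space PB \<Longrightarrow> bil E G \<Longrightarrow> rho E (\<pi> z) G = rho PB z (\<lambda>y u. G (\<pi> y) u)"
    using \<pi>(1) yd_hom_iff[OF P_vsub P_coact_in vE yd_coact_in[OF Ez]] by blast+
  have add: "\<pi> (x, y) + \<pi> (x', y') = \<pi> (x + x', y + y')" if "(x, y) \<in> space PB" "(x', y') \<in> space PB" for x y x' y'
    using lin_on_add[OF \<pi>D(2) that] by simp
  define \<chi> where "\<chi> z = \<pi> (f z, g (0, snd z))" for z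
  have inP: "(f (n, m), g (n', m)) \<in> space PB" if "n \<in> space N" "n' \<in> space N" "m \<in> space M" for n n' m
    using P_in that .
  have anti: "\<pi> (i\<^sub>1 n, - i\<^sub>2 n) = 0" "(i\<^sub>1 n, - i\<^sub>2 n) \<in> space PB" if "n \<in> space N" for n
    using ker that by blast+
  have \<pi>i2: "\<pi> (0, i\<^sub>2 n) = i n" if "n \<in> space N" for n
    using add[OF anti(2)[OF that] P_in'(2)[OF that]] anti(1)[OF that] \<pi>i[OF that] by simp
  have \<pi>_split: "\<pi> (f (n, m), g (n', m)) = \<chi> (n + n', m)" if nm: "n \<in> space N" "n' \<in> space N" "m \<in> space M" for n n' m
  proof -
    have "\<pi> (f (n, m), g (n', m)) = \<pi> (f (n, m), g (0, m)) + \<pi> (0, i\<^sub>2 n')"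
      using add[OF inP[OF nm(1) zN nm(3)] P_in'(2)[OF nm(2)]] fg_add(2)[OF zN nm(3,2) zM] nm
      by (simp add: g(3))
    also have "\<dots> = \<pi> (f (n, m), g (0, m)) + \<pi> (i\<^sub>1 n', 0)" using nm by (simp add: \<pi>i2 \<pi>i)
    also have "\<dots> = \<pi> (f (n + n', m), g (0, m))"
      using add[OF inP[OF nm(1) zN nm(3)] P_in'(1)[OF nm(2)]] fg_add(1)[OF nm(1,3,2) zM] nm
      by (simp add: f(3))
    finally show ?thesis by (simp add: \<chi>_def)
  qed
  have \<chi>n: "\<chi> (n, 0) = i n" if "n \<in> space N" for n
    using that by (simp add: \<chi>_def f(3) fg_0 \<pi>i)
  have \<chi>p: "p (\<chi> (n, m)) = m" if "n \<in> space N" "m \<in> space M" for n m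
    using \<pi>p[OF inP[OF that(1) zN that(2)]] that by (simp add: \<chi>_def f(4))
  have \<chi>_in: "\<chi> z \<in> space E" if "z \<in> space N \<times> space M" for z
    using that by (auto simp: \<chi>_def zN intro!: \<pi>D(1) inP)
  have \<chi>_lin: "lin_on (space TS) (scale TS) (scale E) \<chi>"
    unfolding lin_on_def tw_simps(1)
  proof (intro conjI ballI allI; clarify)
    fix n m n' m' assume nm: "n \<in> space N" "m \<in> space M" "n' \<in> space N" "m' \<in> space M"
    show "\<chi> ((n, m) + (n', m')) = \<chi> (n, m) + \<chi> (n', m')"
      using add[OF inP[OF nm(1) zN nm(2)] inP[OF nm(3) zN nm(4)]] fg_add(1)[OF nm]
        fg_add(2)[OF zN nm(2) zN nm(4)] by (simp add: \<chi>_def)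
    show "\<chi> (scale TS r (n, m)) = scale E r (\<chi> (n, m))" for r
      using lin_on_scale[OF \<pi>D(2) inP[OF nm(1) zN nm(2)], of r] fg_scale(1)[OF nm(1,2)]
        fg_scale(2)[OF zN nm(2), of r]
      by (simp add: \<chi>_def tw_simps pullback_simps scale_0)
  qed
  have hom: "yd_hom A TS E \<chi>"
  proof (rule yd_homI[OF yd_S Ez _ \<chi>_lin])
    fix a z assume "z \<in> space TS"
    then obtain n m where z: "z = (n, m)" and nm: "n \<in> space N" "m \<in> space M" by (auto simp: tw_simps)
    have n0: "act N a 0 = 0" using act_0 by simp
    have "act E a (\<chi> (n, m)) = \<pi> (act E\<^sub>1 a (f (n, m)), act E\<^sub>2 a (g (0, m)))"
      using \<pi>D(3)[OF inP[OF nm(1) zN nm(2)], of a] by (simp add: \<chi>_def pullback_simps)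
    \<comment> \<open>Acting on \<open>(0, m)\<close> produces \<open>\<omega>' a m\<close> in the
      second copy of \<open>N\<close>; moving it to the first yields the sum of the two
      twists.\<close>
    also have "\<dots> = \<pi> (f (act N a n + \<omega> a m, act M a m), g (\<omega>' a m, act M a m))"
      using fD(3)[of "(n, m)" a] gD(3)[of "(0, m)" a] nm by (simp add: tw_simps zN n0)
    also have "\<dots> = \<chi> (act N a n + \<omega> a m + \<omega>' a m, act M a m)"
      by (rule \<pi>_split) (use nm in \<open>simp_all add: vsub_add vN yd_act_in M N datumD[OF d] datumD[OF d']\<close>)
    finally show "\<chi> (act TS a z) = act E a (\<chi> z)" by (simp add: z tw_simps add.assoc)
  next
    fix z and G :: "_ \<Rightarrow> _ \<Rightarrow> 'k" assume "z \<in> space TS" and G: "bil E G"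
    then obtain n m where z: "z = (n, m)" and nm: "n \<in> space N" "m \<in> space M" by (auto simp: tw_simps)
    have "rho E (\<chi> z) G = rho PB (f (n, m), g (0, m)) (\<lambda>y u. G (\<pi> y) u)"
      using \<pi>D(4)[OF inP[OF nm(1) zN nm(2)] G] by (simp add: z \<chi>_def)
    also have "\<dots> = rho TS (n + 0, m) (\<lambda>y u. G (\<chi> y) u)"
      by (rule P_rho_S[OF nm(1) zN nm(2)])
        (use bil_comp[OF G \<pi>D(2,1)] bil_comp[OF G \<chi>_lin \<chi>_in]
          in \<open>simp_all add: tw_simps \<pi>i[symmetric] \<pi>i2 \<chi>n\<close>, simp_all add: \<chi>_def)
    finally show "rho E (\<chi> z) G = rho TS z (\<lambda>y u. G (\<chi> y) u)" by (simp add: z)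
  qed (simp add: tw_simps \<chi>_in)
  have "bij_betw \<chi> (space TS) (space E)"
    unfolding bij_betw_def tw_simps(1)
  proof
    show "\<chi> ` (space N \<times> space M) = space E"
    proof
      show "space E \<subseteq> \<chi> ` (space N \<times> space M)"
      proof
        fix e assume "e \<in> space E"
        then obtain z where z: "z \<in> space PB" "e = \<pi> z" using \<pi>(2) by blast
        from z(1) obtain n n' m where "z = (f (n, m), g (n', m))" and nm: "n \<in> space N" "n' \<in> space N" "m \<in> space M"
          by (rule P_cases)
        hence "e = \<chi> (n + n', m)" using z(2) \<pi>_split by simp
        thus "e \<in> \<chi> ` (space N \<times> space M)" using nm by (simp add: vsub_add vN)
      qed
    qed (use \<chi>_in in auto)
    show "inj_on \<chi> (space N \<times> space M)"
    proof (rule inj_onI, clarify)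
      fix n m n' m' assume nm: "n \<in> space N" "m \<in> space M" "n' \<in> space N" "m' \<in> space M"
        and eq: "\<chi> (n, m) = \<chi> (n', m')"
      \<comment> \<open>\<open>p\<close> recovers \<open>m\<close>, after which injectivity of
        \<open>i\<close> recovers \<open>n\<close>.\<close>
      have m: "m = m'" using \<chi>p nm eq by metis
      have "\<chi> (x, m) = i x + \<chi> (0, m)" if "x \<in> space N" for x
        using lin_on_add[OF \<chi>_lin, of "(x, 0)" "(0, m)"] that nm by (simp add: tw_simps zM zN \<chi>n)
      hence "i n = i n'" using eq m nm by simp
      thus "n = n' \<and> m = m'" using m inj_onD[OF extD(4)[OF Z]] nm by blast
    qed
  qed
  thus ?thesis
    unfolding ext_equiv_def tw_ext_def split
    by (intro exI[of _ \<chi>] conjI hom) (auto simp: \<chi>n \<chi>p tw_simps)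
qed

text \<open>Here the quotient map has to be constructed: inverting \<open>f\<close> and
  \<open>g\<close> reads off the coordinates \<open>(n, n', m)\<close>, and \<open>\<chi>\<close> is
  applied to \<open>(n + n', m)\<close>. Its kernel, \<open>n + n' = 0\<close> and
  \<open>m = 0\<close>, is the antidiagonal copy of \<open>N\<close>.\<close>

lemma equiv_imp_baer_sum:
  assumes Z: "(E, i, p) \<in> extensions A M N"
    and eqv: "ext_equiv A M N (tw_ext (\<lambda>m. \<theta> m + \<theta>' m) (\<lambda>a m. \<omega> a m + \<omega>' a m)) (E, i, p)"
  shows "is_baer_sum A M N (E\<^sub>1, i\<^sub>1, p\<^sub>1) (E\<^sub>2, i\<^sub>2, p\<^sub>2) (E, i, p)"
proof -
  note Ez = extD(1)[OF Z]
  note vE = yd_vsub[OF Ez]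
  obtain \<chi> where \<chi>: "yd_hom A TS E \<chi>" "bij_betw \<chi> (space N \<times> space M) (space E)"
      "\<And>n. n \<in> space N \<Longrightarrow> \<chi> (n, 0) = i n"
      "\<And>n m. n \<in> space N \<Longrightarrow> m \<in> space M \<Longrightarrow> p (\<chi> (n, m)) = m"
    using eqv unfolding ext_equiv_def tw_ext_def by (auto simp: tw_simps)
  note \<chi>D = yd_homD[OF \<chi>(1) yd_S Ez, unfolded tw_simps(1)]
  define f' g' where "f' = inv_into (space N \<times> space M) f" and "g' = inv_into (space N \<times> space M) g"
  have f': "f' (f z) = z" and g': "g' (g z) = z" if "z \<in> space N \<times> space M" for z
    using that bij_betw_inv_into_left f(2) g(2) unfolding f'_def g'_def by metis+
  define \<pi> where "\<pi> z = \<chi> (fst (f' (fst z)) + fst (g' (snd z)), snd (f' (fst z)))" for z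
  have \<pi>: "\<pi> (f (n, m), g (n', m)) = \<chi> (n + n', m)" if "n \<in> space N" "n' \<in> space N" "m \<in> space M" for n n' m
    using that by (simp add: \<pi>_def f' g')
  have add: "\<chi> (n + n', m + m') = \<chi> (n, m) + \<chi> (n', m')"
    if "n \<in> space N" "m \<in> space M" "n' \<in> space N" "m' \<in> space M" for n m n' m'
    using lin_on_add[OF \<chi>D(2), of "(n, m)" "(n', m')"] that by simp
  have \<chi>0: "\<chi> (0, 0) = 0" using lin_on_0[OF \<chi>D(2)] zM zN by (simp add: zero_prod_def)
  have \<pi>1: "\<pi> (i\<^sub>1 n, 0) = \<chi> (n, 0)" and \<pi>2: "\<pi> (0, i\<^sub>2 n) = \<chi> (n, 0)" if "n \<in> space N" for n
    using \<pi>[OF that zN zM] \<pi>[OF zN that zM] that by (simp_all add: f(3) g(3) fg_0)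
  have \<pi>3: "\<pi> (f (0, m), g (0, m)) = \<chi> (0, m)" if "m \<in> space M" for m
    using \<pi>[OF zN zN that] by simp
  have \<pi>_in: "\<pi> z \<in> space E" if "z \<in> space PB" for z
    using that by (rule P_cases) (simp add: \<pi> \<chi>D(1) vsub_add vN)
  have \<pi>_lin: "lin_on (space PB) (scale PB) (scale E) \<pi>"
    unfolding lin_on_def
  proof (intro conjI ballI allI)
    fix z w assume "z \<in> space PB" "w \<in> space PB"
    then obtain n n' m k k' l where z: "z = (f (n, m), g (n', m))" "n \<in> space N" "n' \<in> space N" "m \<in> space M"
      and w: "w = (f (k, l), g (k', l))" "k \<in> space N" "k' \<in> space N" "l \<in> space M"
      by (elim P_cases) auto
    have "\<pi> (z + w) = \<pi> (f (n + k, m + l), g (n' + k', m + l))"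
      using z w by (simp add: fg_add)
    also have "\<dots> = \<chi> ((n + n') + (k + k'), m + l)"
      by (subst \<pi>) (use z w in \<open>simp_all add: vsub_add vN vM algebra_simps\<close>)
    also have "\<dots> = \<pi> z + \<pi> w" using z w by (simp add: \<pi> add vsub_add vN)
    finally show "\<pi> (z + w) = \<pi> z + \<pi> w" .
  next
    fix r z assume "z \<in> space PB"
    then obtain n n' m where z: "z = (f (n, m), g (n', m))" "n \<in> space N" "n' \<in> space N" "m \<in> space M"
      by (rule P_cases)
    interpret Nv: vector_space "scale N" using vN by (simp add: vsub_def)
    have "\<pi> (scale PB r z) = \<pi> (f (scale N r n, scale M r m), g (scale N r n', scale M r m))"
      using z by (simp add: fg_scale pullback_simps)
    also have "\<dots> = \<chi> (scale TS r (n + n', m))"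
      by (subst \<pi>) (use z in \<open>simp_all add: vsub_scale vN vM tw_simps Nv.scale_right_distrib\<close>)
    also have "\<dots> = scale E r (\<pi> z)"
      using z by (simp add: \<pi> lin_on_scale[OF \<chi>D(2)] vsub_add vN)
    finally show "\<pi> (scale PB r z) = scale E r (\<pi> z)" .
  qed
  have "\<pi> ` space PB \<subseteq> space E \<and> lin_on (space PB) (scale PB) (scale E) \<pi> \<and>
     (\<forall>a. \<forall>m\<in>space PB. \<pi> (act PB a m) = act E a (\<pi> m)) \<and>
     (\<forall>m\<in>space PB. \<forall>G::_ \<Rightarrow> _ \<Rightarrow> 'k. bil E G \<longrightarrow> rho E (\<pi> m) G = rho PB m (\<lambda>y u. G (\<pi> y) u))"
  proof (intro conjI allI ballI impI \<pi>_lin)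
    show "\<pi> ` space PB \<subseteq> space E" using \<pi>_in by auto
  next
    fix a z assume "z \<in> space PB"
    then obtain n n' m where z: "z = (f (n, m), g (n', m))" "n \<in> space N" "n' \<in> space N" "m \<in> space M"
      by (rule P_cases)
    have "\<pi> (act PB a z) = \<pi> (f (act N a n + \<omega> a m, act M a m), g (act N a n' + \<omega>' a m, act M a m))"
      using z fD(3)[of "(n, m)" a] gD(3)[of "(n', m)" a] by (simp add: pullback_simps tw_simps)
    also have "\<dots> = \<chi> (act TS a (n + n', m))"
      by (subst \<pi>) (use z in \<open>simp_all add: vsub_add vN yd_act_in M N datumD[OF d] datumD[OF d'] tw_simps
          lin_on_add[OF yd_act_lin[OF N]] algebra_simps\<close>)
    also have "\<dots> = act E a (\<pi> z)"
      using z by (simp add: \<pi> \<chi>D(3) vsub_add vN)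
    finally show "\<pi> (act PB a z) = act E a (\<pi> z)" .
  next
    fix z and G :: "_ \<Rightarrow> _ \<Rightarrow> 'k" assume "z \<in> space PB" and G: "bil E G"
    then obtain n n' m where z: "z = (f (n, m), g (n', m))" "n \<in> space N" "n' \<in> space N" "m \<in> space M"
      by (elim P_cases)
    have "rho E (\<pi> z) G = rho TS (n + n', m) (\<lambda>y u. G (\<chi> y) u)"
      using z \<chi>D(4)[OF _ G, of "(n + n', m)"] by (simp add: \<pi> vsub_add vN)
    also have "\<dots> = rho PB z (\<lambda>y u. G (\<pi> y) u)"
      unfolding z(1)
      by (rule P_rho_S[OF z(2-4), symmetric]) (simp_all add: bil_comp[OF G \<pi>_lin \<pi>_in] \<chi>D(5)[OF G] \<pi>1 \<pi>2 \<pi>3)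
    finally show "rho E (\<pi> z) G = rho PB z (\<lambda>y u. G (\<pi> y) u)" .
  qed
  hence hom: "yd_hom A PB E \<pi>"
    using yd_hom_iff[OF P_vsub P_coact_in vE yd_coact_in[OF Ez]] by blast
  have surj: "\<pi> ` space PB = space E"
  proof
    show "space E \<subseteq> \<pi> ` space PB"
    proof
      fix e assume "e \<in> space E"
      hence "e \<in> \<chi> ` (space N \<times> space M)" using \<chi>(2) by (simp add: bij_betw_def)
      then obtain n m where nm: "n \<in> space N" "m \<in> space M" "e = \<chi> (n, m)" by auto
      hence "e = \<pi> (f (n, m), g (0, m))" by (simp add: \<pi> zN)
      thus "e \<in> \<pi> ` space PB" using P_in[OF nm(1) zN nm(2)] by (rule image_eqI)
    qed
  qed (use \<pi>_in in auto)
  \<comment> \<open>Identifies \<open>(i\<^sub>1 n, - i\<^sub>2 n)\<close> as the point of the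
    pullback with coordinates \<open>n\<close>, \<open>- n\<close> and 0.\<close>
  have neg: "g (- n, 0) = - i\<^sub>2 n" if "n \<in> space N" for n
  proof -
    have "g (n + - n, 0 + 0) = i\<^sub>2 n + g (- n, 0)"
      using fg_add(2)[OF that zM vsub_minus[OF vN that] zM] g(3)[OF that] by simp
    hence "i\<^sub>2 n + g (- n, 0) = 0" by (simp add: fg_0)
    thus ?thesis by (rule minus_unique[symmetric])
  qed
  have ker: "{z \<in> space PB. \<pi> z = 0} = (\<lambda>n. (i\<^sub>1 n, - i\<^sub>2 n)) ` space N"
  proof (intro equalityI subsetI)
    fix z assume "z \<in> {z \<in> space PB. \<pi> z = 0}"
    hence zP: "z \<in> space PB" and 0: "\<pi> z = 0" by auto
    from zP obtain n n' m where z: "z = (f (n, m), g (n', m))" "n \<in> space N" "n' \<in> space N" "m \<in> space M"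
      by (rule P_cases)
    have "\<chi> (n + n', m) = \<chi> (0, 0)" using 0 z by (simp add: \<pi> \<chi>0)
    hence "(n + n', m) = (0, 0)"
      using \<chi>(2) z by (intro inj_onD[of \<chi> "space N \<times> space M"]) (auto simp: bij_betw_def zM zN vsub_add vN)
    hence "m = 0" "n' = - n" by (auto simp: eq_neg_iff_add_eq_0 add.commute)
    hence "z = (i\<^sub>1 n, - i\<^sub>2 n)" using z by (simp add: f(3) neg)
    thus "z \<in> (\<lambda>n. (i\<^sub>1 n, - i\<^sub>2 n)) ` space N" using z(2) by blast
  next
    fix z assume "z \<in> (\<lambda>n. (i\<^sub>1 n, - i\<^sub>2 n)) ` space N"
    then obtain n where n: "n \<in> space N" "z = (i\<^sub>1 n, - i\<^sub>2 n)" by blast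
    have "z = (f (n, 0), g (- n, 0))" using n by (simp add: f(3) neg)
    thus "z \<in> {z \<in> space PB. \<pi> z = 0}"
      using n P_in[OF n(1) vsub_minus[OF vN n(1)] zM] \<pi>[OF n(1) vsub_minus[OF vN n(1)] zM] by (simp add: \<chi>0)
  qed
  have "p (\<pi> (x, y)) = p\<^sub>1 x" if "(x, y) \<in> space PB" for x y
    using that by (rule P_cases) (simp add: \<pi> \<chi>(4) f(4) vsub_add vN)
  thus ?thesis
    unfolding is_baer_sum_pullback using hom surj ker \<pi>1 \<chi>(3) by (intro exI[of _ \<pi>]) auto
qed

end

end

section \<open>Linear maps out of tensor spaces\<close>

text \<open>Tensors are functions on forms, so a tensor-valued map can be treated coordinate by
  coordinate, each coordinate being a form on the generators.\<close>

definition multilinear :: "('x, 'k::field) multi \<Rightarrow> ('x \<Rightarrow> 'i \<Rightarrow> 'k) \<Rightarrow> bool" where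
  "multilinear T g \<longleftrightarrow> (\<forall>i. \<exists>\<gamma>\<in>forms T. \<forall>x\<in>gens T. \<gamma> x = g x i)"

text \<open>Each coordinate of the Sweedler sum is evaluation at a form, hence linear in the tensor
  and correct on pure tensors.\<close>

lemma multilinear_tsum:
  assumes "absorbs T" "multilinear T g"
  shows "lin_on (tspace T) fscale fscale (tsum T g)"
    and "x \<in> gens T \<Longrightarrow> tsum T g (pure T x) = g x"
proof -
  have *: "\<exists>\<gamma>\<in>forms T. (\<forall>x\<in>gens T. \<gamma> x = g x i) \<and> (\<forall>t\<in>tspace T. tsum T g t i = t \<gamma>)" for i
  proof -
    obtain \<gamma> where \<gamma>: "\<gamma> \<in> forms T" "\<And>x. x \<in> gens T \<Longrightarrow> \<gamma> x = g x i"
      using assms(2) unfolding multilinear_def by blast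
    have "tsum T g t i = t \<gamma>" if "t \<in> tspace T" for t
      unfolding tsum_apply by (rule tsum_form[OF assms(1) that \<gamma>])
    thus ?thesis using \<gamma> by blast
  qed
  show "lin_on (tspace T) fscale fscale (tsum T g)"
    unfolding lin_on_def
  proof (intro conjI ballI allI ext)
    fix s t c i assume "s \<in> tspace T" "t \<in> tspace T"
    moreover obtain \<gamma> where "\<forall>t\<in>tspace T. tsum T g t i = t \<gamma>" using * by blast
    ultimately show "tsum T g (s + t) i = (tsum T g s + tsum T g t) i"
      by (simp add: tspace_add)
  next
    fix t c i assume "t \<in> tspace T"
    moreover obtain \<gamma> where "\<forall>t\<in>tspace T. tsum T g t i = t \<gamma>" using * by blast
    ultimately show "tsum T g (fscale c t) i = fscale c (tsum T g t) i"
      by (simp add: tspace_scale fscale_apply)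
  qed
  show "tsum T g (pure T x) = g x" if "x \<in> gens T"
  proof
    fix i
    obtain \<gamma> where \<gamma>: "\<gamma> \<in> forms T" "\<forall>x\<in>gens T. \<gamma> x = g x i" "\<forall>t\<in>tspace T. tsum T g t i = t \<gamma>"
      using * by blast
    have "tsum T g (pure T x) i = pure T x \<gamma>" using \<gamma>(3) tspace_pure[OF that] by blast
    thus "tsum T g (pure T x) i = g x i" using that \<gamma> by (simp add: pure_def)
  qed
qed

lemma lift_lin: "absorbs T \<Longrightarrow> multilinear T g \<Longrightarrow> lin_on (tspace T) fscale fscale (lift T g)"
  using multilinear_tsum(1)[of T g] by (simp add: lift_def lin_on_def tspace_add tspace_scale)

lemma lift_pure: "absorbs T \<Longrightarrow> multilinear T g \<Longrightarrow> x \<in> gens T \<Longrightarrow> lift T g (pure T x) = g x"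
  by (simp add: lift_def tspace_pure multilinear_tsum(2))

lemma lift_cong: "absorbs T \<Longrightarrow> (\<And>x. x \<in> gens T \<Longrightarrow> g x = h x) \<Longrightarrow> lift T g = lift T h"
  unfolding lift_def by (rule ext) (auto intro: tsum_cong)

text \<open>Both lifts sum over the same chosen decomposition, so they can be added term by term
  before any multilinearity is established.\<close>

lemma lift_plus: "lift T g + lift T h = lift T (\<lambda>x. g x + h x)"
  by (auto simp: lift_def fun_eq_iff tsum_plus tsum_apply)

lemma lift_minus: "lift T g - lift T h = lift T (\<lambda>x. g x - h x)"
  for g :: "_ \<Rightarrow> _ \<Rightarrow> 'k::field"
  by (auto simp: lift_def fun_eq_iff tsum_minus tsum_apply)

lemma lift_eq_0_iff:
  assumes "absorbs T" "multilinear T g"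
  shows "lift T g = 0 \<longleftrightarrow> (\<forall>x\<in>gens T. g x = 0)"
proof
  assume "lift T g = 0" thus "\<forall>x\<in>gens T. g x = 0" using lift_pure[OF assms] by auto
next
  assume "\<forall>x\<in>gens T. g x = 0"
  hence "lift T g = lift T (\<lambda>_. 0)" by (intro lift_cong assms) auto
  thus "lift T g = 0" by (simp add: lift_def tsum_zero fun_eq_iff)
qed

text \<open>A linear map is the sum of its values over whichever decomposition into pure tensors was
  chosen; off \<open>tspace T\<close> both sides are 0.\<close>

lemma lin_on_eq_lift:
  assumes "absorbs T" "lin_on (tspace T) fscale fscale f" "\<And>t. t \<notin> tspace T \<Longrightarrow> f t = 0"
  shows "f = lift T (\<lambda>x. f (pure T x))"
proof
  fix t
  show "f t = lift T (\<lambda>x. f (pure T x)) t"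
  proof (cases "t \<in> tspace T")
    case True
    have f0: "f 0 = 0" by (rule lin_on_0[OF assms(2) tspace_0])
    have sum: "f (\<Sum>x\<leftarrow>r. pure T x) = (\<Sum>x\<leftarrow>r. f (pure T x))" if "set r \<subseteq> gens T" for r
      using that
    proof (induction r)
      case (Cons x r)
      have "(\<Sum>x\<leftarrow>r. pure T x) \<in> tspace T"
        using Cons.prems by (intro tspace_sum_list) (auto intro: tspace_pure)
      hence "f (pure T x + (\<Sum>x\<leftarrow>r. pure T x)) = f (pure T x) + f (\<Sum>x\<leftarrow>r. pure T x)"
        using Cons.prems by (intro lin_on_add[OF assms(2)]) (auto intro: tspace_pure)
      moreover have "f (\<Sum>x\<leftarrow>r. pure T x) = (\<Sum>x\<leftarrow>r. f (pure T x))"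
        using Cons by simp
      ultimately show ?case by (simp only: list.map sum_list.Cons)
    qed (use f0 in simp)
    show ?thesis
      using sum[OF tsum_rep(1)[OF assms(1) True]] True
      unfolding tsum_rep(2)[OF assms(1) True] by (simp add: lift_def tsum_def)
  qed (simp add: assms(3) lift_def)
qed

lemma gens_AM_0: "x \<in> gens (AM A 0 M) \<longleftrightarrow> (\<exists>m\<in>space M. x = ([], m))"
  by (cases x) (auto simp: AM_def)

lemma gens_AM_1: "x \<in> gens (AM A 1 M) \<longleftrightarrow> (\<exists>m\<in>space M. \<exists>a. x = ([a], m))"
  by (cases x) (auto simp: AM_def length_Suc_conv One_nat_def)

lemma gens_AM_2: "x \<in> gens (AM A 2 M) \<longleftrightarrow> (\<exists>m\<in>space M. \<exists>a b. x = ([a, b], m))"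
  by (cases x) (auto simp: AM_def length_Suc_conv numeral_2_eq_2)

lemma gens_Apow_1: "x \<in> gens (Apow A 1) \<longleftrightarrow> (\<exists>a. x = [a])"
  by (auto simp: Apow_def length_Suc_conv One_nat_def)

lemma lin_on_component: "lin_on S s fscale g \<Longrightarrow> lin_on S s (*) (\<lambda>x. g x i)"
  by (simp add: lin_on_def fscale_def)

lemma lin_on_components: "(\<And>i. lin_on S s (*) (\<lambda>x. g x i)) \<Longrightarrow> lin_on S s fscale g"
  unfolding lin_on_def by (simp add: fun_eq_iff fscale_def)

section \<open>Tensor spaces with few factors\<close>

context sweedler
begin

lemma multilinear_AM_0:
  assumes "vsub M" "lin_on (space M) (scale M) fscale (\<lambda>m. g ([], m))"
  shows "multilinear (AM A 0 M) g"
  unfolding multilinear_def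
  by (intro allI multi_form_AM A_vs assms) (auto intro: lin_on_component[OF assms(2)])

lemma multilinear_AM_1:
  assumes "vsub M" "\<And>a. lin_on (space M) (scale M) fscale (\<lambda>m. g ([a], m))"
    "\<And>m. m \<in> space M \<Longrightarrow> lin_on UNIV (bscale A) fscale (\<lambda>a. g ([a], m))"
  shows "multilinear (AM A 1 M) g"
  unfolding multilinear_def
  by (intro allI multi_form_AM A_vs assms(1))
    (auto simp: length_Suc_conv One_nat_def intro: lin_on_component[OF assms(2)] lin_on_component[OF assms(3)])

lemma multilinear_AM_2:
  assumes "vsub M" "\<And>a b. lin_on (space M) (scale M) fscale (\<lambda>m. g ([a, b], m))"
    "\<And>b m. m \<in> space M \<Longrightarrow> lin_on UNIV (bscale A) fscale (\<lambda>a. g ([a, b], m))"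
    "\<And>a m. m \<in> space M \<Longrightarrow> lin_on UNIV (bscale A) fscale (\<lambda>b. g ([a, b], m))"
  shows "multilinear (AM A 2 M) g"
  unfolding multilinear_def
  by (intro allI multi_form_AM A_vs assms(1))
    (auto simp: length_Suc_conv numeral_2_eq_2 less_Suc_eq intro: lin_on_component[OF assms(2)]
      lin_on_component[OF assms(3)] lin_on_component[OF assms(4)])

lemma multilinear_MA_0:
  assumes "vsub M" "lin_on (space M) (scale M) fscale (\<lambda>m. g (m, []))"
  shows "multilinear (MA A M 0) g"
  unfolding multilinear_def
  by (intro allI multi_form_MA A_vs assms) (auto intro: lin_on_component[OF assms(2)])

lemma multilinear_Apow_1:
  assumes "lin_on UNIV (bscale A) fscale (\<lambda>a. g [a])"
  shows "multilinear (Apow A 1) g"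
  unfolding multilinear_def
proof (intro allI bexI ballI)
  fix i
  show "(\<lambda>x. g [x ! 0] i) \<in> forms (Apow A 1)"
    using lin_on_component[OF assms, of i]
    by (auto simp: Apow_def linear_iff_lin_on A_vs vector_space_mult length_Suc_conv One_nat_def)
  show "g [x ! 0] i = g x i" if "x \<in> gens (Apow A 1)" for x
    using that by (auto simp: gens_Apow_1)
qed

lemma absorbs_A1: "absorbs (Apow A 1)"
  using absorbs_Apow[of A 0] by (simp add: One_nat_def)

lemma tsum_Apow_1:
  "lin_on UNIV (bscale A) fscale (\<lambda>a. g [a]) \<Longrightarrow> tsum (Apow A 1) g (pure (Apow A 1) [a]) = g [a]"
  by (rule multilinear_tsum(2)) (auto simp: absorbs_A1 multilinear_Apow_1 gens_Apow_1)

lemma tsum_MA_0: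
  "vsub M \<Longrightarrow> m \<in> space M \<Longrightarrow> lin_on (space M) (scale M) fscale (\<lambda>m. g (m, [])) \<Longrightarrow>
   tsum (MA A M 0) g (pure (MA A M 0) (m, [])) = g (m, [])"
  by (rule multilinear_tsum(2)) (auto simp: absorbs_MA multilinear_MA_0 gens_MA_0)

lemma pure_MA_0_lin: "vsub M \<Longrightarrow> lin_on (space M) (scale M) fscale (\<lambda>m. pure (MA A M 0) (m, []))"
  by (auto simp: lin_on_def pure_def fun_eq_iff fscale_def MA_def linear_iff_lin_on)

text \<open>The recursion ends in a pure tensor of \<open>A^1\<close>, so already its first step is
  a double sum; linearity of a pure tensor in its last factor collapses the inner one.\<close>

lemma icomult_1: "icomult A 1 a = comult A a"
proof -
  have *: "lin_on UNIV (bscale A) fscale (\<lambda>c. pure (Apow A 2) [b, c])" for b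
  proof (rule lin_on_components)
    fix \<beta>
    have "lin_on UNIV (bscale A) (*) (\<lambda>c. \<beta> [b, c])" if "\<beta> \<in> forms (Apow A 2)"
    proof -
      have "\<forall>as. length as = 2 \<longrightarrow> (\<forall>i<2. lin_on UNIV (bscale A) (*) (\<lambda>x. \<beta> (as[i := x])))"
        using that unfolding Apow_def linear_iff_lin_on by simp
      from this[rule_format, of "[b, b]" 1] show ?thesis by (simp add: One_nat_def)
    qed
    thus "lin_on UNIV (bscale A) (*) (\<lambda>c. pure (Apow A 2) [b, c] \<beta>)"
      by (cases "\<beta> \<in> forms (Apow A 2)") (simp_all add: pure_def lin_on_def)
  qed
  have "icomult A 1 a = icomult A (Suc 0) a" by (simp add: One_nat_def)
  also have "\<dots> = tsum (Apow A 2) (\<lambda>l. tsum (Apow A 1) (\<lambda>l'. pure (Apow A 2) (l ! 0 # l')) (pure (Apow A 1) [l ! 1])) (comult A a)"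
    by (simp add: One_nat_def numeral_2_eq_2)
  also have "\<dots> = tsum (Apow A 2) (pure (Apow A 2)) (comult A a)"
    by (rule tsum_cong[OF absorbs_A2 comult_in]) (auto simp: gens_Apow_2 tsum_Apow_1 * nth_pair_1)
  also have "\<dots> = comult A a" by (rule tsum_pure_id[OF absorbs_A2 comult_in])
  finally show ?thesis .
qed

text \<open>The identification of \<open>M \<otimes> A^0\<close> with \<open>M\<close>.\<close>

definition un0 :: "('v::ab_group_add, 'a, 'k) yd \<Rightarrow> ('v \<times> 'a list, 'k) tensor \<Rightarrow> 'v" where
  "un0 V t = tsum (MA A V 0) fst t"

lemma un0_pure:
  assumes "vsub V" "x \<in> space V"
  shows "un0 V (pure (MA A V 0) (x, [])) = x"
  using tsum_eq_MA[of "scale V" V 0 A fst "[(x, [])]"] assms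
  by (simp add: un0_def vsub_def lin_on_def gens_MA_0)

text \<open>With a single factor, sums of pure tensors are pure.\<close>

lemma tspace_MA_0:
  assumes V: "vsub V" and t: "t \<in> tspace (MA A V 0)"
  shows "\<exists>x\<in>space V. t = pure (MA A V 0) (x, [])"
proof -
  note l = pure_MA_0_lin[OF V]
  have "\<exists>x\<in>space V. (\<Sum>x\<leftarrow>r. pure (MA A V 0) x) = pure (MA A V 0) (x, [])" if "set r \<subseteq> gens (MA A V 0)" for r
    using that
  proof (induction r)
    case Nil
    show ?case using lin_on_0[OF l vsub_0[OF V]] vsub_0[OF V] by (intro bexI[of _ 0]) auto
  next
    case (Cons y r)
    then obtain x where x: "x \<in> space V" "(\<Sum>x\<leftarrow>r. pure (MA A V 0) x) = pure (MA A V 0) (x, [])" by auto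
    obtain z where z: "z \<in> space V" "y = (z, [])" using Cons.prems by (auto simp: gens_MA_0)
    have "(\<Sum>x\<leftarrow>y # r. pure (MA A V 0) x) = pure (MA A V 0) (z + x, [])"
      using x z by (simp add: lin_on_add[OF l])
    thus ?case using vsub_add[OF V z(1) x(1)] by blast
  qed
  thus ?thesis using tspace_decomp[OF absorbs_MA[OF V] t] by auto
qed

lemma un0_in: "vsub V \<Longrightarrow> t \<in> tspace (MA A V 0) \<Longrightarrow> un0 V t \<in> space V"
  and pure_un0: "vsub V \<Longrightarrow> t \<in> tspace (MA A V 0) \<Longrightarrow> pure (MA A V 0) (un0 V t, []) = t"
  using tspace_MA_0[of V t] un0_pure[of V] by auto

lemma pure_MA_0_in: "x \<in> space V \<Longrightarrow> pure (MA A V 0) (x, []) \<in> tspace (MA A V 0)"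
  by (rule tspace_pure) (simp add: gens_MA_0)

lemma un0_lin:
  assumes V: "vsub V"
  shows "lin_on (tspace (MA A V 0)) fscale (scale V) (un0 V)"
  unfolding lin_on_def
proof (intro conjI ballI allI)
  fix s t c assume st: "s \<in> tspace (MA A V 0)" "t \<in> tspace (MA A V 0)"
  obtain x y where x: "x \<in> space V" "s = pure (MA A V 0) (x, [])" and y: "y \<in> space V" "t = pure (MA A V 0) (y, [])"
    using tspace_MA_0[OF V st(1)] tspace_MA_0[OF V st(2)] by blast
  show "un0 V (s + t) = un0 V s + un0 V t"
    using x y by (simp add: un0_pure V vsub_add flip: lin_on_add[OF pure_MA_0_lin[OF V]])
next
  fix t c assume t: "t \<in> tspace (MA A V 0)"
  obtain y where y: "y \<in> space V" "t = pure (MA A V 0) (y, [])"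
    using tspace_MA_0[OF V t] by blast
  show "un0 V (fscale c t) = scale V c (un0 V t)"
    using y by (simp add: un0_pure V vsub_scale flip: lin_on_scale[OF pure_MA_0_lin[OF V]])
qed

lemma pure_MA_1_lin:
  assumes "vsub V"
  shows "lin_on (space V) (scale V) fscale (\<lambda>y. pure (MA A V 1) (y, [u]))"
    "y \<in> space V \<Longrightarrow> lin_on UNIV (bscale A) fscale (\<lambda>u. pure (MA A V 1) (y, [u]))"
proof -
  show "lin_on (space V) (scale V) fscale (\<lambda>y. pure (MA A V 1) (y, [u]))"
  proof (rule lin_on_components)
    fix \<beta> show "lin_on (space V) (scale V) (*) (\<lambda>y. pure (MA A V 1) (y, [u]) \<beta>)"
      using bilD2[OF form_bil[of \<beta> V], of u]
      by (cases "\<beta> \<in> forms (MA A V 1)") (simp_all add: pure_def lin_on_def)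
  qed
  show "y \<in> space V \<Longrightarrow> lin_on UNIV (bscale A) fscale (\<lambda>u. pure (MA A V 1) (y, [u]))"
  proof (rule lin_on_components)
    fix \<beta> assume "y \<in> space V" thus "lin_on UNIV (bscale A) (*) (\<lambda>u. pure (MA A V 1) (y, [u]) \<beta>)"
      using bilD1[OF form_bil[of \<beta> V], of y]
      by (cases "\<beta> \<in> forms (MA A V 1)") (simp_all add: pure_def lin_on_def)
  qed
qed

lemma rho_pure: "vsub V \<Longrightarrow> t \<in> tens V \<Longrightarrow> ev V t (\<lambda>y u. pure (MA A V 1) (y, [u])) = t"
  using tsum_MA_ev[of V t "pure (MA A V 1)"] tsum_pure_id[OF absorbs_MA[of V A 1]] by simp

section \<open>The differentials in low degrees\<close>

lemma Yhom_in: "f \<in> Yhom A M N n p \<Longrightarrow> t \<in> tspace (AM A n M) \<Longrightarrow> f t \<in> tspace (MA A N p)"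
  and Yhom_lin: "f \<in> Yhom A M N n p \<Longrightarrow> lin_on (tspace (AM A n M)) fscale fscale f"
  and Yhom_off: "f \<in> Yhom A M N n p \<Longrightarrow> t \<notin> tspace (AM A n M) \<Longrightarrow> f t = 0"
  unfolding Yhom_def by blast+

lemma pure_AM_in: "m \<in> space M \<Longrightarrow> length as = n \<Longrightarrow> pure (AM A n M) (as, m) \<in> tspace (AM A n M)"
  by (rule tspace_pure) (simp add: AM_def)

lemma pure_AM_lin:
  assumes "length as = n"
  shows "lin_on S (scale M) fscale (\<lambda>m. pure (AM A n M) (as, m))"
    "i < n \<Longrightarrow> lin_on UNIV (bscale A) fscale (\<lambda>a. pure (AM A n M) (as[i := a], m))"
  using assms
  by (auto simp: lin_on_def pure_def fun_eq_iff fscale_def AM_def linear_iff_lin_on)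

lemma Yhom_eq_lift:
  assumes "vsub M" "f \<in> Yhom A M N n p"
  shows "f = lift (AM A n M) (\<lambda>x. f (pure (AM A n M) x))"
  by (rule lin_on_eq_lift[OF absorbs_AM[OF assms(1)] Yhom_lin[OF assms(2)] Yhom_off[OF assms(2)]])

lemma lift_Yhom:
  assumes "vsub M" "multilinear (AM A n M) g" "\<And>x. x \<in> gens (AM A n M) \<Longrightarrow> g x \<in> tspace (MA A N p)"
  shows "lift (AM A n M) g \<in> Yhom A M N n p"
  unfolding Yhom_def
  using lift_lin[OF absorbs_AM[OF assms(1)] assms(2)]
  by (auto simp: lift_def intro!: tsum_in_tspace absorbs_AM assms)

lemma sum_atMost_1: "(\<Sum>i\<le>1. h i) = h 0 + h (1::nat)" for h :: "nat \<Rightarrow> 'w::comm_monoid_add"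
  by (simp add: One_nat_def)

lemma sum_atMost_2: "(\<Sum>i\<le>2. h i) = h 0 + h 1 + h (2::nat)" for h :: "nat \<Rightarrow> 'w::comm_monoid_add"
  by (simp add: numeral_2_eq_2 One_nat_def)

end

context yd_pair
begin

text \<open>
  A cochain of degree one is a pair of maps \<open>M \<rightarrow> N \<otimes> A\<close> and \<open>A \<otimes> M \<rightarrow> N\<close>. Setting them to \<open>0\<close> off
  \<open>space M\<close> makes them additive in the cochain as functions.
\<close>

definition theta :: "('m, 'n, 'a, 'k) ymap \<Rightarrow> 'm \<Rightarrow> ('n \<times> 'a list, 'k) tensor" where
  "theta f m = (if m \<in> space M then f (pure (AM A 0 M) ([], m)) else 0)"

definition omega :: "('m, 'n, 'a, 'k) ymap \<Rightarrow> 'a \<Rightarrow> 'm \<Rightarrow> 'n" where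
  "omega f a m = (if m \<in> space M then un0 N (f (pure (AM A 1 M) ([a], m))) else 0)"

definition deg0 :: "('m, 'n, 'a, 'k) ymap \<Rightarrow> 'm \<Rightarrow> 'n" where
  "deg0 f m = un0 N (f (pure (AM A 0 M) ([], m)))"

lemma omega_lin:
  assumes g: "g \<in> Yhom A M N 1 0"
  shows "lin_on (space M) (scale M) (scale N) (omega g a)"
proof -
  have "lin_on (space M) (scale M) (scale N) (\<lambda>m. un0 N (g (pure (AM A 1 M) ([a], m))))"
    by (rule lin_on_comp[OF un0_lin[OF vN]], rule lin_on_comp[OF Yhom_lin[OF g] pure_AM_lin(1)])
      (simp_all add: pure_AM_in Yhom_in[OF g])
  thus ?thesis by (simp add: lin_on_def omega_def vsub_add vsub_scale vM)
qed

lemma datum_theta_omega: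
  assumes f: "f \<in> Yhom A M N 0 1" and g: "g \<in> Yhom A M N 1 0"
  shows "datum M N (theta f) (omega g)"
  unfolding datum_def
proof (intro conjI allI ballI)
  show "theta f m \<in> tens N" if "m \<in> space M" for m
    using that by (simp add: theta_def Yhom_in[OF f] pure_AM_in)
  have "lin_on (space M) (scale M) fscale (\<lambda>m. f (pure (AM A 0 M) ([], m)))"
    by (rule lin_on_comp[OF Yhom_lin[OF f] pure_AM_lin(1)]) (simp_all add: pure_AM_in)
  thus "lin_on (space M) (scale M) fscale (theta f)"
    by (simp add: lin_on_def theta_def vsub_add vsub_scale vM)
  show "omega g a m \<in> space N" if "m \<in> space M" for a m
    using that by (simp add: omega_def un0_in vN Yhom_in[OF g] pure_AM_in)
  show "lin_on (space M) (scale M) (scale N) (omega g a)" for a by (rule omega_lin[OF g])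
  show "lin_on UNIV (bscale A) (scale N) (\<lambda>a. omega g a m)" if m: "m \<in> space M" for m
  proof -
    have l: "lin_on UNIV (bscale A) fscale (\<lambda>a. pure (AM A 1 M) ([a], m))"
      using pure_AM_lin(2)[of "[0]" 1 0 M m] by simp
    have "lin_on UNIV (bscale A) (scale N) (\<lambda>a. un0 N (g (pure (AM A 1 M) ([a], m))))"
      by (rule lin_on_comp[OF un0_lin[OF vN]], rule lin_on_comp[OF Yhom_lin[OF g] l])
        (simp_all add: pure_AM_in Yhom_in[OF g] m)
    thus ?thesis by (simp add: omega_def m)
  qed
qed

lemma deg0_lin:
  assumes f: "f \<in> Yhom A M N 0 0"
  shows "lin_on (space M) (scale M) (scale N) (deg0 f)" "m \<in> space M \<Longrightarrow> deg0 f m \<in> space N"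
    "m \<in> space M \<Longrightarrow> f (pure (AM A 0 M) ([], m)) = pure (MA A N 0) (deg0 f m, [])"
proof -
  show "lin_on (space M) (scale M) (scale N) (deg0 f)"
    unfolding deg0_def
    by (rule lin_on_comp[OF un0_lin[OF vN]], rule lin_on_comp[OF Yhom_lin[OF f] pure_AM_lin(1)])
      (simp_all add: pure_AM_in Yhom_in[OF f])
  show "m \<in> space M \<Longrightarrow> deg0 f m \<in> space N"
    by (simp add: deg0_def un0_in vN Yhom_in[OF f] pure_AM_in)
  show "m \<in> space M \<Longrightarrow> f (pure (AM A 0 M) ([], m)) = pure (MA A N 0) (deg0 f m, [])"
    by (simp add: deg0_def pure_un0 vN Yhom_in[OF f] pure_AM_in)
qed

lemma omega_pure:
  assumes f: "f \<in> Yhom A M N 1 0"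
  shows "m \<in> space M \<Longrightarrow> f (pure (AM A 1 M) ([a], m)) = pure (MA A N 0) (omega f a m, [])"
    "m \<in> space M \<Longrightarrow> omega f a m \<in> space N"
  by (simp_all add: omega_def pure_un0 un0_in vN Yhom_in[OF f] pure_AM_in)

section \<open>Explicit differentials on cochains of total degree at most one\<close>

lemma lin_act_pure_0: "lin_on (space N) (scale N) fscale (\<lambda>y. pure (MA A N 0) (act N b y, []))"
  by (rule lin_on_comp[OF pure_MA_0_lin[OF vN] yd_act_lin[OF N]]) (simp add: yd_act_in N)

lemma lin_act_pure_0': "y \<in> space N \<Longrightarrow> lin_on UNIV (bscale A) fscale (\<lambda>b. pure (MA A N 0) (act N b y, []))"
  by (rule lin_on_comp[OF pure_MA_0_lin[OF vN] yd_act_lin_alg[OF N]]) (auto simp: yd_act_in N)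

text \<open>For \<open>p = 0\<close> the sum over \<open>A^1\<close> and the sum over
  \<open>N \<otimes> A^0\<close> each run over a pure tensor and reduce to one term.\<close>

lemma left_action_0:
  assumes "y \<in> space N"
  shows "tsum (Apow A 1) (\<lambda>l. tsum (MA A N 0)
         (\<lambda>(y, bs). pure (MA A N 0) (act N (hd l) y, map2 (*) (tl l) bs))
         (pure (MA A N 0) (y, []))) (pure (Apow A 1) [a]) = pure (MA A N 0) (act N a y, [])"
proof -
  have 1: "tsum (MA A N 0) (\<lambda>(y, bs). pure (MA A N 0) (act N (hd l) y, map2 (*) (tl l) bs))
         (pure (MA A N 0) (y, [])) = pure (MA A N 0) (act N (hd l) y, [])" for l
    by (subst tsum_MA_0[OF vN assms]) (simp_all add: lin_act_pure_0)
  show ?thesis unfolding 1 by (subst tsum_Apow_1) (simp_all add: lin_act_pure_0' assms)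
qed

text \<open>Stated for a family \<open>h\<close> so as to serve cochains without argument in
  \<open>A\<close> and, with the first argument held fixed, cochains with one.\<close>

lemma right_action_0:
  assumes "\<And>a. h a = pure (MA A N 0) (k a, [])" "\<And>a. k a \<in> space N" "lin_on UNIV (bscale A) (scale N) k"
  shows "tsum (Apow A 1) (\<lambda>l. tsum (MA A N 0)
         (\<lambda>(y, bs). pure (MA A N 0) (y, map2 (*) bs (butlast l)))
         (h (last l))) (pure (Apow A 1) [a]) = pure (MA A N 0) (k a, [])"
proof -
  have 1: "tsum (MA A N 0) (\<lambda>(y, bs). pure (MA A N 0) (y, map2 (*) bs (butlast l)))
         (h (last l)) = pure (MA A N 0) (k (last l), [])" for l
    unfolding assms(1) by (subst tsum_MA_0[OF vN assms(2)]) (simp_all add: pure_MA_0_lin vN)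
  have "lin_on UNIV (bscale A) fscale (\<lambda>a. pure (MA A N 0) (k a, []))"
    by (rule lin_on_comp[OF pure_MA_0_lin[OF vN] assms(3)]) (simp add: assms(2))
  thus ?thesis unfolding 1 by (subst tsum_Apow_1) simp_all
qed

text \<open>On a map from \<open>M\<close> to \<open>N\<close> this differential measures the
  failure to be \<open>A\<close>-linear, and \<open>d_c_00\<close> the failure to be
  colinear.\<close>

lemma d_m_00:
  assumes f: "f \<in> Yhom A M N 0 0"
  shows "d_m A M N 0 0 f = lift (AM A 1 M) (\<lambda>(as, m).
    pure (MA A N 0) (act N (hd as) (deg0 f m) - deg0 f (act M (hd as) m), []))"
proof -
  note p = deg0_lin[OF f]
  have 0: "b_map A M N 0 0 0 f = lift (AM A 1 M) (\<lambda>(as, m). pure (MA A N 0) (act N (hd as) (deg0 f m), []))"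
    unfolding b_map_def add_0
    by (rule lift_cong[OF absorbs_AM[OF vM]])
      (auto simp: gens_AM_1 p left_action_0)
  have 1: "b_map A M N 0 0 1 f = lift (AM A 1 M) (\<lambda>(as, m). pure (MA A N 0) (deg0 f (act M (hd as) m), []))"
    unfolding b_map_def add_0
  proof (rule lift_cong[OF absorbs_AM[OF vM]], unfold gens_AM_1, elim bexE exE, simp)
    fix m a assume m: "m \<in> space M"
    show "tsum (Apow A 1) (\<lambda>l. tsum (MA A N 0) (\<lambda>(y, bs). pure (MA A N 0) (y, map2 (*) bs (butlast l)))
         (f (pure (AM A 0 M) ([], act M (last l) m)))) (pure (Apow A 1) [a]) =
      pure (MA A N 0) (deg0 f (act M a m), [])"
      by (rule right_action_0[of "\<lambda>b. f (pure (AM A 0 M) ([], act M b m))" "\<lambda>b. deg0 f (act M b m)"])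
        (simp_all add: p m yd_act_in M lin_on_comp[OF p(1) yd_act_lin_alg[OF M m]])
  qed
  show ?thesis
    unfolding d_m_def add_0 sum_atMost_1 0 1
    by (simp add: sgn_scale_def lift_minus)
      (rule lift_cong[OF absorbs_AM[OF vM]], auto simp: gens_AM_1 p yd_act_in M N vN
        lin_on_diff[OF pure_MA_0_lin[OF vN]])
qed

text \<open>The Hochschild differential of \<open>\<omega>\<close>, viewed as a one-cochain of
  \<open>A\<close> with values in \<open>Hom(M, N)\<close>.\<close>

lemma d_m_10:
  assumes f: "f \<in> Yhom A M N 1 0"
  shows "d_m A M N 1 0 f = lift (AM A 2 M) (\<lambda>(as, m). pure (MA A N 0)
    (act N (as ! 0) (omega f (as ! 1) m) - omega f (as ! 0 * as ! 1) m + omega f (as ! 0) (act M (as ! 1) m), []))"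
proof -
  note o = omega_pure[OF f]
  have 0: "b_map A M N 1 0 0 f = lift (AM A 2 M) (\<lambda>(as, m). pure (MA A N 0) (act N (as ! 0) (omega f (as ! 1) m), []))"
    unfolding b_map_def add_0 one_add_one
    by (rule lift_cong[OF absorbs_AM[OF vM]])
      (auto simp: gens_AM_2 o left_action_0 nth_pair_1)
  have 1: "b_map A M N 1 0 1 f = lift (AM A 2 M) (\<lambda>(as, m). pure (MA A N 0) (omega f (as ! 0 * as ! 1) m, []))"
    unfolding b_map_def add_0 one_add_one
    by (rule lift_cong[OF absorbs_AM[OF vM]])
      (auto simp: gens_AM_2 o nth_pair_1)
  have 2: "b_map A M N 1 0 2 f = lift (AM A 2 M) (\<lambda>(as, m). pure (MA A N 0) (omega f (as ! 0) (act M (as ! 1) m), []))"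
    unfolding b_map_def add_0 one_add_one
  proof (rule lift_cong[OF absorbs_AM[OF vM]], unfold gens_AM_2, elim bexE exE, simp add: nth_pair_1)
    fix m a b assume m: "m \<in> space M"
    show "tsum (Apow A 1) (\<lambda>l. tsum (MA A N 0) (\<lambda>(y, bs). pure (MA A N 0) (y, map2 (*) bs (butlast l)))
         (f (pure (AM A 1 M) ([a], act M (last l) m)))) (pure (Apow A 1) [b]) =
      pure (MA A N 0) (omega f a (act M b m), [])"
      by (intro right_action_0[of "\<lambda>b. f (pure (AM A 1 M) ([a], act M b m))" "\<lambda>b. omega f a (act M b m)"])
        (simp_all add: o m yd_act_in M lin_on_comp[OF omega_lin[OF f] yd_act_lin_alg[OF M m]])
  qed
  note l = pure_MA_0_lin[OF vN]
  show ?thesis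
    unfolding d_m_def one_add_one sum_atMost_2 0 1 2
    by (simp add: sgn_scale_def lift_minus lift_plus)
      (rule lift_cong[OF absorbs_AM[OF vM]], auto simp: gens_AM_2 o(2) nth_pair_1 yd_act_in M N vN vsub_diff
        lin_on_diff[OF l] lin_on_add[OF l])
qed

lemma d_m_01:
  assumes f: "f \<in> Yhom A M N 0 1"
  shows "d_m A M N 0 1 f = lift (AM A 1 M) (\<lambda>(as, m).
    sd (hd as) (\<lambda>b c. ev N (theta f m) (\<lambda>y u. pure (MA A N 1) (act N b y, [c * u]))) -
    sd (hd as) (\<lambda>b c. ev N (theta f (act M c m)) (\<lambda>y u. pure (MA A N 1) (y, [u * b]))))"
proof -
  have t: "f (pure (AM A 0 M) ([], m)) = theta f m" "theta f m \<in> tens N" if "m \<in> space M" for m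
    using that by (simp_all add: theta_def Yhom_in[OF f] pure_AM_in)
  have 0: "b_map A M N 0 1 0 f = lift (AM A 1 M) (\<lambda>(as, m).
    sd (hd as) (\<lambda>b c. ev N (theta f m) (\<lambda>y u. pure (MA A N 1) (act N b y, [c * u]))))"
    unfolding b_map_def add_0 one_add_one sd_def ev_def
    by (rule lift_cong[OF absorbs_AM[OF vM]])
      (auto simp: gens_AM_1 gens_Apow_2 gens_MA_1 t icomult_1 nth_pair_1 comult_in
        intro!: tsum_cong absorbs_A2 absorbs_MA vN)
  have 1: "b_map A M N 0 1 1 f = lift (AM A 1 M) (\<lambda>(as, m).
    sd (hd as) (\<lambda>b c. ev N (theta f (act M c m)) (\<lambda>y u. pure (MA A N 1) (y, [u * b]))))"
    unfolding b_map_def add_0 one_add_one sd_def ev_def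
    by (rule lift_cong[OF absorbs_AM[OF vM]])
      (auto simp: gens_AM_1 gens_Apow_2 gens_MA_1 t icomult_1 nth_pair_1 comult_in yd_act_in M
        intro!: tsum_cong absorbs_A2 absorbs_MA vN)
  show ?thesis
    unfolding d_m_def add_0 sum_atMost_1 0 1
    by (simp add: sgn_scale_def lift_minus case_prod_unfold)
qed

lemma lin_rho_pure:
  "lin_on (space N) (scale N) fscale (\<lambda>y. rho N y (\<lambda>z v. pure (MA A N 1) (z, [v * b])))"
proof (rule lin_on_components)
  fix \<beta>
  have "lin_on (space N) (scale N) (*) (\<lambda>y. rho N y (\<lambda>z v. \<beta> (z, [v * b])))" if "\<beta> \<in> forms (MA A N 1)"
    by (rule rho_lin[OF N bil_mult_right[OF form_bil[OF that]]])
  thus "lin_on (space N) (scale N) (*) (\<lambda>y. rho N y (\<lambda>z v. pure (MA A N 1) (z, [v * b])) \<beta>)"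
    by (cases "\<beta> \<in> forms (MA A N 1)") (simp_all add: ev_def tsum_apply pure_def tsum_zero lin_on_def)
qed

lemma coact_0:
  assumes "y \<in> space N"
  shows "tsum (MA A N 0) (\<lambda>(y, bs). tsum (MA A N 1)
         (\<lambda>(y\<^sub>0, u). pure (MA A N 1) (y\<^sub>0, (u ! 0 * b) # bs)) (coact N y)) (pure (MA A N 0) (y, [])) =
    rho N y (\<lambda>z v. pure (MA A N 1) (z, [v * b]))"
proof -
  have 1: "tsum (MA A N 1) (\<lambda>(y\<^sub>0, u). pure (MA A N 1) (y\<^sub>0, [u ! 0 * b])) (coact N y) =
    rho N y (\<lambda>z v. pure (MA A N 1) (z, [v * b]))" for y
    by (simp add: ev_def case_prod_unfold)
  show ?thesis by (subst tsum_MA_0[OF vN assms]) (simp_all add: 1 lin_rho_pure)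
qed

lemma append_0:
  assumes "y \<in> space N"
  shows "tsum (MA A N 0) (\<lambda>(y, bs). pure (MA A N 1) (y, bs @ [b])) (pure (MA A N 0) (y, [])) =
    pure (MA A N 1) (y, [b])"
  by (subst tsum_MA_0[OF vN assms]) (simp_all add: pure_MA_1_lin[OF vN])

lemma d_c_00:
  assumes f: "f \<in> Yhom A M N 0 0"
  shows "d_c A M N 0 0 f = lift (AM A 0 M) (\<lambda>(as, m).
    coact N (deg0 f m) - rho M m (\<lambda>x u. pure (MA A N 1) (deg0 f x, [u])))"
proof -
  note p = deg0_lin[OF f]
  have 0: "c_map A M N 0 0 0 f = lift (AM A 0 M) (\<lambda>(as, m). coact N (deg0 f m))"
    unfolding c_map_def add_0
    by (rule lift_cong[OF absorbs_AM[OF vM]])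
      (auto simp: gens_AM_0 p coact_0[where b = 1, simplified] rho_pure vN yd_coact_in N)
  have 1: "c_map A M N 0 0 1 f = lift (AM A 0 M) (\<lambda>(as, m). rho M m (\<lambda>x u. pure (MA A N 1) (deg0 f x, [u])))"
    unfolding c_map_def add_0 ev_def
    by (rule lift_cong[OF absorbs_AM[OF vM]])
      (auto simp: gens_AM_0 gens_MA_1 p append_0 yd_coact_in M intro!: tsum_cong absorbs_MA vM)
  show ?thesis
    unfolding d_c_def add_0 sum_atMost_1 0 1
    by (simp add: sgn_scale_def lift_minus case_prod_unfold)
qed

lemma d_c_10:
  assumes f: "f \<in> Yhom A M N 1 0"
  shows "d_c A M N 1 0 f = lift (AM A 1 M) (\<lambda>(as, m).
    sd (hd as) (\<lambda>b c. rho N (omega f c m) (\<lambda>y u. pure (MA A N 1) (y, [u * b]))) -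
    sd (hd as) (\<lambda>b c. rho M m (\<lambda>x u. pure (MA A N 1) (omega f b x, [c * u]))))"
proof -
  note o = omega_pure[OF f]
  have 0: "c_map A M N 1 0 0 f = lift (AM A 1 M) (\<lambda>(as, m).
    sd (hd as) (\<lambda>b c. rho N (omega f c m) (\<lambda>y u. pure (MA A N 1) (y, [u * b]))))"
    unfolding c_map_def add_0 sd_def
    by (rule lift_cong[OF absorbs_AM[OF vM]]) (auto simp: gens_AM_1 o coact_0)
  have 1: "c_map A M N 1 0 1 f = lift (AM A 1 M) (\<lambda>(as, m).
    sd (hd as) (\<lambda>b c. rho M m (\<lambda>x u. pure (MA A N 1) (omega f b x, [c * u]))))"
    unfolding c_map_def add_0 sd_def ev_def
    by (rule lift_cong[OF absorbs_AM[OF vM]])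
      (auto simp: gens_AM_1 gens_MA_1 gens_Apow_2 o append_0 yd_coact_in M comult_in
        intro!: tsum_cong absorbs_MA absorbs_A2 vM)
  show ?thesis
    unfolding d_c_def add_0 sum_atMost_1 0 1
    by (simp add: sgn_scale_def lift_minus case_prod_unfold)
qed

text \<open>The comodule counterpart of \<open>d_m_10\<close>: the coaction of \<open>N\<close>
  after \<open>\<theta>\<close>, the comultiplication, and the coaction of \<open>M\<close> before
  \<open>\<theta>\<close>, with alternating signs.\<close>

lemma d_c_01:
  assumes f: "f \<in> Yhom A M N 0 1"
  shows "d_c A M N 0 1 f = lift (AM A 0 M) (\<lambda>(as, m).
    ev N (theta f m) (\<lambda>y u. rho N y (\<lambda>z v. pure (MA A N 2) (z, [v, u]))) -
    ev N (theta f m) (\<lambda>y u. sd u (\<lambda>b c. pure (MA A N 2) (y, [b, c]))) +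
    rho M m (\<lambda>x u. ev N (theta f x) (\<lambda>z v. pure (MA A N 2) (z, [v, u]))))"
proof -
  have t: "f (pure (AM A 0 M) ([], m)) = theta f m" "theta f m \<in> tens N" if "m \<in> space M" for m
    using that by (simp_all add: theta_def Yhom_in[OF f] pure_AM_in)
  have 0: "c_map A M N 0 1 0 f = lift (AM A 0 M) (\<lambda>(as, m).
     ev N (theta f m) (\<lambda>y u. rho N y (\<lambda>z v. pure (MA A N 2) (z, [v, u]))))"
    unfolding c_map_def one_add_one ev_def
    by (rule lift_cong[OF absorbs_AM[OF vM]])
      (auto simp: gens_AM_0 gens_MA_1 t case_prod_unfold yd_coact_in N intro!: tsum_cong absorbs_MA vN)
  have 1: "c_map A M N 0 1 1 f = lift (AM A 0 M) (\<lambda>(as, m).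
     ev N (theta f m) (\<lambda>y u. sd u (\<lambda>b c. pure (MA A N 2) (y, [b, c]))))"
    unfolding c_map_def one_add_one ev_def sd_def
    by (rule lift_cong[OF absorbs_AM[OF vM]])
      (auto simp: gens_AM_0 gens_MA_1 gens_Apow_2 t case_prod_unfold comult_in intro!: tsum_cong absorbs_MA absorbs_A2 vN)
  have 2: "c_map A M N 0 1 2 f = lift (AM A 0 M) (\<lambda>(as, m).
     rho M m (\<lambda>x u. ev N (theta f x) (\<lambda>z v. pure (MA A N 2) (z, [v, u]))))"
    unfolding c_map_def one_add_one ev_def
    by (rule lift_cong[OF absorbs_AM[OF vM]])
      (auto simp: gens_AM_0 gens_MA_1 t case_prod_unfold yd_coact_in M intro!: tsum_cong absorbs_MA vN vM)
  show ?thesis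
    unfolding d_c_def one_add_one sum_atMost_2 0 1 2
    by (simp add: sgn_scale_def lift_minus lift_plus case_prod_unfold)
qed

section \<open>Cocycles and coboundaries of degree one\<close>

lemma ball_gens_AM_0: "(\<forall>x\<in>gens (AM A 0 M). Q x) \<longleftrightarrow> (\<forall>m\<in>space M. Q ([], m))"
  and ball_gens_AM_1: "(\<forall>x\<in>gens (AM A 1 M). Q x) \<longleftrightarrow> (\<forall>a. \<forall>m\<in>space M. Q ([a], m))"
  and ball_gens_AM_2: "(\<forall>x\<in>gens (AM A 2 M). Q x) \<longleftrightarrow> (\<forall>a b. \<forall>m\<in>space M. Q ([a, b], m))"
  unfolding Ball_def gens_AM_0 gens_AM_1 gens_AM_2 by blast+

lemma pure_MA_0_eq_0_iff:
  assumes "x \<in> space N"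
  shows "pure (MA A N 0) (x, []) = 0 \<longleftrightarrow> x = 0"
proof -
  have "pure (MA A N 0) (0, []) = 0"
    using lin_on_0[OF pure_MA_0_lin[OF vN] vsub_0[OF vN]] .
  thus ?thesis using un0_pure[OF vN assms] un0_pure[OF vN vsub_0[OF vN]] by auto
qed

text \<open>A lift vanishes exactly when its summand does on generators, provided that the summand
  is multilinear; this is the purpose of the linearity checks for \<open>?e\<close>.\<close>

lemma d_m_10_eq_0_iff:
  assumes f: "f \<in> Yhom A M N 1 0" and d: "datum M N \<theta> (omega f)"
  shows "d_m A M N 1 0 f = 0 \<longleftrightarrow>
    (\<forall>a b. \<forall>m\<in>space M. omega f (a * b) m = act N a (omega f b m) + omega f a (act M b m))"
proof -
  let ?\<omega> = "omega f"
  let ?e = "\<lambda>a b m. act N a (?\<omega> b m) - ?\<omega> (a * b) m + ?\<omega> a (act M b m)"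
  interpret Nv: vector_space "scale N" using vN by (simp add: vsub_def)
  have e_in: "?e a b m \<in> space N" if "m \<in> space M" for a b m
    using that by (simp add: vsub_add vsub_diff vN yd_act_in M N datumD[OF d])
  note w = lin_on_add[OF datumD(4)[OF d]] lin_on_scale[OF datumD(4)[OF d]]
    lin_on_add[OF datumD(5)[OF d]] lin_on_scale[OF datumD(5)[OF d]]
    lin_on_add[OF yd_act_lin[OF N]] lin_on_scale[OF yd_act_lin[OF N]]
    lin_on_add[OF yd_act_lin_alg[OF N]] lin_on_scale[OF yd_act_lin_alg[OF N]]
    lin_on_add[OF yd_act_lin[OF M]] lin_on_scale[OF yd_act_lin[OF M]]
    lin_on_add[OF yd_act_lin_alg[OF M]] lin_on_scale[OF yd_act_lin_alg[OF M]]
  have 1: "lin_on (space M) (scale M) (scale N) (?e a b)" for a b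
    by (simp add: lin_on_def w datumD(3)[OF d] yd_act_in M N
        Nv.scale_right_distrib Nv.scale_right_diff_distrib algebra_simps)
  have 2: "lin_on UNIV (bscale A) (scale N) (\<lambda>a. ?e a b m)" "lin_on UNIV (bscale A) (scale N) (\<lambda>b. ?e a b m)"
    if "m \<in> space M" for a b m
    using that by (simp_all add: lin_on_def w datumD(3)[OF d] yd_act_in M N A_mult distrib_right distrib_left
        Nv.scale_right_distrib Nv.scale_right_diff_distrib)
  have l: "multilinear (AM A 2 M) (\<lambda>(as, m). pure (MA A N 0) (?e (as ! 0) (as ! 1) m, []))"
    using lin_on_comp[OF pure_MA_0_lin[OF vN] 1] lin_on_comp[OF pure_MA_0_lin[OF vN] 2(1)]
      lin_on_comp[OF pure_MA_0_lin[OF vN] 2(2)]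
    by (intro multilinear_AM_2 vM) (simp_all add: e_in nth_pair_1)
  have "x - y + z = (x + z) - y" for x y z :: 'n by simp
  hence "x - y + z = 0 \<longleftrightarrow> y = x + z" for x y z :: 'n by (auto simp only: right_minus_eq)
  thus ?thesis
    unfolding d_m_10[OF f] lift_eq_0_iff[OF absorbs_AM[OF vM] l] ball_gens_AM_2
    by (simp add: nth_pair_1 pure_MA_0_eq_0_iff e_in)
qed

text \<open>Bilinear test functions separate tensors, so linearity of a tensor-valued map can be
  checked after evaluation.\<close>

lemma tensor_lin:
  assumes "\<And>x. x \<in> S \<Longrightarrow> g x \<in> tens N" "\<And>x y. x \<in> S \<Longrightarrow> y \<in> S \<Longrightarrow> x + y \<in> S" "\<And>c x. x \<in> S \<Longrightarrow> s c x \<in> S"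
    "\<And>G. bil N G \<Longrightarrow> lin_on S s (*) (\<lambda>x. ev N (g x) G)"
  shows "lin_on S s fscale g"
  unfolding lin_on_def
proof (intro conjI ballI allI; rule ev_eqI[OF vN])
  fix x y G assume "x \<in> S" "y \<in> S" "bil N G"
  thus "ev N (g (x + y)) G = ev N (g x + g y) G"
    using lin_on_add[OF assms(4)[OF \<open>bil N G\<close>]] by (simp add: ev_add vN assms)
next
  fix c x G assume "x \<in> S" "bil N G"
  thus "ev N (g (s c x)) G = ev N (fscale c (g x)) G"
    using lin_on_scale[OF assms(4)[OF \<open>bil N G\<close>]] by (simp add: ev_scale vN assms)
qed (auto intro: assms tspace_add tspace_scale)

lemma compat_eq_0_iff:
  assumes f: "f \<in> Yhom A M N 0 1" and g: "g \<in> Yhom A M N 1 0"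
  shows "d_m A M N 0 1 f - d_c A M N 1 0 g = 0 \<longleftrightarrow>
     (\<forall>a. \<forall>m\<in>space M. \<forall>G::'n \<Rightarrow> 'a \<Rightarrow> 'k. bil N G \<longrightarrow>
        sd a (\<lambda>b c. ev N (theta f (act M c m)) (\<lambda>y u. G y (u * b))) +
        sd a (\<lambda>b c. rho N (omega g c m) (\<lambda>y u. G y (u * b))) =
        sd a (\<lambda>b c. ev N (theta f m) (\<lambda>y u. G (act N b y) (c * u))) +
        sd a (\<lambda>b c. rho M m (\<lambda>x u. G (omega g b x) (c * u))))"
proof -
  let ?\<theta> = "theta f" and ?\<omega> = "omega g"
  note d = datum_theta_omega[OF f g]
  \<comment> \<open>\<open>t3 - t1\<close> is the differential of \<open>\<theta>\<close> and
    \<open>t2 - t4\<close> that of \<open>\<omega>\<close>; equality of the two is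
    \<open>t1 + t2 = t3 + t4\<close>, the sign-free form used in \<open>cocycle\<close>.\<close>
  define t1 t2 t3 t4 where "t1 a m = sd a (\<lambda>b c. ev N (?\<theta> (act M c m)) (\<lambda>y u. pure (MA A N 1) (y, [u * b])))"
    and "t2 a m = sd a (\<lambda>b c. rho N (?\<omega> c m) (\<lambda>y u. pure (MA A N 1) (y, [u * b])))"
    and "t3 a m = sd a (\<lambda>b c. ev N (?\<theta> m) (\<lambda>y u. pure (MA A N 1) (act N b y, [c * u])))"
    and "t4 a m = sd a (\<lambda>b c. rho M m (\<lambda>x u. pure (MA A N 1) (?\<omega> b x, [c * u])))"
    for a m
  have eq: "d_m A M N 0 1 f - d_c A M N 1 0 g =
    lift (AM A 1 M) (\<lambda>(as, m). (t3 (hd as) m - t1 (hd as) m) - (t2 (hd as) m - t4 (hd as) m))"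
    unfolding d_m_01[OF f] d_c_10[OF g] lift_minus t1_def t2_def t3_def t4_def
    by (simp add: case_prod_unfold)
  have in0: "ev N (?\<theta> (act M c m)) (\<lambda>y u. pure (MA A N 1) (y, [u * b])) \<in> tens N"
    "rho N (?\<omega> c m) (\<lambda>y u. pure (MA A N 1) (y, [u * b])) \<in> tens N"
    "ev N (?\<theta> m) (\<lambda>y u. pure (MA A N 1) (act N b y, [c * u])) \<in> tens N"
    "rho M m (\<lambda>x u. pure (MA A N 1) (?\<omega> b x, [c * u])) \<in> tens N"
    if "m \<in> space M" for b c m
    by (intro push_in; use that in \<open>simp add: vN vM datumD[OF d] yd_act_in yd_coact_in M N\<close>)+
  have t_in: "t1 a m \<in> tens N" "t2 a m \<in> tens N" "t3 a m \<in> tens N" "t4 a m \<in> tens N"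
    if "m \<in> space M" for a m
    unfolding t1_def t2_def t3_def t4_def by (intro sd_in_tspace in0 that)+
  have ev_t: "ev N (t1 a m) G = sd a (\<lambda>b c. ev N (?\<theta> (act M c m)) (\<lambda>y u. G y (u * b)))"
    "ev N (t2 a m) G = sd a (\<lambda>b c. rho N (?\<omega> c m) (\<lambda>y u. G y (u * b)))"
    "ev N (t3 a m) G = sd a (\<lambda>b c. ev N (?\<theta> m) (\<lambda>y u. G (act N b y) (c * u)))"
    "ev N (t4 a m) G = sd a (\<lambda>b c. rho M m (\<lambda>x u. G (?\<omega> b x) (c * u)))"
    if "m \<in> space M" "bil N G" for a m and G :: "_ \<Rightarrow> _ \<Rightarrow> 'k"
    using that unfolding t1_def t2_def t3_def t4_def
    by (simp_all add: ev_sd ev_push vN vM in0 datumD[OF d] yd_act_in yd_coact_in M N)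
  have lin_m: "lin_on (space M) (scale M) (*) (\<lambda>m. ev N (t a m) G)"
    if "bil N G" "t \<in> {t1, t2, t3, t4}" for t a G
  proof -
    have 1: "lin_on (space M) (scale M) (*) (\<lambda>m. ev N (?\<theta> m) H)" if "bil N H" for H
      by (rule lin_on_comp[OF ev_lin[OF vN that] datumD(2)[OF d] datumD(1)[OF d]])
    have 2: "lin_on (space M) (scale M) (*) (\<lambda>m. rho N (?\<omega> c m) H)" if "bil N H" for H c
      by (rule lin_on_comp[OF rho_lin[OF N that] datumD(4)[OF d] datumD(3)[OF d]])
    have 3: "lin_on (space M) (scale M) (*) (\<lambda>m. ev N (?\<theta> (act M c m)) H)" if "bil N H" for H c
      by (rule lin_on_comp[OF 1[OF that] yd_act_lin[OF M] yd_act_in[OF M]])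
    have 4: "bil M (\<lambda>x u. G (?\<omega> b x) (c * u))" for b c
      by (rule bil_comp[OF bil_mult_left[OF that(1)] datumD(4)[OF d] datumD(3)[OF d]])
    have "lin_on (space M) (scale M) (*) (\<lambda>m. sd a (\<lambda>b c. ev N (?\<theta> (act M c m)) (\<lambda>y u. G y (u * b))))"
      "lin_on (space M) (scale M) (*) (\<lambda>m. sd a (\<lambda>b c. rho N (?\<omega> c m) (\<lambda>y u. G y (u * b))))"
      "lin_on (space M) (scale M) (*) (\<lambda>m. sd a (\<lambda>b c. ev N (?\<theta> m) (\<lambda>y u. G (act N b y) (c * u))))"
      "lin_on (space M) (scale M) (*) (\<lambda>m. sd a (\<lambda>b c. rho M m (\<lambda>x u. G (?\<omega> b x) (c * u))))"
      by (intro sd_param_sub vM 1 2 3 bil_mult_right bil_act[OF N bil_mult_left] rho_lin[OF M 4] that(1))+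
    thus ?thesis using that by (auto simp: lin_on_def ev_t vsub_add vsub_scale vM)
  qed
  \<comment> \<open>\<open>a\<close> enters through its comultiplication, so linearity in
    \<open>a\<close> asks that each summand be bilinear in the pair \<open>b\<close>,
    \<open>c\<close>.\<close>
  have lin_a: "lin_on UNIV (bscale A) (*) (\<lambda>a. ev N (t a m) G)"
    if "bil N G" "t \<in> {t1, t2, t3, t4}" and m: "m \<in> space M" for t m G
  proof -
    note G1 = bilD1[OF that(1)] and G2 = bilD2[OF that(1)]
    have Gr: "lin_on UNIV (bscale A) (*) (\<lambda>b. G y (u * b))" if "y \<in> space N" for y u
      by (rule lin_on_UNIV_comp[OF G1[OF that] mult_lin(2)])
    have Gl: "lin_on UNIV (bscale A) (*) (\<lambda>b. G y (b * u))" if "y \<in> space N" for y u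
      by (rule lin_on_UNIV_comp[OF G1[OF that] mult_lin(1)])
    have 1: "lin_on UNIV (bscale A) (*) (\<lambda>c. ev N (?\<theta> (act M c m)) H)" if "bil N H" for H
      by (rule lin_on_comp[OF lin_on_comp[OF ev_lin[OF vN that] datumD(2)[OF d] datumD(1)[OF d]] yd_act_lin_alg[OF M m]])
        (simp_all add: yd_act_in M m)
    have 2: "lin_on UNIV (bscale A) (*) (\<lambda>c. rho N (?\<omega> c m) H)" if "bil N H" for H
      by (rule lin_on_comp[OF rho_lin[OF N that] datumD(5)[OF d m] datumD(3)[OF d m]])
    have 3: "lin_on UNIV (bscale A) (*) (\<lambda>b. G (act N b y) u)" if "y \<in> space N" for y u
      by (rule lin_on_comp[OF G2 yd_act_lin_alg[OF N that] yd_act_in[OF N that]])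
    have 4: "lin_on UNIV (bscale A) (*) (\<lambda>b. G (?\<omega> b x) u)" if "x \<in> space M" for x u
      by (rule lin_on_comp[OF G2 datumD(5)[OF d that] datumD(3)[OF d that]])
    have "bilA (\<lambda>b c. ev N (?\<theta> (act M c m)) (\<lambda>y u. G y (u * b)))"
      unfolding bilA_def
      by (intro conjI allI 1 bil_mult_right that ev_param_UNIV vN Gr datumD(1)[OF d] yd_act_in M m)
    moreover have "bilA (\<lambda>b c. rho N (?\<omega> c m) (\<lambda>y u. G y (u * b)))"
      unfolding bilA_def
      by (intro conjI allI 2 bil_mult_right that ev_param_UNIV vN Gr datumD(3)[OF d] yd_coact_in N m)
    moreover have "bilA (\<lambda>b c. ev N (?\<theta> m) (\<lambda>y u. G (act N b y) (c * u)))"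
      unfolding bilA_def
      by (intro conjI allI ev_param_UNIV vN Gl 3 datumD(1)[OF d] yd_act_in N m)
    moreover have "bilA (\<lambda>b c. rho M m (\<lambda>x u. G (?\<omega> b x) (c * u)))"
      unfolding bilA_def
      by (intro conjI allI ev_param_UNIV vM Gl 4 datumD(3)[OF d] yd_coact_in M m)
    ultimately show ?thesis using that by (auto simp: ev_t intro: sd_lin)
  qed
  let ?g = "\<lambda>(as, m). (t3 (hd as) m - t1 (hd as) m) - (t2 (hd as) m - t4 (hd as) m)"
  have l: "multilinear (AM A 1 M) ?g"
  proof (rule multilinear_AM_1[OF vM]; simp; rule tensor_lin)
    fix a G assume "bil N (G :: 'n \<Rightarrow> 'a \<Rightarrow> 'k)"
    hence "lin_on (space M) (scale M) (*)
        (\<lambda>m. (ev N (t3 a m) G - ev N (t1 a m) G) - (ev N (t2 a m) G - ev N (t4 a m) G))"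
      by (intro lin_on_minus_fun lin_m) auto
    thus "lin_on (space M) (scale M) (*) (\<lambda>m. ev N (t3 a m - t1 a m - (t2 a m - t4 a m)) G)"
      using \<open>bil N G\<close> by (simp add: lin_on_def ev_diff vN t_in tspace_diff vsub_add vsub_scale vM)
  next
    fix m G assume m: "m \<in> space M" and "bil N (G :: 'n \<Rightarrow> 'a \<Rightarrow> 'k)"
    hence "lin_on UNIV (bscale A) (*)
        (\<lambda>a. (ev N (t3 a m) G - ev N (t1 a m) G) - (ev N (t2 a m) G - ev N (t4 a m) G))"
      by (intro lin_on_minus_fun lin_a) auto
    thus "lin_on UNIV (bscale A) (*) (\<lambda>a. ev N (t3 a m - t1 a m - (t2 a m - t4 a m)) G)"
      using \<open>bil N G\<close> m by (simp add: lin_on_def ev_diff vN t_in tspace_diff)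
  qed (auto simp: t_in tspace_diff vsub_add vsub_scale vM)
  have "t3 a m - t1 a m - (t2 a m - t4 a m) = 0 \<longleftrightarrow> (\<forall>G. bil N G \<longrightarrow>
      ev N (t1 a m) G + ev N (t2 a m) G = ev N (t3 a m) G + ev N (t4 a m) G)" if m: "m \<in> space M" for a m
  proof -
    have "t3 a m - t1 a m - (t2 a m - t4 a m) = 0 \<longleftrightarrow> t1 a m + t2 a m = t3 a m + t4 a m"
      by (auto simp: algebra_simps)
    also have "\<dots> \<longleftrightarrow> (\<forall>G. bil N G \<longrightarrow>
      ev N (t1 a m) G + ev N (t2 a m) G = ev N (t3 a m) G + ev N (t4 a m) G)"
      by (subst tensor_eq_iff_ev) (auto simp: vN t_in m tspace_add ev_add)
    finally show ?thesis .
  qed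
  thus ?thesis
    unfolding eq lift_eq_0_iff[OF absorbs_AM[OF vM] l] ball_gens_AM_1 by (auto simp: ev_t)
qed

lemma d_c_01_eq_0_iff:
  assumes f: "f \<in> Yhom A M N 0 1" and d: "datum M N (theta f) \<omega>"
  shows "d_c A M N 0 1 f = 0 \<longleftrightarrow> (\<forall>m\<in>space M. \<forall>G::'n \<Rightarrow> 'a \<Rightarrow> 'a \<Rightarrow> 'k. tril N G \<longrightarrow>
        ev N (theta f m) (\<lambda>y u. rho N y (\<lambda>z v. G z v u)) + rho M m (\<lambda>x u. ev N (theta f x) (\<lambda>z v. G z v u)) =
        ev N (theta f m) (\<lambda>y u. sd u (G y)))"
proof -
  let ?\<theta> = "theta f"
  \<comment> \<open>The value of the differential at \<open>m\<close>, with a trilinear function in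
    place of a form on \<open>N \<otimes> A \<otimes> A\<close>.\<close>
  define K where "K m G = ev N (?\<theta> m) (\<lambda>y u. rho N y (\<lambda>z v. G z v u)) - ev N (?\<theta> m) (\<lambda>y u. sd u (G y)) +
    rho M m (\<lambda>x u. ev N (?\<theta> x) (\<lambda>z v. G z v u))" for m and G :: "'n \<Rightarrow> 'a \<Rightarrow> 'a \<Rightarrow> 'k"
  define g where "g m = ev N (?\<theta> m) (\<lambda>y u. rho N y (\<lambda>z v. pure (MA A N 2) (z, [v, u]))) -
    ev N (?\<theta> m) (\<lambda>y u. sd u (\<lambda>b c. pure (MA A N 2) (y, [b, c]))) +
    rho M m (\<lambda>x u. ev N (?\<theta> x) (\<lambda>z v. pure (MA A N 2) (z, [v, u])))" for m
  have g1: "g m \<beta> = K m (\<lambda>y u v. \<beta> (y, [u, v]))" if "\<beta> \<in> forms (MA A N 2)" for m \<beta>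
    unfolding g_def K_def by (simp add: ev_def sd_def tsum_apply pure_def that)
  have g0: "g m \<beta> = 0" if "\<beta> \<notin> forms (MA A N 2)" for m \<beta>
    unfolding g_def by (simp add: ev_def sd_def tsum_apply pure_def that tsum_zero)
  \<comment> \<open>The form that represents a test function agrees with it only over
    \<open>space N\<close>, so the values of \<open>G\<close> elsewhere must not matter.\<close>
  have K_cong: "K m G = K m H" if "m \<in> space M" "\<And>y u v. y \<in> space N \<Longrightarrow> G y u v = H y u v" for m G H
  proof -
    have "(\<lambda>u. sd u (G y)) = (\<lambda>u. sd u (H y))" if "y \<in> space N" for y
      using \<open>\<And>y u v. y \<in> space N \<Longrightarrow> G y u v = H y u v\<close>[OF that] by presburger
    hence "ev N (?\<theta> m) (\<lambda>y u. sd u (G y)) = ev N (?\<theta> m) (\<lambda>y u. sd u (H y))"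
      by (intro ev_cong vN datumD(1)[OF d] that(1)) meson
    moreover have "ev N (?\<theta> m) (\<lambda>y u. rho N y (\<lambda>z v. G z v u)) = ev N (?\<theta> m) (\<lambda>y u. rho N y (\<lambda>z v. H z v u))"
      "rho M m (\<lambda>x u. ev N (?\<theta> x) (\<lambda>z v. G z v u)) = rho M m (\<lambda>x u. ev N (?\<theta> x) (\<lambda>z v. H z v u))"
      by (intro ev_cong vN vM yd_coact_in M N datumD(1)[OF d] that; assumption)+
    ultimately show ?thesis by (simp add: K_def)
  qed
  have K_lin: "lin_on (space M) (scale M) (*) (\<lambda>m. K m G)" if G: "tril N G" for G
  proof -
    have 1: "lin_on (space M) (scale M) (*) (\<lambda>m. ev N (?\<theta> m) H)" if "bil N H" for H
      by (rule lin_on_comp[OF ev_lin[OF vN that] datumD(2)[OF d] datumD(1)[OF d]])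
    show ?thesis
      unfolding K_def
      by (intro lin_on_plus lin_on_minus_fun 1 rho_lin[OF M] bil_rho_tril bil_sd_tril vN vM G
          yd_coact_in yd_coact_lin N datumD(1)[OF d] datumD(2)[OF d])
  qed
  have l: "multilinear (AM A 0 M) (\<lambda>(as, m). g m)"
  proof (rule multilinear_AM_0[OF vM], simp, rule lin_on_components)
    fix \<beta> show "lin_on (space M) (scale M) (*) (\<lambda>m. g m \<beta>)"
      using K_lin[OF form_tril[of \<beta> N]]
      by (cases "\<beta> \<in> forms (MA A N 2)") (simp_all add: g0 g1 lin_on_def)
  qed
  have "g m = 0 \<longleftrightarrow> (\<forall>G. tril N G \<longrightarrow> K m G = 0)" if m: "m \<in> space M" for m
  proof (intro iffI allI impI)
    fix G assume g: "g m = 0" and G: "tril N G"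
    obtain \<beta> where \<beta>: "\<beta> \<in> forms (MA A N 2)"
      "\<And>x. x \<in> gens (MA A N 2) \<Longrightarrow> \<beta> x = G (fst x) (snd x ! 0) (snd x ! 1)"
      using tril_form[OF vN G] by blast
    have "K m G = K m (\<lambda>y u v. \<beta> (y, [u, v]))"
      by (rule K_cong[OF m]) (simp add: \<beta>(2) gens_MA_2 nth_pair_1)
    thus "K m G = 0" using g1[OF \<beta>(1), of m] g by simp
  next
    assume K: "\<forall>G. tril N G \<longrightarrow> K m G = 0"
    show "g m = 0"
    proof
      fix \<beta> show "g m \<beta> = 0 \<beta>"
        using K form_tril[of \<beta> N] by (cases "\<beta> \<in> forms (MA A N 2)") (simp_all add: g0 g1)
    qed
  qed
  moreover have "d_c A M N 0 1 f = lift (AM A 0 M) (\<lambda>(as, m). g m)"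
    unfolding d_c_01[OF f] g_def by simp
  moreover have "K m G = 0 \<longleftrightarrow> ev N (?\<theta> m) (\<lambda>y u. rho N y (\<lambda>z v. G z v u)) +
     rho M m (\<lambda>x u. ev N (?\<theta> x) (\<lambda>z v. G z v u)) = ev N (?\<theta> m) (\<lambda>y u. sd u (G y))" for m G
    unfolding K_def by (auto simp: algebra_simps)
  ultimately show ?thesis
    using lift_eq_0_iff[OF absorbs_AM[OF vM] l] unfolding ball_gens_AM_0 by simp
qed

section \<open>Total degree one: cochains as pairs\<close>

lemma Tot_1D:
  assumes "F \<in> Tot A M N 1"
  shows "F 0 \<in> Yhom A M N 0 1" "F 1 \<in> Yhom A M N 1 0" "n > 1 \<Longrightarrow> F n = 0"
  using assms unfolding Tot_def by (force, force, simp)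

lemma Tot_1I:
  assumes "F 0 \<in> Yhom A M N 0 1" "F 1 \<in> Yhom A M N 1 0" "\<And>n. n > 1 \<Longrightarrow> F n = 0"
  shows "F \<in> Tot A M N 1"
proof -
  have "F n \<in> Yhom A M N n (1 - n)" if "n \<le> 1" for n
    using assms that by (cases "n = 0") (auto simp: le_eq_less_or_eq One_nat_def)
  thus ?thesis using assms(3) by (simp add: Tot_def)
qed

abbreviation "theta_of F \<equiv> theta (F 0)"
abbreviation "omega_of F \<equiv> omega (F 1)"

lemma Tot_datum: "F \<in> Tot A M N 1 \<Longrightarrow> datum M N (theta_of F) (omega_of F)"
  by (rule datum_theta_omega) (simp_all add: Tot_1D)

text \<open>The total differential has components \<open>d_c \<theta>\<close>,
  \<open>d_m \<theta> - d_c \<omega>\<close> and \<open>d_m \<omega>\<close> at positions 0, 1 and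
  2, one for each cocycle identity; the minus sign is the sign of \<open>d_c\<close> for
  \<open>n = 1\<close>.\<close>

lemma tot_d_1_eq_0_iff:
  assumes F: "F \<in> Tot A M N 1"
  shows "tot_d A M N 1 F = 0 \<longleftrightarrow> cocycle M N (theta_of F) (omega_of F)"
proof -
  have 0: "tot_d A M N 1 F 0 = d_c A M N 0 1 (F 0)"
    by (simp add: tot_d_def sgn_scale_def)
  have 1: "tot_d A M N 1 F 1 = d_m A M N 0 1 (F 0) - d_c A M N 1 0 (F 1)"
    by (simp add: tot_d_def sgn_scale_def)
  have 2: "tot_d A M N 1 F 2 = d_m A M N 1 0 (F 1)"
    by (simp add: tot_d_def One_nat_def)
  have 3: "tot_d A M N 1 F n = 0" if "n > 2" for n
    using that by (simp add: tot_d_def)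
  have "tot_d A M N 1 F = 0 \<longleftrightarrow> tot_d A M N 1 F 0 = 0 \<and> tot_d A M N 1 F 1 = 0 \<and> tot_d A M N 1 F 2 = 0"
    (is "?l \<longleftrightarrow> ?r")
  proof
    assume r: ?r
    show ?l
    proof
      fix n :: nat
      consider "n = 0" | "n = 1" | "n = 2" | "n > 2" by linarith
      thus "tot_d A M N 1 F n = 0 n" using r 3 by cases simp_all
    qed
  qed simp
  thus ?thesis
    unfolding 0 1 2 d_m_10_eq_0_iff[OF Tot_1D(2)[OF F] Tot_datum[OF F]]
      d_c_01_eq_0_iff[OF Tot_1D(1)[OF F] Tot_datum[OF F]]
      compat_eq_0_iff[OF Tot_1D(1)[OF F] Tot_1D(2)[OF F]] cocycle_def
    by blast
qed

text \<open>Inverse to \<open>F \<mapsto> (theta_of F, omega_of F)\<close>, for pairs considered on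
  \<open>space M\<close>; \<open>\<omega>\<close> is composed with the identification of
  \<open>N\<close> with \<open>N \<otimes> A^0\<close>.\<close>

definition cochain_of :: "('m \<Rightarrow> ('n \<times> 'a list, 'k) tensor) \<Rightarrow> ('a \<Rightarrow> 'm \<Rightarrow> 'n) \<Rightarrow> nat \<Rightarrow> ('m, 'n, 'a, 'k) ymap" where
  "cochain_of \<theta> \<omega> n = (if n = 0 then lift (AM A 0 M) (\<lambda>x. \<theta> (snd x))
     else if n = 1 then lift (AM A 1 M) (\<lambda>x. pure (MA A N 0) (\<omega> (hd (fst x)) (snd x), []))
     else 0)"

lemma cochain_of_multilinear:
  assumes d: "datum M N \<theta> \<omega>"
  shows "multilinear (AM A 0 M) (\<lambda>x. \<theta> (snd x))"
    "multilinear (AM A 1 M) (\<lambda>x. pure (MA A N 0) (\<omega> (hd (fst x)) (snd x), []))"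
proof -
  show "multilinear (AM A 0 M) (\<lambda>x. \<theta> (snd x))"
    by (rule multilinear_AM_0[OF vM]) (simp add: datumD[OF d])
  show "multilinear (AM A 1 M) (\<lambda>x. pure (MA A N 0) (\<omega> (hd (fst x)) (snd x), []))"
    by (rule multilinear_AM_1[OF vM])
      (simp_all add: lin_on_comp[OF pure_MA_0_lin[OF vN] datumD(4)[OF d]]
        lin_on_comp[OF pure_MA_0_lin[OF vN] datumD(5)[OF d]] datumD[OF d])
qed

lemma cochain_of_Tot:
  assumes d: "datum M N \<theta> \<omega>"
  shows "cochain_of \<theta> \<omega> \<in> Tot A M N 1"
    "m \<in> space M \<Longrightarrow> theta_of (cochain_of \<theta> \<omega>) m = \<theta> m" "m \<in> space M \<Longrightarrow> omega_of (cochain_of \<theta> \<omega>) a m = \<omega> a m"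
proof -
  note l = cochain_of_multilinear[OF d]
  show "cochain_of \<theta> \<omega> \<in> Tot A M N 1"
    by (rule Tot_1I)
      (auto simp: cochain_of_def gens_AM_0 gens_AM_1 datumD[OF d] intro!: lift_Yhom l vM pure_MA_0_in)
  show "m \<in> space M \<Longrightarrow> theta_of (cochain_of \<theta> \<omega>) m = \<theta> m"
    by (simp add: cochain_of_def theta_def lift_pure[OF absorbs_AM[OF vM] l(1)] gens_AM_0)
  show "m \<in> space M \<Longrightarrow> omega_of (cochain_of \<theta> \<omega>) a m = \<omega> a m"
    by (simp add: cochain_of_def omega_def lift_pure[OF absorbs_AM[OF vM] l(2)] gens_AM_1 un0_pure vN datumD[OF d])
qed

lemma cochain_of_cong:
  assumes "\<And>m. m \<in> space M \<Longrightarrow> \<theta> m = \<theta>' m" "\<And>a m. m \<in> space M \<Longrightarrow> \<omega> a m = \<omega>' a m"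
  shows "cochain_of \<theta> \<omega> = cochain_of \<theta>' \<omega>'"
proof -
  have "lift (AM A 0 M) (\<lambda>x. \<theta> (snd x)) = lift (AM A 0 M) (\<lambda>x. \<theta>' (snd x))"
    by (rule lift_cong[OF absorbs_AM[OF vM]]) (auto simp: gens_AM_0 assms)
  moreover have "lift (AM A 1 M) (\<lambda>x. pure (MA A N 0) (\<omega> (hd (fst x)) (snd x), [])) =
    lift (AM A 1 M) (\<lambda>x. pure (MA A N 0) (\<omega>' (hd (fst x)) (snd x), []))"
    by (rule lift_cong[OF absorbs_AM[OF vM]]) (auto simp: gens_AM_1 assms)
  ultimately show ?thesis by (simp add: cochain_of_def fun_eq_iff)
qed

lemma Tot_eq_cochain_of:
  assumes F: "F \<in> Tot A M N 1"
  shows "F = cochain_of (theta_of F) (omega_of F)"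
proof
  fix n :: nat
  consider "n = 0" | "n = 1" | "n > 1" by linarith
  thus "F n = cochain_of (theta_of F) (omega_of F) n"
  proof cases
    case 1
    have "F 0 = lift (AM A 0 M) (\<lambda>x. F 0 (pure (AM A 0 M) x))"
      by (rule Yhom_eq_lift[OF vM Tot_1D(1)[OF F]])
    also have "\<dots> = cochain_of (theta_of F) (omega_of F) 0"
      unfolding cochain_of_def by simp
        (rule lift_cong[OF absorbs_AM[OF vM]], auto simp: gens_AM_0 theta_def)
    finally show ?thesis by (simp add: 1)
  next
    case 2
    have "F 1 = lift (AM A 1 M) (\<lambda>x. F 1 (pure (AM A 1 M) x))"
      by (rule Yhom_eq_lift[OF vM Tot_1D(2)[OF F]])
    also have "\<dots> = cochain_of (theta_of F) (omega_of F) 1"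
      unfolding cochain_of_def by simp
        (rule lift_cong[OF absorbs_AM[OF vM]], auto simp: gens_AM_1 omega_pure[OF Tot_1D(2)[OF F]])
    finally show ?thesis by (simp add: 2)
  next
    case 3
    thus ?thesis by (simp add: cochain_of_def Tot_1D(3)[OF F])
  qed
qed

text \<open>With \<open>cob_omega\<close>, the coboundary of a map from \<open>M\<close> to
  \<open>N\<close> as a pair, before it is packed into a cochain.\<close>

definition cob_theta :: "('m \<Rightarrow> 'n) \<Rightarrow> 'm \<Rightarrow> ('n \<times> 'a list, 'k) tensor" where
  "cob_theta \<phi> m = coact N (\<phi> m) - rho M m (\<lambda>x u. pure (MA A N 1) (\<phi> x, [u]))"

definition cob_omega :: "('m \<Rightarrow> 'n) \<Rightarrow> 'a \<Rightarrow> 'm \<Rightarrow> 'n" where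
  "cob_omega \<phi> a m = act N a (\<phi> m) - \<phi> (act M a m)"

lemma tot_d_0:
  assumes H: "H \<in> Tot A M N 0"
  shows "tot_d A M N 0 H = cochain_of (cob_theta (deg0 (H 0))) (cob_omega (deg0 (H 0)))"
proof
  fix n :: nat
  have f: "H 0 \<in> Yhom A M N 0 0" using H by (simp add: Tot_def)
  consider "n = 0" | "n = 1" | "n > 1" by linarith
  thus "tot_d A M N 0 H n = cochain_of (cob_theta (deg0 (H 0))) (cob_omega (deg0 (H 0))) n"
    by cases (simp_all add: tot_d_def cochain_of_def sgn_scale_def d_c_00[OF f] d_m_00[OF f] cob_theta_def cob_omega_def
        case_prod_unfold)
qed

lemma coboundaries_1:
  "coboundaries A M N 1 = {cochain_of (cob_theta \<phi>) (cob_omega \<phi>) | \<phi>.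
     lin_on (space M) (scale M) (scale N) \<phi> \<and> (\<forall>m\<in>space M. \<phi> m \<in> space N)}" (is "_ = ?R")
proof -
  have "coboundaries A M N 1 = tot_d A M N 0 ` Tot A M N 0" by (simp add: coboundaries_def)
  also have "\<dots> = ?R"
  proof (intro equalityI subsetI)
    fix C assume "C \<in> tot_d A M N 0 ` Tot A M N 0"
    then obtain H where H: "H \<in> Tot A M N 0" "C = tot_d A M N 0 H" by blast
    have f: "H 0 \<in> Yhom A M N 0 0" using H by (simp add: Tot_def)
    show "C \<in> ?R" using H tot_d_0[OF H(1)] deg0_lin[OF f] by auto
  next
    fix C assume "C \<in> ?R"
    then obtain \<phi> where C: "C = cochain_of (cob_theta \<phi>) (cob_omega \<phi>)" and \<phi>: "lin_on (space M) (scale M) (scale N) \<phi>"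
      "\<And>m. m \<in> space M \<Longrightarrow> \<phi> m \<in> space N" by blast
    define h where "h = lift (AM A 0 M) (\<lambda>x. pure (MA A N 0) (\<phi> (snd x), []))"
    define H where "H n = (if n = 0 then h else 0)" for n :: nat
    have l: "multilinear (AM A 0 M) (\<lambda>x. pure (MA A N 0) (\<phi> (snd x), []))"
      by (rule multilinear_AM_0[OF vM]) (simp add: lin_on_comp[OF pure_MA_0_lin[OF vN] \<phi>])
    have "h \<in> Yhom A M N 0 0"
      unfolding h_def by (rule lift_Yhom[OF vM l]) (auto simp: gens_AM_0 \<phi> intro: pure_MA_0_in)
    hence H: "H \<in> Tot A M N 0" by (simp add: Tot_def H_def)
    have p: "deg0 (H 0) m = \<phi> m" if "m \<in> space M" for m
      using that by (simp add: deg0_def H_def h_def lift_pure[OF absorbs_AM[OF vM] l] gens_AM_0 un0_pure vN \<phi>)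
    have "rho M m (\<lambda>x u. pure (MA A N 1) (deg0 (H 0) x, [u])) = rho M m (\<lambda>x u. pure (MA A N 1) (\<phi> x, [u]))"
      if "m \<in> space M" for m
      by (rule ev_cong) (use that in \<open>simp_all add: vM yd_coact_in M p\<close>)
    hence "tot_d A M N 0 H = C"
      unfolding tot_d_0[OF H] C by (intro cochain_of_cong) (simp_all add: cob_theta_def cob_omega_def p yd_act_in M)
    thus "C \<in> tot_d A M N 0 ` Tot A M N 0" using H by blast
  qed
  finally show ?thesis .
qed

lemma cob_theta_in:
  assumes "\<And>m. m \<in> space M \<Longrightarrow> \<phi> m \<in> space N" "m \<in> space M"
  shows "cob_theta \<phi> m \<in> tens N"
  unfolding cob_theta_def by (intro tspace_diff push_in) (use assms in \<open>simp_all add: vM vN yd_coact_in M N\<close>)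

lemma ev_cob_theta:
  fixes G :: "_ \<Rightarrow> _ \<Rightarrow> 'k"
  assumes "\<And>m. m \<in> space M \<Longrightarrow> \<phi> m \<in> space N" "m \<in> space M" "bil N G"
  shows "ev N (cob_theta \<phi> m) G = rho N (\<phi> m) G - rho M m (\<lambda>x u. G (\<phi> x) u)"
  unfolding cob_theta_def using assms
  by (simp add: ev_diff push_in ev_push vM vN yd_coact_in M N)

lemma datum_cob:
  assumes \<phi>: "lin_on (space M) (scale M) (scale N) \<phi>" "\<And>m. m \<in> space M \<Longrightarrow> \<phi> m \<in> space N"
  shows "datum M N (cob_theta \<phi>) (cob_omega \<phi>)"
  unfolding datum_def
proof (intro conjI allI ballI cob_theta_in \<phi>)
  interpret Nv: vector_space "scale N" using vN by (simp add: vsub_def)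
  show "lin_on (space M) (scale M) fscale (cob_theta \<phi>)"
  proof (rule tensor_lin)
    fix G assume G: "bil N (G :: _ \<Rightarrow> _ \<Rightarrow> 'k)"
    have "lin_on (space M) (scale M) (*) (\<lambda>m. rho N (\<phi> m) G - rho M m (\<lambda>x u. G (\<phi> x) u))"
      by (intro lin_on_minus_fun rho_lin[OF M] bil_comp[OF G \<phi>] lin_on_comp[OF rho_lin[OF N G] \<phi>])
    thus "lin_on (space M) (scale M) (*) (\<lambda>m. ev N (cob_theta \<phi> m) G)"
      by (simp add: lin_on_def ev_cob_theta \<phi> G vsub_add vsub_scale vM)
  qed (simp_all add: cob_theta_in \<phi> vsub_add vsub_scale vM)
  show "cob_omega \<phi> a m \<in> space N" if "m \<in> space M" for a m
    using that by (simp add: cob_omega_def vsub_diff vN yd_act_in M N \<phi>)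
  show "lin_on (space M) (scale M) (scale N) (cob_omega \<phi> a)" for a
    by (simp add: lin_on_def cob_omega_def \<phi> yd_act_in M lin_on_add[OF \<phi>(1)] lin_on_scale[OF \<phi>(1)]
        lin_on_add[OF yd_act_lin[OF M]] lin_on_scale[OF yd_act_lin[OF M]]
        lin_on_add[OF yd_act_lin[OF N]] lin_on_scale[OF yd_act_lin[OF N]] Nv.scale_right_diff_distrib)
  show "lin_on UNIV (bscale A) (scale N) (\<lambda>a. cob_omega \<phi> a m)" if "m \<in> space M" for m
    using that by (simp add: lin_on_def cob_omega_def \<phi> yd_act_in M lin_on_add[OF \<phi>(1)] lin_on_scale[OF \<phi>(1)]
        lin_on_add[OF yd_act_lin_alg[OF M]] lin_on_scale[OF yd_act_lin_alg[OF M]]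
        lin_on_add[OF yd_act_lin_alg[OF N]] lin_on_scale[OF yd_act_lin_alg[OF N]] Nv.scale_right_diff_distrib)
qed

lemma datum_zero: "datum M N (\<lambda>_. 0) (\<lambda>_ _. 0)"
proof -
  interpret Nv: vector_space "scale N" using vN by (simp add: vsub_def)
  show ?thesis by (simp add: datum_def tspace_0 vsub_0 vN lin_on_def fscale_def fun_eq_iff)
qed

lemma cocycle_zero: "cocycle M N (\<lambda>_. 0) (\<lambda>_ _. 0)"
proof -
  have "bil N (\<lambda>y u. rho N y (\<lambda>z v. G z v u))" if "tril N G" for G
    by (rule bil_rho_tril) (simp_all add: vN yd_coact_in N yd_coact_lin that)
  moreover have "G 0 = (\<lambda>_. 0)" if "bil N G" for G
    by (rule ext) (rule lin_on_0[OF bilD2[OF that] vsub_0[OF vN]])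
  moreover have "bil N (\<lambda>y u. G (act N b y) (c * u))" if "bil N G" for G b c
    by (rule bil_act[OF N bil_mult_left[OF that]])
  ultimately show ?thesis
    by (simp add: cocycle_def act_0 ev_zero vN tril_bil ev_zero_fun bil_sd_tril
        bil_mult_right rho_0)
qed

lemma lin_on_uminus:
  assumes "lin_on (space M) (scale M) (scale N) \<phi>"
  shows "lin_on (space M) (scale M) (scale N) (\<lambda>m. - \<phi> m)"
proof -
  interpret Nv: vector_space "scale N" using vN by (simp add: vsub_def)
  show ?thesis using assms by (simp add: lin_on_def)
qed

text \<open>
  Coboundaries are cocycles because shearing the split extension along \<open>- \<phi>\<close> transports its
  Yetter-Drinfel'd structure to the twisted one.
\<close>

lemma cocycle_cob:
  assumes \<phi>: "lin_on (space M) (scale M) (scale N) \<phi>" "\<And>m. m \<in> space M \<Longrightarrow> \<phi> m \<in> space N"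
  shows "cocycle M N (cob_theta \<phi>) (cob_omega \<phi>)"
proof (rule shear(1)[OF datum_zero cocycle_zero datum_cob[OF \<phi>]])
  have 1: "rho M m (\<lambda>x u. G (- \<phi> x) u) = - rho M m (\<lambda>x u. G (\<phi> x) u)"
    if "m \<in> space M" "bil N G" for m and G :: "_ \<Rightarrow> _ \<Rightarrow> 'k"
  proof -
    have "rho M m (\<lambda>x u. G (- \<phi> x) u) = rho M m (\<lambda>x u. (- 1) * G (\<phi> x) u)"
      by (rule ev_cong)
        (use that in \<open>simp_all add: vM yd_coact_in M \<phi> lin_on_minus[OF bilD2[OF that(2)] vN]\<close>)
    thus ?thesis unfolding ev_mult by simp
  qed
  show "cobound (\<lambda>_. 0) (\<lambda>_ _. 0) (cob_theta \<phi>) (cob_omega \<phi>) (\<lambda>m. - \<phi> m)"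
    unfolding cobound_def using \<phi>
    by (auto simp: vsub_minus vN lin_on_uminus cob_omega_def lin_on_minus[OF yd_act_lin[OF N] vN] ev_zero
        ev_cob_theta 1 lin_on_minus[OF rho_lin[OF N] vN])
qed

text \<open>Against the zero pair, the equations of \<open>cobound\<close> can be solved for
  \<open>\<theta>\<close> and \<open>\<omega>\<close>: they must be \<open>cob_theta \<phi>\<close>
  and \<open>cob_omega \<phi>\<close>. So the coboundaries are the cochains whose twisted extension
  is sheared to the split one.\<close>

lemma cobound_zero_iff:
  assumes F: "F \<in> Tot A M N 1"
  shows "(\<exists>\<phi>. cobound (theta_of F) (omega_of F) (\<lambda>_. 0) (\<lambda>_ _. 0) \<phi>) \<longleftrightarrow> F \<in> coboundaries A M N 1"
proof
  note d = Tot_datum[OF F]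
  assume "\<exists>\<phi>. cobound (theta_of F) (omega_of F) (\<lambda>_. 0) (\<lambda>_ _. 0) \<phi>"
  then obtain \<phi> where cb: "cobound (theta_of F) (omega_of F) (\<lambda>_. 0) (\<lambda>_ _. 0) \<phi>" ..
  have \<phi>: "lin_on (space M) (scale M) (scale N) \<phi>" "\<And>m. m \<in> space M \<Longrightarrow> \<phi> m \<in> space N"
    and c1: "\<And>a m. m \<in> space M \<Longrightarrow> omega_of F a m + \<phi> (act M a m) = act N a (\<phi> m) + 0"
    and c2: "\<And>m G::'n \<Rightarrow> 'a \<Rightarrow> 'k. m \<in> space M \<Longrightarrow> bil N G \<Longrightarrow>
        ev N (theta_of F m) G + rho M m (\<lambda>x u. G (\<phi> x) u) = rho N (\<phi> m) G + ev N 0 G"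
    using cb unfolding cobound_def by blast+
  have "omega_of F a m = cob_omega \<phi> a m" if "m \<in> space M" for a m
    using c1[OF that, of a] by (simp add: cob_omega_def eq_diff_eq)
  moreover have "theta_of F m = cob_theta \<phi> m" if "m \<in> space M" for m
    by (rule ev_eqI[OF vN])
      (use that c2[OF that] in \<open>simp_all add: datumD[OF d] cob_theta_in \<phi> ev_cob_theta ev_zero vN eq_diff_eq\<close>)
  ultimately have "F = cochain_of (cob_theta \<phi>) (cob_omega \<phi>)"
    using Tot_eq_cochain_of[OF F] cochain_of_cong[of "theta_of F" "cob_theta \<phi>" "omega_of F" "cob_omega \<phi>"] by simp
  thus "F \<in> coboundaries A M N 1" unfolding coboundaries_1 using \<phi> by blast
next
  assume "F \<in> coboundaries A M N 1"
  then obtain \<phi> where FF: "F = cochain_of (cob_theta \<phi>) (cob_omega \<phi>)" and \<phi>: "lin_on (space M) (scale M) (scale N) \<phi>"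
    "\<And>m. m \<in> space M \<Longrightarrow> \<phi> m \<in> space N"
    unfolding coboundaries_1 by blast
  have "cobound (theta_of F) (omega_of F) (\<lambda>_. 0) (\<lambda>_ _. 0) \<phi>"
    unfolding cobound_def
    using \<phi> by (simp add: FF cochain_of_Tot[OF datum_cob[OF \<phi>]] ev_cob_theta ev_zero vN cob_omega_def)
  thus "\<exists>\<phi>. cobound (theta_of F) (omega_of F) (\<lambda>_. 0) (\<lambda>_ _. 0) \<phi>" by blast
qed

lemma cocycles_1_iff: "F \<in> cocycles A M N 1 \<longleftrightarrow> F \<in> Tot A M N 1 \<and> cocycle M N (theta_of F) (omega_of F)"
  using tot_d_1_eq_0_iff by (auto simp: cocycles_def)

lemma theta_of_omega_of_add_diff:
  assumes F: "F \<in> Tot A M N 1" and G: "G \<in> Tot A M N 1"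
  shows "theta_of (F + G) = (\<lambda>m. theta_of F m + theta_of G m)" "omega_of (F + G) = (\<lambda>a m. omega_of F a m + omega_of G a m)"
    "theta_of (F - G) = (\<lambda>m. theta_of F m - theta_of G m)" "omega_of (F - G) = (\<lambda>a m. omega_of F a m - omega_of G a m)"
proof -
  have add: "un0 N (s + t) = un0 N s + un0 N t" if "s \<in> tspace (MA A N 0)" "t \<in> tspace (MA A N 0)" for s t
    by (rule lin_on_add[OF un0_lin[OF vN] that])
  have diff: "un0 N (s - t) = un0 N s - un0 N t" if "s \<in> tspace (MA A N 0)" "t \<in> tspace (MA A N 0)" for s t
    using add[OF tspace_diff[OF that] that(2)] by (simp add: eq_diff_eq)
  note i = Yhom_in[OF Tot_1D(2)[OF F]] Yhom_in[OF Tot_1D(2)[OF G]]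
  show "theta_of (F + G) = (\<lambda>m. theta_of F m + theta_of G m)" "theta_of (F - G) = (\<lambda>m. theta_of F m - theta_of G m)"
    by (simp_all add: theta_def fun_eq_iff)
  show "omega_of (F + G) = (\<lambda>a m. omega_of F a m + omega_of G a m)" "omega_of (F - G) = (\<lambda>a m. omega_of F a m - omega_of G a m)"
    by (rule ext, rule ext, simp add: omega_def add diff i pure_AM_in)+
qed

lemma Yhom_add_diff:
  assumes "f \<in> Yhom A M N n p" "g \<in> Yhom A M N n p"
  shows "f + g \<in> Yhom A M N n p" "f - g \<in> Yhom A M N n p"
proof -
  interpret F: vector_space "fscale :: 'k \<Rightarrow> (('n \<times> 'a list \<Rightarrow> 'k) \<Rightarrow> 'k) \<Rightarrow> _" by (rule vector_space_fscale)
  note f = Yhom_in[OF assms(1)] Yhom_off[OF assms(1)] Yhom_lin[OF assms(1)]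
  note g = Yhom_in[OF assms(2)] Yhom_off[OF assms(2)] Yhom_lin[OF assms(2)]
  have "lin_on (tspace (AM A n M)) fscale fscale (f + g)" "lin_on (tspace (AM A n M)) fscale fscale (f - g)"
    using f(3) g(3) unfolding lin_on_def by (simp_all add: F.scale_right_distrib F.scale_right_diff_distrib)
  moreover have "(f + g) t \<in> tspace (MA A N p)" "(f - g) t \<in> tspace (MA A N p)"
    if "t \<in> tspace (AM A n M)" for t
    using f(1)[OF that] g(1)[OF that] by (simp_all add: tspace_add tspace_diff)
  moreover have "(f + g) t = 0" "(f - g) t = 0" if "t \<notin> tspace (AM A n M)" for t
    using f(2)[OF that] g(2)[OF that] by simp_all
  ultimately show "f + g \<in> Yhom A M N n p" "f - g \<in> Yhom A M N n p"
    unfolding Yhom_def by blast+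
qed

lemma cocycles_1_closed:
  assumes F: "F \<in> cocycles A M N 1" and G: "G \<in> cocycles A M N 1"
  shows "F + G \<in> cocycles A M N 1" "F - G \<in> cocycles A M N 1"
proof -
  have FT: "F \<in> Tot A M N 1" "G \<in> Tot A M N 1" and c: "cocycle M N (theta_of F) (omega_of F)" "cocycle M N (theta_of G) (omega_of G)"
    using F G by (simp_all add: cocycles_1_iff)
  have t: "F + G \<in> Tot A M N 1" "F - G \<in> Tot A M N 1"
    by (rule Tot_1I; use Tot_1D[OF FT(1)] Tot_1D[OF FT(2)] in \<open>simp add: Yhom_add_diff\<close>)+
  have "cocycle M N (theta_of (F + G)) (omega_of (F + G))"
    unfolding theta_of_omega_of_add_diff[OF FT] by (rule cocycle_add[OF Tot_datum[OF FT(1)] c(1) Tot_datum[OF FT(2)] c(2)])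
  thus "F + G \<in> cocycles A M N 1" using t by (simp add: cocycles_1_iff)
  interpret Nv: vector_space "scale N" using vN by (simp add: vsub_def)
  have "fscale (- 1) t = - t" for t :: "('n \<times> 'a list, 'k) tensor" by (simp add: fscale_def fun_eq_iff)
  hence "cocycle M N (theta_of (F - G)) (omega_of (F - G))"
    unfolding theta_of_omega_of_add_diff[OF FT]
    using cocycle_lincomb[OF Tot_datum[OF FT(1)] c(1) Tot_datum[OF FT(2)] c(2), of "- 1"] by simp
  thus "F - G \<in> cocycles A M N 1" using t by (simp add: cocycles_1_iff)
qed

abbreviation "zero_fam \<equiv> (0 :: nat \<Rightarrow> ('m, 'n, 'a, 'k) ymap)"

lemma theta_omega_0: "theta (0 :: ('m, 'n, 'a, 'k) ymap) = (\<lambda>_. 0)" "omega 0 = (\<lambda>_ _. 0)"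
  using lin_on_0[OF un0_lin[OF vN] tspace_0] by (auto simp: theta_def omega_def fun_eq_iff)

lemma theta_of_omega_of_0: "theta_of zero_fam = (\<lambda>_. 0)" "omega_of zero_fam = (\<lambda>_ _. 0)"
  by (simp_all add: theta_omega_0)

lemma zero_cocycle: "zero_fam \<in> cocycles A M N 1"
proof -
  have "0 \<in> Yhom A M N n p" for n p
    by (auto simp: Yhom_def tspace_0 lin_on_def fscale_def fun_eq_iff)
  hence "zero_fam \<in> Tot A M N 1" by (simp add: Tot_def)
  thus ?thesis by (simp add: cocycles_1_iff theta_omega_0 cocycle_zero)
qed

section \<open>The isomorphism\<close>

definition Z1 :: "(nat \<Rightarrow> ('m, 'n, 'a, 'k) ymap) monoid" where
  "Z1 = \<lparr>carrier = cocycles A M N 1, mult = (+), one = 0\<rparr>"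

lemma group_Z1: "group Z1"
proof (rule groupI)
  show "\<exists>y\<in>carrier Z1. y \<otimes>\<^bsub>Z1\<^esub> x = \<one>\<^bsub>Z1\<^esub>" if "x \<in> carrier Z1" for x
    using that cocycles_1_closed(2)[OF zero_cocycle] by (intro bexI[of _ "0 - x"]) (auto simp: Z1_def)
qed (auto simp: Z1_def cocycles_1_closed zero_cocycle add.assoc)

definition ext_of :: "(nat \<Rightarrow> ('m, 'n, 'a, 'k) ymap) \<Rightarrow> ('n \<times> 'm, 'm, 'n, 'a, 'k) ext" where
  "ext_of F = tw_ext (theta_of F) (omega_of F)"

text \<open>The representative \<open>ext_of F\<close> lives on \<open>'n \<times> 'm\<close> and
  the members of the class on \<open>'e\<close>; the class is cut out by equivalence with an
  extension of another type.\<close>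

definition ext_class :: "(nat \<Rightarrow> ('m, 'n, 'a, 'k) ymap) \<Rightarrow> ('e::ab_group_add, 'm, 'n, 'a, 'k) ext set" where
  "ext_class F = {X \<in> extensions A M N. ext_equiv A M N (ext_of F) X}"

lemma cocycleD:
  assumes "F \<in> cocycles A M N 1"
  shows "datum M N (theta_of F) (omega_of F)" "cocycle M N (theta_of F) (omega_of F)" "F \<in> Tot A M N 1"
  using assms Tot_datum by (simp_all add: cocycles_1_iff)

lemma ext_of_extension: "F \<in> cocycles A M N 1 \<Longrightarrow> ext_of F \<in> extensions A M N"
  unfolding ext_of_def by (intro tw_extension cocycleD)

lemma ex_ext_class:
  assumes X: "X \<in> extensions A M N"
  shows "\<exists>F\<in>cocycles A M N 1. X \<in> ext_class F"
proof -
  obtain E i p where E: "X = (E, i, p)" by (metis prod_cases3)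
  obtain \<theta> \<omega> where d: "datum M N \<theta> \<omega>" and c: "cocycle M N \<theta> \<omega>" and eq: "ext_equiv A M N (tw_ext \<theta> \<omega>) X"
    using extension_is_twisted X unfolding E by blast
  note F = cochain_of_Tot[OF d]
  let ?F = "cochain_of \<theta> \<omega>"
  \<comment> \<open>The pair recovered from the cochain agrees with
    \<open>(\<theta>, \<omega>)\<close> on \<open>space M\<close> only, so the two twisted modules
    may differ as records; the shear along 0 identifies them.\<close>
  have "cobound \<theta> \<omega> (theta_of ?F) (omega_of ?F) (\<lambda>_. 0)"
  proof -
    have "G 0 = (\<lambda>_. 0)" if "bil N G" for G
      by (rule ext) (rule lin_on_0[OF bilD2[OF that] vsub_0[OF vN]])
    thus ?thesis
      unfolding cobound_def
      by (simp add: vsub_0 vN F act_0 ev_zero_fun rho_0 scale_0 lin_on_def)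
  qed
  note sh = shear[OF d c Tot_datum[OF F(1)] this]
  have Fc: "?F \<in> cocycles A M N 1" using sh(1) F(1) by (simp add: cocycles_1_iff)
  have tE: "tw_ext \<theta> \<omega> \<in> extensions A M N" by (rule tw_extension[OF d c])
  have "ext_equiv A M N (ext_of ?F) (tw_ext \<theta> \<omega>)"
    using ext_equiv_sym[OF tE ext_of_extension[OF Fc]] sh(2) by (simp add: ext_of_def)
  hence "X \<in> ext_class ?F"
    using ext_equiv_trans[OF ext_of_extension[OF Fc] tE X _ eq] X by (simp add: ext_class_def)
  thus ?thesis using Fc by blast
qed

lemma ext_class_eq:
  assumes F: "F \<in> cocycles A M N 1" and X: "X \<in> ext_class F"
  shows "{Y \<in> extensions A M N. ext_equiv A M N X Y} = ext_class F"
proof -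
  have X': "X \<in> extensions A M N" "ext_equiv A M N (ext_of F) X" using X by (auto simp: ext_class_def)
  note s = ext_equiv_sym[OF ext_of_extension[OF F] X']
  show ?thesis
    using ext_equiv_trans[OF ext_of_extension[OF F] X'(1) _ X'(2)] ext_equiv_trans[OF X'(1) ext_of_extension[OF F] _ s]
    by (auto simp: ext_class_def)
qed

text \<open>Membership in the two classes supplies the trivialisations. As the right-hand side
  mentions \<open>F + G\<close> only, being a Baer sum of \<open>X\<close> and \<open>Y\<close>
  depends on their classes alone; the product set in \<open>Ext1\<close> is therefore a single
  class.\<close>

lemma ext_class_baer:
  assumes F: "F \<in> cocycles A M N 1" and G: "G \<in> cocycles A M N 1"
    and X: "X \<in> ext_class F" and Y: "Y \<in> ext_class G" and Z: "Z \<in> extensions A M N"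
  shows "is_baer_sum A M N X Y Z \<longleftrightarrow> Z \<in> ext_class (F + G)"
proof -
  obtain E\<^sub>1 i\<^sub>1 p\<^sub>1 E\<^sub>2 i\<^sub>2 p\<^sub>2 E i p where XYZ: "X = (E\<^sub>1, i\<^sub>1, p\<^sub>1)" "Y = (E\<^sub>2, i\<^sub>2, p\<^sub>2)" "Z = (E, i, p)"
    by (metis prod_cases3)
  have e: "(E\<^sub>1, i\<^sub>1, p\<^sub>1) \<in> extensions A M N" "(E\<^sub>2, i\<^sub>2, p\<^sub>2) \<in> extensions A M N" "(E, i, p) \<in> extensions A M N"
    using X Y Z by (auto simp: ext_class_def XYZ)
  obtain f where f: "yd_hom A (tw M N (theta_of F) (omega_of F)) E\<^sub>1 f" "bij_betw f (space N \<times> space M) (space E\<^sub>1)"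
      "\<And>n. n \<in> space N \<Longrightarrow> f (n, 0) = i\<^sub>1 n"
      "\<And>n m. n \<in> space N \<Longrightarrow> m \<in> space M \<Longrightarrow> p\<^sub>1 (f (n, m)) = m"
    using X unfolding ext_class_def ext_of_def tw_ext_def XYZ ext_equiv_def by (auto simp: tw_simps)
  obtain g where g: "yd_hom A (tw M N (theta_of G) (omega_of G)) E\<^sub>2 g" "bij_betw g (space N \<times> space M) (space E\<^sub>2)"
      "\<And>n. n \<in> space N \<Longrightarrow> g (n, 0) = i\<^sub>2 n"
      "\<And>n m. n \<in> space N \<Longrightarrow> m \<in> space M \<Longrightarrow> p\<^sub>2 (g (n, m)) = m"
    using Y unfolding ext_class_def ext_of_def tw_ext_def XYZ ext_equiv_def by (auto simp: tw_simps)
  note c = cocycleD[OF F] cocycleD[OF G]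
  show ?thesis
    unfolding XYZ ext_class_def ext_of_def theta_of_omega_of_add_diff[OF c(3,6)]
    using baer_sum_imp_equiv[OF e(1,2) c(1,2,4,5) f g e(3)]
      equiv_imp_baer_sum[OF e(1,2) c(1,2,4,5) f g e(3)] e(3) by blast
qed

section \<open>Classes in the universe given by the embedding \<open>j\<close>\<close>

context
  fixes scale_e :: "'k \<Rightarrow> 'e::ab_group_add \<Rightarrow> 'e" and j :: "'n \<times> 'm \<Rightarrow> 'e"
  assumes j: "Vector_Spaces.linear (scale (yd_sum A N M)) scale_e j" "inj_on j (space (yd_sum A N M))"
begin

abbreviation "Ext \<equiv> (Ext1 A M N :: ('e, 'm, 'n, 'a, 'k) ext set monoid)"

text \<open>An empty class would not be an element of the quotient, and could not determine its
  cocycle up to a coboundary.\<close>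

lemma ext_class_nonempty: "F \<in> cocycles A M N 1 \<Longrightarrow> \<exists>X. X \<in> (ext_class F :: ('e, 'm, 'n, 'a, 'k) ext set)"
  using extension_in_universe[OF j cocycleD(1)[of F] cocycleD(2)[of F]] by (auto simp: ext_class_def ext_of_def)

lemma ext_class_carrier: "carrier Ext = ext_class ` cocycles A M N 1"
proof -
  let ?R = "{(X, Y). X \<in> extensions A M N \<and> Y \<in> extensions A M N \<and> ext_equiv A M N X Y} ::
    (('e, 'm, 'n, 'a, 'k) ext \<times> ('e, 'm, 'n, 'a, 'k) ext) set"
  have R: "?R `` {X} = ext_class F" if "F \<in> cocycles A M N 1" "X \<in> ext_class F" for X F
    using ext_class_eq[OF that] that(2) by (auto simp: ext_class_def)
  have "extensions A M N // ?R = ext_class ` cocycles A M N 1"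
  proof (intro equalityI subsetI)
    fix C assume "C \<in> extensions A M N // ?R"
    then obtain X where X: "X \<in> extensions A M N" "C = ?R `` {X}" by (rule quotientE)
    obtain F where "F \<in> cocycles A M N 1" "X \<in> ext_class F" using ex_ext_class[OF X(1)] by blast
    thus "C \<in> ext_class ` cocycles A M N 1" using R X(2) by blast
  next
    fix C :: "('e, 'm, 'n, 'a, 'k) ext set" assume "C \<in> ext_class ` cocycles A M N 1"
    then obtain F where F: "F \<in> cocycles A M N 1" "C = ext_class F" by blast
    obtain X where X: "X \<in> (ext_class F :: ('e, 'm, 'n, 'a, 'k) ext set)" using ext_class_nonempty[OF F(1)] by blast
    hence "X \<in> extensions A M N" by (simp add: ext_class_def)
    hence "?R `` {X} \<in> extensions A M N // ?R" by (rule quotientI)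
    thus "C \<in> extensions A M N // ?R" unfolding R[OF F(1) X] F(2) .
  qed
  thus ?thesis by (simp add: Ext1_def)
qed

text \<open>By \<open>ext_class_baer\<close> all pairs of members have the same Baer sums, so one
  pair decides; nonemptiness provides it.\<close>

lemma ext_class_mult:
  assumes F: "F \<in> cocycles A M N 1" and G: "G \<in> cocycles A M N 1"
  shows "ext_class (F + G) = ext_class F \<otimes>\<^bsub>Ext\<^esub> ext_class G"
proof -
  obtain X Y where XY: "X \<in> (ext_class F :: ('e, 'm, 'n, 'a, 'k) ext set)" "Y \<in> (ext_class G :: ('e, 'm, 'n, 'a, 'k) ext set)"
    using ext_class_nonempty F G by blast
  have "ext_class F \<otimes>\<^bsub>Ext\<^esub> ext_class G = {Z \<in> extensions A M N. \<exists>X\<in>ext_class F. \<exists>Y\<in>ext_class G. is_baer_sum A M N X Y Z}"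
    by (simp add: Ext1_def)
  also have "\<dots> = {Z \<in> extensions A M N. Z \<in> ext_class (F + G)}"
    using ext_class_baer[OF F G] XY by blast
  finally show ?thesis by (auto simp: ext_class_def)
qed

lemma ext_class_one: "ext_class zero_fam = \<one>\<^bsub>Ext\<^esub>"
  by (simp add: ext_class_def Ext1_def ext_of_def theta_omega_0 tw_ext_def tw_zero)

lemma ext_class_hom: "ext_class \<in> hom Z1 Ext"
  by (auto simp: hom_def ext_class_carrier ext_class_mult Z1_def)

text \<open>The image of a group under a multiplicative map is a group, and \<open>ext_class\<close>
  is onto. Associativity and inverses for the Baer sum thus come from addition of cocycles, without
  a diagram chase.\<close>

lemma group_Ext: "group Ext"
proof -
  have "Ext\<lparr>carrier := ext_class ` carrier Z1, one := ext_class \<one>\<^bsub>Z1\<^esub>\<rparr> = Ext"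
    using ext_class_carrier ext_class_one by (simp add: Z1_def)
  thus ?thesis using group.hom_imp_img_group[OF group_Z1 ext_class_hom] by simp
qed

lemma ext_class_kernel: "kernel Z1 Ext ext_class = coboundaries A M N 1"
proof -
  have "ext_class F = (ext_class zero_fam :: ('e, 'm, 'n, 'a, 'k) ext set) \<longleftrightarrow> F \<in> coboundaries A M N 1"
    if F: "F \<in> cocycles A M N 1" for F
  proof -
    note z = zero_cocycle
    have "ext_class F = (ext_class zero_fam :: ('e, 'm, 'n, 'a, 'k) ext set) \<longleftrightarrow> ext_equiv A M N (ext_of F) (ext_of zero_fam)"
    proof
      assume eq: "ext_class F = (ext_class zero_fam :: ('e, 'm, 'n, 'a, 'k) ext set)"
      \<comment> \<open>Equal classes are compared through a common member on
        \<open>'e\<close>.\<close>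
      obtain X :: "('e, 'm, 'n, 'a, 'k) ext" where X: "X \<in> ext_class F" using ext_class_nonempty[OF F] by blast
      hence "X \<in> extensions A M N" "ext_equiv A M N (ext_of F) X" "ext_equiv A M N (ext_of zero_fam) X"
        using eq by (auto simp: ext_class_def)
      thus "ext_equiv A M N (ext_of F) (ext_of zero_fam)"
        using ext_equiv_trans[OF ext_of_extension[OF F] _ ext_of_extension[OF z]] ext_equiv_sym[OF ext_of_extension[OF z]] by blast
    next
      assume eq: "ext_equiv A M N (ext_of F) (ext_of zero_fam)"
      note eq' = ext_equiv_sym[OF ext_of_extension[OF F] ext_of_extension[OF z] eq]
      show "ext_class F = (ext_class zero_fam :: ('e, 'm, 'n, 'a, 'k) ext set)"
        using ext_equiv_trans[OF ext_of_extension[OF F] ext_of_extension[OF z] _ eq]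
          ext_equiv_trans[OF ext_of_extension[OF z] ext_of_extension[OF F] _ eq'] by (auto simp: ext_class_def)
    qed
    also have "\<dots> \<longleftrightarrow> (\<exists>\<phi>. cobound (theta_of F) (omega_of F) (\<lambda>_. 0) (\<lambda>_ _. 0) \<phi>)"
      unfolding ext_of_def theta_of_omega_of_0
      by (rule tw_ext_equiv_iff[OF cocycleD(1,2)[OF F] datum_zero cocycle_zero])
    also have "\<dots> \<longleftrightarrow> F \<in> coboundaries A M N 1" by (rule cobound_zero_iff[OF cocycleD(3)[OF F]])
    finally show ?thesis .
  qed
  \<comment> \<open>The kernel is by definition a set of cocycles, so the coboundaries have to be
    cocycles as well.\<close>
  moreover have "coboundaries A M N 1 \<subseteq> cocycles A M N 1"
  proof
    fix C assume C: "C \<in> coboundaries A M N 1"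
    then obtain \<phi> where FF: "C = cochain_of (cob_theta \<phi>) (cob_omega \<phi>)" and \<phi>: "lin_on (space M) (scale M) (scale N) \<phi>"
      "\<And>m. m \<in> space M \<Longrightarrow> \<phi> m \<in> space N"
      unfolding coboundaries_1 by blast
    note m = cochain_of_Tot[OF datum_cob[OF \<phi>]]
    \<comment> \<open>The shear along 0 again passes from a pair to the pair recovered from its
      cochain, which agrees with it on \<open>space M\<close>.\<close>
    have "cobound (cob_theta \<phi>) (cob_omega \<phi>) (theta_of C) (omega_of C) (\<lambda>_. 0)"
    proof -
      have "G 0 = (\<lambda>_. 0)" if "bil N G" for G
        by (rule ext) (rule lin_on_0[OF bilD2[OF that] vsub_0[OF vN]])
      thus ?thesis
        unfolding cobound_def FF
        by (simp add: vsub_0 vN m act_0 ev_zero_fun rho_0 scale_0 lin_on_def)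
    qed
    hence "cocycle M N (theta_of C) (omega_of C)"
      using shear(1)[OF datum_cob[OF \<phi>] cocycle_cob[OF \<phi>] Tot_datum] m(1) FF by blast
    thus "C \<in> cocycles A M N 1" using m(1) FF by (simp add: cocycles_1_iff)
  qed
  ultimately show ?thesis
    unfolding kernel_def ext_class_one[symmetric] by (auto simp: Z1_def)
qed

text \<open>The first isomorphism theorem. That the coboundaries are the kernel of
  \<open>ext_class\<close> also makes them normal, so that the quotient is a group.\<close>

lemma Hcoh_Ext: "group (Hcoh A M N 1)" "Hcoh A M N 1 \<cong> Ext"
proof -
  interpret group_hom Z1 Ext ext_class
    by (intro group_hom.intro group_hom_axioms.intro group_Z1 group_Ext ext_class_hom)
  have H: "Hcoh A M N 1 = Z1 Mod (kernel Z1 Ext ext_class)"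
    by (simp add: Hcoh_def Z1_def[symmetric] ext_class_kernel)
  show "group (Hcoh A M N 1)"
    unfolding H by (rule normal.factorgroup_is_group[OF normal_kernel])
  show "Hcoh A M N 1 \<cong> Ext"
    unfolding H by (rule FactGroup_iso) (simp add: ext_class_carrier, simp add: Z1_def)
qed

end

end

theorem proposition1:
  fixes A :: "('a::ring_1, 'k::field) bialg"
    and M :: "('m::ab_group_add, 'a, 'k) yd"
    and N :: "('n::ab_group_add, 'a, 'k) yd"
    and scale_e :: "'k \<Rightarrow> 'e::ab_group_add \<Rightarrow> 'e"
    and j :: "'n \<times> 'm \<Rightarrow> 'e"
  assumes "bialgebra A" and "yd_module A M" and "yd_module A N"
    and universe: "Vector_Spaces.linear (scale (yd_sum A N M)) scale_e j"
      "inj_on j (space (yd_sum A N M))"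
  shows "group (Hcoh A M N 1) \<and>
    group (Ext1 A M N :: ('e, 'm, 'n, 'a, 'k) ext set monoid) \<and>
    Hcoh A M N 1 \<cong> (Ext1 A M N :: ('e, 'm, 'n, 'a, 'k) ext set monoid)"
proof -
  interpret yd_pair A M N by unfold_locales fact+
  show ?thesis
    using Hcoh_Ext[OF universe] group_Ext[OF universe] by blast
qed

end
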